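(* Let $K$ be a field and let $\mathcal{H}=(\mathcal{H},*,\Delta)$ be a bialgebra over $K$. The following are equivalent: (a) $\mathcal{H}$ is a connected 2-associative bialgebra, i.e. $\mathcal H$ is connected and there is an associative product $\cdot$ on $\mathcal H$ such that $(\mathcal H,*,\cdot,\Delta)$ is a 2-associative bialgebra; (b) $\mathcal{H}$ is isomorphic to $U2(\mathrm{Prim}\,\mathcal{H})$ as a 2-associative bialgebra, i.e. there is an associative product $\cdot$ on $\mathcal H$ such that $(\mathcal H,*,\cdot,\Delta)$ is a 2-associative bialgebra and, for the resulting $B_\infty$-algebra structure on $\mathrm{Prim}\,\mathcal H$, there is an isomorphism of 2-associative bialgebras $\mathcal H\cong U2(\mathrm{Prim}\,\mathcal H)$; (c) $\mathcal{H}$ is cofree among the connected coalgebras, i.e. $\mathcal H$ is isomorphic as a coalgebra to the tensor coalgebra $T^c(\mathrm{Prim}\,\mathcal H)$.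
   Context: All vector spaces are over a field $K$ of arbitrary characteristic. Bialgebras are unital, counital, associative and coassociative. Connectedness and primitives. For a counital coassociative coalgebra with distinguished element $1$ such that $\Delta(1)=1\otimes 1$, put $\overline\Delta(x)=\Delta(x)-x\otimes 1-1\otimes x$. $\mathrm{Prim}\,\mathcal H$ is the space of $x$ with $\overline\Delta(x)=0$. Put $F_0\mathcal H=K1$, $F_r\mathcal H=\{x:\overline\Delta(x)\in F_{r-1}\mathcal H\otimes F_{r-1}\mathcal H\}$; $\mathcal H$ is connected if $\mathcal H=\bigcup_r F_r\mathcal H$. Tensor coalgebra. $T^c(V)=\bigoplus_{n\ge0}V^{\otimes n}$ with the deconcatenation coproduct $\Delta(v_1\cdots v_n)=\sum_{i=0}^n v_1\cdots v_i\otimes v_{i+1}\cdots v_n$. 2-associative algebra. A vector space with two associative products $*$ and $\cdot$ having a common unit $1$. $2as(V)$ denotes the free (unital) 2-associative algebra on the vector space $V$. 2-associative bialgebra. $(\mathcal H,*,\cdot,\Delta)$ such that $(\mathcal H,*,\Delta)$ is a bialgebra in the usual sense and $(\mathcal H,\cdot,\Delta)$ is a unital infinitesimal bialgebra: $\cdot$ is unital associative, $\Delta$ is counital coassociative, and $\Delta(x\cdot y)=(x\otimes1)\cdot\Delta(y)+\Delta(x)\cdot(1\otimes y)-x\otimes y$, where $(a\otimes b)\cdot(a'\otimes b')=a\cdot a'\otimes b\cdot b'$. (The units of $*$ and $\cdot$ coincide.) $B_\infty$-algebra. A vector space $R$ with linear maps $M_{pq}:R^{\otimes p}\otimes R^{\otimes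 q}\to R$ ($p,q\ge0$) with $M_{00}=0$, $M_{10}=M_{01}=\mathrm{Id}$, $M_{n0}=M_{0n}=0$ for $n\ge2$, satisfying for all $i,j,k\ge1$ the relation $$\sum_{l=1}^{i+j}\sum_{(\underline a,\underline b)}M_{lk}\circ(M^l_{(\underline a,\underline b)}\otimes\mathrm{Id}^{\otimes k})=\sum_{m=1}^{j+k}\sum_{(\underline b,\underline c)}M_{im}\circ(\mathrm{Id}^{\otimes i}\otimes M^m_{(\underline b,\underline c)}),$$ where the inner sum on the left runs over pairs of $l$-tuples of non-negative integers $\underline a,\underline b$ with $\sum a_s=i$, $\sum b_s=j$, the inner sum on the right over pairs of $m$-tuples of non-negative integers with $\sum b_s=j$, $\sum c_s=k$, and $M^l_{(\underline a,\underline b)}=M_{a_1b_1}\cdots M_{a_lb_l}:R^{\otimes p}\otimes R^{\otimes q}\to R^{\otimes l}$ (with $p=\sum a_s$, $q=\sum b_s$) sends $(u_1\cdots u_p,v_1\cdots v_q)$ to $M_{a_1b_1}(u_1\cdots u_{a_1},v_1\cdots v_{b_1})\otimes M_{a_2b_2}(u_{a_1+1}\cdots u_{a_1+a_2},v_{b_1+1}\cdots v_{b_1+b_2})\otimes\cdots\otimes M_{a_lb_l}(\cdots u_p,\cdots v_q)$. From 2-associative algebras to $B_\infty$-algebras. Any 2-associative algebra $(A,*,\cdot)$ becomes a $B_\infty$-algebra $A_{B_\infty}$ with operations defined inductively by $M_{00}=0$, $M_{10}=M_{01}=\mathrm{Id}$, $M_{n0}=M_{0n}=0$ for $n\geq 2$,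 and for $p,q\ge1$ $$M_{pq}(u_1\cdots u_p,v_1\cdots v_q)=(u_1\cdot\ldots\cdot u_p)*(v_1\cdot\ldots\cdot v_q)-\sum_{k\ge2}\sum_{(\underline i,\underline j)}\nu^{k-1}\big(M_{i_1j_1}\cdots M_{i_kj_k}(u_1\cdots u_p,v_1\cdots v_q)\big),$$ where $\sum i_s=p$, $\sum j_s=q$ and $\nu^{k-1}$ multiplies the $k$ tensor factors with $\cdot$. For a 2-associative bialgebra $\mathcal H$, $\mathrm{Prim}\,\mathcal H$ is a sub-$B_\infty$-algebra of $\mathcal H_{B_\infty}$. Universal enveloping 2-associative algebra. For a $B_\infty$-algebra $R$, $U2(R)$ is the quotient of $2as(R)$ by the 2-associative ideal generated by the elements $M_{pq}(r_1\cdots r_p,s_1\cdots s_q)-\widetilde M_{pq}(r_1\cdots r_p,s_1\cdots s_q)$, $r_i,s_j\in R$, where $M_{pq}$ is the operation of $R$ and $\widetilde M_{pq}$ that of $2as(R)_{B_\infty}$. $2as(R)$ has a unique coproduct making it a 2-associative bialgebra in which $R$ is primitive; it induces the 2-associative bialgebra structure on $U2(R)$. *)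

theory Defs
  imports Main "HOL.Vector_Spaces" "HOL-Library.Poly_Mapping"
begin

text \<open>
  A vector space over the field \<open>'k\<close> is given by a subspace of some type carrying a
  \<^locale>\<open>vector_space\<close> structure; only the elements of the carrier matter.
\<close>

record ('k, 'v) vspace =
  carr :: "'v set"
  scl :: "'k \<Rightarrow> 'v \<Rightarrow> 'v"

definition is_vspace :: "('k::field, 'v::ab_group_add, 'z) vspace_scheme \<Rightarrow> bool" where
  "is_vspace V \<longleftrightarrow> vector_space (scl V) \<and> module.subspace (scl V) (carr V)"

definition linear_map ::
  "('k::field, 'v::ab_group_add, 'y) vspace_scheme \<Rightarrow> ('k, 'w::ab_group_add, 'z) vspace_scheme
    \<Rightarrow> ('v \<Rightarrow> 'w) \<Rightarrow> bool" where
  "linear_map V W f \<longleftrightarrow>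
     (\<forall>x\<in>carr V. f x \<in> carr W) \<and>
     (\<forall>x\<in>carr V. \<forall>y\<in>carr V. f (x + y) = f x + f y) \<and>
     (\<forall>c. \<forall>x\<in>carr V. f (scl V c x) = scl W c (f x))"

definition bilinear_map ::
  "('k::field, 'v::ab_group_add, 'x) vspace_scheme \<Rightarrow> ('k, 'w::ab_group_add, 'y) vspace_scheme
    \<Rightarrow> ('k, 'u::ab_group_add, 'z) vspace_scheme \<Rightarrow> ('v \<Rightarrow> 'w \<Rightarrow> 'u) \<Rightarrow> bool" where
  "bilinear_map V W U f \<longleftrightarrow>
     (\<forall>x\<in>carr V. linear_map W U (f x)) \<and> (\<forall>y\<in>carr W. linear_map V U (\<lambda>x. f x y))"

definition ground_field :: "('k::field, 'k) vspace" where
  "ground_field = \<lparr>carr = UNIV, scl = (*)\<rparr>"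


section \<open>Free vector spaces and their quotients\<close>

definition pscale :: "'k::field \<Rightarrow> ('x \<Rightarrow>\<^sub>0 'k) \<Rightarrow> ('x \<Rightarrow>\<^sub>0 'k)" where
  "pscale c f = Poly_Mapping.map (\<lambda>a. c * a) f"

abbreviation basis :: "'x \<Rightarrow> ('x \<Rightarrow>\<^sub>0 'k::field)" where
  "basis x \<equiv> Poly_Mapping.single x 1"

definition lin_ext :: "('k::field \<Rightarrow> 'a \<Rightarrow> 'a) \<Rightarrow> ('x \<Rightarrow> 'a::ab_group_add) \<Rightarrow> ('x \<Rightarrow>\<^sub>0 'k) \<Rightarrow> 'a" where
  "lin_ext s F f = (\<Sum>x\<in>Poly_Mapping.keys f. s (Poly_Mapping.lookup f x) (F x))"

definition free_on :: "'x set \<Rightarrow> ('x \<Rightarrow>\<^sub>0 'k::field) set" where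
  "free_on X = {f. Poly_Mapping.keys f \<subseteq> X}"

text \<open>
  Every vector space that has to be constructed is a quotient of a free one (or of a subspace of
  a free one) by a subspace \<open>N\<close>.  Instead of cosets we use representatives: \<open>coset_rep N\<close> is a
  linear choice of one representative in each coset of \<open>N\<close>, so that it has kernel \<open>N\<close> and its image
  on a subspace \<open>C\<close> containing \<open>N\<close> is \<open>C / N\<close>, with \<open>coset_rep N\<close> as the quotient map.  See
  \<open>linear_coset_rep\<close>, \<open>coset_rep_eq_iff\<close> and \<open>coset_rep_in_coset\<close> below.
\<close>

definition coset_rep :: "('x \<Rightarrow>\<^sub>0 'k::field) set \<Rightarrow> ('x \<Rightarrow>\<^sub>0 'k) \<Rightarrow> ('x \<Rightarrow>\<^sub>0 'k)" where
  "coset_rep N = (SOME r. Vector_Spaces.linear pscale pscale r \<and>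
                          (\<forall>f. r f - f \<in> N) \<and> (\<forall>f\<in>N. r f = 0))"

definition quotient_space ::
    "('x \<Rightarrow>\<^sub>0 'k::field) set \<Rightarrow> ('x \<Rightarrow>\<^sub>0 'k) set \<Rightarrow> ('k, 'x \<Rightarrow>\<^sub>0 'k) vspace" where
  "quotient_space C N = \<lparr>carr = coset_rep N ` C, scl = pscale\<rparr>"

lemma lookup_pscale [simp]: "Poly_Mapping.lookup (pscale c f) x = c * Poly_Mapping.lookup f x"
  unfolding pscale_def by (simp add: Poly_Mapping.map.rep_eq when_def)

lemma vector_space_pscale: "vector_space (pscale :: 'k::field \<Rightarrow> ('x \<Rightarrow>\<^sub>0 'k) \<Rightarrow> ('x \<Rightarrow>\<^sub>0 'k))"
  by unfold_locales (auto intro!: poly_mapping_eqI simp: lookup_add algebra_simps)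

lemma coset_rep_exists:
  fixes N :: "('x \<Rightarrow>\<^sub>0 'k::field) set"
  assumes N: "module.subspace pscale N"
  shows "\<exists>r. Vector_Spaces.linear pscale pscale r \<and> (\<forall>f. r f - f \<in> N) \<and> (\<forall>f\<in>N. r f = 0)"
proof -
  let ?s = "pscale :: 'k \<Rightarrow> ('x \<Rightarrow>\<^sub>0 'k) \<Rightarrow> ('x \<Rightarrow>\<^sub>0 'k)"
  interpret vs: vector_space ?s by (rule vector_space_pscale)
  interpret vp: vector_space_pair ?s ?s by unfold_locales
  obtain g where g: "g ` UNIV \<subseteq> N" "Vector_Spaces.linear ?s ?s g" "\<forall>v\<in>N. g v = v"
    using vp.linear_exists_left_inverse_on[OF vs.linear_id N] by auto
  have "Vector_Spaces.linear ?s ?s (\<lambda>f. f - g f)"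
    using vp.linear_compose_sub[OF vs.linear_id g(2)] by simp
  moreover have "(f - g f) - f \<in> N" for f
    using vs.subspace_neg[OF N, of "g f"] g(1) by auto
  moreover have "f - g f = 0" if "f \<in> N" for f
    using g(3) that by simp
  ultimately show ?thesis by blast
qed

lemma coset_rep_props:
  assumes "module.subspace pscale N"
  shows linear_coset_rep: "Vector_Spaces.linear pscale pscale (coset_rep N)"
    and coset_rep_in_coset: "coset_rep N f - f \<in> N"
    and coset_rep_zero: "f \<in> N \<Longrightarrow> coset_rep N f = 0"
  using someI_ex[OF coset_rep_exists[OF assms]] unfolding coset_rep_def by blast+

lemma coset_rep_eq_iff:
  fixes N :: "('x \<Rightarrow>\<^sub>0 'k::field) set"
  assumes N: "module.subspace pscale N"
  shows "coset_rep N f = coset_rep N g \<longleftrightarrow> f - g \<in> N"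
proof -
  interpret vs: vector_space "pscale :: 'k \<Rightarrow> ('x \<Rightarrow>\<^sub>0 'k) \<Rightarrow> ('x \<Rightarrow>\<^sub>0 'k)" by (rule vector_space_pscale)
  interpret l: Vector_Spaces.linear pscale pscale "coset_rep N" by (rule linear_coset_rep[OF N])
  show ?thesis
  proof
    assume "f - g \<in> N"
    then have "coset_rep N (f - g) = 0" by (rule coset_rep_zero[OF N])
    then show "coset_rep N f = coset_rep N g" by (simp add: l.diff)
  next
    assume "coset_rep N f = coset_rep N g"
    then show "f - g \<in> N"
      using vs.subspace_diff[OF N coset_rep_in_coset[OF N, of g] coset_rep_in_coset[OF N, of f]]
      by simp
  qed
qed


section \<open>Tensor products\<close>

definition tensor_rel ::
  "('k::field, 'v::ab_group_add, 'y) vspace_scheme \<Rightarrow> ('k, 'w::ab_group_add, 'z) vspace_scheme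
    \<Rightarrow> ('v \<times> 'w \<Rightarrow>\<^sub>0 'k) set" where
  "tensor_rel V W = module.span pscale
     ({basis (x + x', y) - basis (x, y) - basis (x', y) | x x' y.
         x \<in> carr V \<and> x' \<in> carr V \<and> y \<in> carr W} \<union>
      {basis (x, y + y') - basis (x, y) - basis (x, y') | x y y'.
         x \<in> carr V \<and> y \<in> carr W \<and> y' \<in> carr W} \<union>
      {basis (scl V c x, y) - pscale c (basis (x, y)) | c x y. x \<in> carr V \<and> y \<in> carr W} \<union>
      {basis (x, scl W c y) - pscale c (basis (x, y)) | c x y. x \<in> carr V \<and> y \<in> carr W})"

definition tensor ::
  "('k::field, 'v::ab_group_add, 'y) vspace_scheme \<Rightarrow> ('k, 'w::ab_group_add, 'z) vspace_scheme
    \<Rightarrow> ('k, 'v \<times> 'w \<Rightarrow>\<^sub>0 'k) vspace" where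
  "tensor V W = quotient_space (free_on (carr V \<times> carr W)) (tensor_rel V W)"

definition tens ::
  "('k::field, 'v::ab_group_add, 'y) vspace_scheme \<Rightarrow> ('k, 'w::ab_group_add, 'z) vspace_scheme
    \<Rightarrow> 'v \<Rightarrow> 'w \<Rightarrow> ('v \<times> 'w \<Rightarrow>\<^sub>0 'k)" where
  "tens V W x y = coset_rep (tensor_rel V W) (basis (x, y))"

text \<open>
  An element of \<open>tensor V W\<close> is a formal sum of pairs representing it, so a bilinear map \<open>b\<close> on
  \<open>V \<times> W\<close> induces the linear map \<open>lin_ext s (\<lambda>(x, y). b x y)\<close> on \<open>tensor V W\<close>.
  In particular \<open>tensor_map V' W' f g\<close> is \<open>f \<otimes> g\<close>, with values in \<open>tensor V' W'\<close>.
\<close>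

definition tensor_map ::
  "('k::field, 'v::ab_group_add, 'y) vspace_scheme \<Rightarrow> ('k, 'w::ab_group_add, 'z) vspace_scheme
    \<Rightarrow> ('a \<Rightarrow> 'v) \<Rightarrow> ('b \<Rightarrow> 'w) \<Rightarrow> ('a \<times> 'b \<Rightarrow>\<^sub>0 'k) \<Rightarrow> ('v \<times> 'w \<Rightarrow>\<^sub>0 'k)" where
  "tensor_map V W f g = lin_ext pscale (\<lambda>(x, y). tens V W (f x) (g y))"

text \<open>The canonical isomorphism \<open>(U \<otimes> V) \<otimes> W \<cong> U \<otimes> (V \<otimes> W)\<close>.\<close>

definition tensor_assoc ::
  "('k::field, 'u::ab_group_add, 'x) vspace_scheme \<Rightarrow> ('k, 'v::ab_group_add, 'y) vspace_scheme
    \<Rightarrow> ('k, 'w::ab_group_add, 'z) vspace_scheme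
    \<Rightarrow> (('u \<times> 'v \<Rightarrow>\<^sub>0 'k) \<times> 'w \<Rightarrow>\<^sub>0 'k) \<Rightarrow> ('u \<times> ('v \<times> 'w \<Rightarrow>\<^sub>0 'k) \<Rightarrow>\<^sub>0 'k)" where
  "tensor_assoc U V W =
     lin_ext pscale (\<lambda>(X, w). lin_ext pscale (\<lambda>(u, v). tens U (tensor V W) u (tens V W v w)) X)"

text \<open>The product \<open>(a \<otimes> b) (a' \<otimes> b') = a a' \<otimes> b b'\<close> on \<open>V \<otimes> V\<close> induced by a product on \<open>V\<close>.\<close>

definition tensor_mult ::
  "('k::field, 'v::ab_group_add, 'z) vspace_scheme \<Rightarrow> ('v \<Rightarrow> 'v \<Rightarrow> 'v)
    \<Rightarrow> ('v \<times> 'v \<Rightarrow>\<^sub>0 'k) \<Rightarrow> ('v \<times> 'v \<Rightarrow>\<^sub>0 'k) \<Rightarrow> ('v \<times> 'v \<Rightarrow>\<^sub>0 'k)" where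
  "tensor_mult V mul X Y =
     lin_ext pscale (\<lambda>(a, b). lin_ext pscale (\<lambda>(a', b'). tens V V (mul a a') (mul b b')) Y) X"


section \<open>Coalgebras, bialgebras, 2-associative bialgebras\<close>

text \<open>A coalgebra with a distinguished element \<open>one\<close>; \<open>star\<close> and \<open>dot\<close> are the two products.\<close>

record (overloaded) ('k, 'v) coalg = "('k, 'v) vspace" +
  comul :: "'v \<Rightarrow> ('v \<times> 'v \<Rightarrow>\<^sub>0 'k)"
  counit :: "'v \<Rightarrow> 'k"
  one :: 'v

record (overloaded) ('k, 'v) bialg = "('k, 'v) coalg" +
  star :: "'v \<Rightarrow> 'v \<Rightarrow> 'v"

record (overloaded) ('k, 'v) bialg2 = "('k, 'v) bialg" +
  dot :: "'v \<Rightarrow> 'v \<Rightarrow> 'v"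

definition with_dot :: "('k, 'v) bialg \<Rightarrow> ('v \<Rightarrow> 'v \<Rightarrow> 'v) \<Rightarrow> ('k, 'v) bialg2" where
  "with_dot H d = bialg.extend H (bialg2.fields d)"

definition counital_coassociative ::
    "('k::field, 'v::ab_group_add, 'z) coalg_scheme \<Rightarrow> bool" where
  "counital_coassociative C \<longleftrightarrow>
     is_vspace C \<and>
     linear_map C (tensor C C) (comul C) \<and>
     linear_map C ground_field (counit C) \<and>
     (\<forall>x\<in>carr C. tensor_assoc C C C (tensor_map (tensor C C) C (comul C) id (comul C x))
                 = tensor_map C (tensor C C) id (comul C) (comul C x)) \<and>
     (\<forall>x\<in>carr C. lin_ext (scl C) (\<lambda>(a, b). scl C (counit C a) b) (comul C x) = x) \<and>
     (\<forall>x\<in>carr C. lin_ext (scl C) (\<lambda>(a, b). scl C (counit C b) a) (comul C x) = x)"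

definition unital_associative ::
    "('k::field, 'v::ab_group_add, 'z) vspace_scheme \<Rightarrow> ('v \<Rightarrow> 'v \<Rightarrow> 'v) \<Rightarrow> 'v \<Rightarrow> bool" where
  "unital_associative A mul e \<longleftrightarrow>
     is_vspace A \<and> bilinear_map A A A mul \<and> e \<in> carr A \<and>
     (\<forall>x\<in>carr A. mul e x = x \<and> mul x e = x) \<and>
     (\<forall>x\<in>carr A. \<forall>y\<in>carr A. \<forall>z\<in>carr A. mul (mul x y) z = mul x (mul y z))"

definition bialgebra :: "('k::field, 'v::ab_group_add, 'z) bialg_scheme \<Rightarrow> bool" where
  "bialgebra H \<longleftrightarrow>
     unital_associative H (star H) (one H) \<and>
     counital_coassociative H \<and>
     comul H (one H) = tens H H (one H) (one H) \<and>
     (\<forall>x\<in>carr H. \<forall>y\<in>carr H.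
        comul H (star H x y) = tensor_mult H (star H) (comul H x) (comul H y)) \<and>
     counit H (one H) = 1 \<and>
     (\<forall>x\<in>carr H. \<forall>y\<in>carr H. counit H (star H x y) = counit H x * counit H y)"

definition unital_infinitesimal_bialgebra ::
    "('k::field, 'v::ab_group_add, 'z) bialg2_scheme \<Rightarrow> bool" where
  "unital_infinitesimal_bialgebra H \<longleftrightarrow>
     unital_associative H (dot H) (one H) \<and>
     counital_coassociative H \<and>
     (\<forall>x\<in>carr H. \<forall>y\<in>carr H.
        comul H (dot H x y) =
          tensor_mult H (dot H) (tens H H x (one H)) (comul H y)
          + tensor_mult H (dot H) (comul H x) (tens H H (one H) y)
          - tens H H x y)"

definition two_assoc_bialgebra :: "('k::field, 'v::ab_group_add, 'z) bialg2_scheme \<Rightarrow> bool" where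
  "two_assoc_bialgebra H \<longleftrightarrow> bialgebra H \<and> unital_infinitesimal_bialgebra H"

definition coalgebra_iso ::
  "('k::field, 'v::ab_group_add, 'y) coalg_scheme \<Rightarrow> ('k, 'w::ab_group_add, 'z) coalg_scheme
    \<Rightarrow> ('v \<Rightarrow> 'w) \<Rightarrow> bool" where
  "coalgebra_iso C D \<phi> \<longleftrightarrow>
     linear_map C D \<phi> \<and> bij_betw \<phi> (carr C) (carr D) \<and>
     (\<forall>x\<in>carr C. comul D (\<phi> x) = tensor_map D D \<phi> \<phi> (comul C x)) \<and>
     (\<forall>x\<in>carr C. counit D (\<phi> x) = counit C x)"

definition two_assoc_bialgebra_iso ::
  "('k::field, 'v::ab_group_add, 'y) bialg2_scheme \<Rightarrow> ('k, 'w::ab_group_add, 'z) bialg2_scheme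
    \<Rightarrow> ('v \<Rightarrow> 'w) \<Rightarrow> bool" where
  "two_assoc_bialgebra_iso A B \<phi> \<longleftrightarrow>
     coalgebra_iso A B \<phi> \<and> \<phi> (one A) = one B \<and>
     (\<forall>x\<in>carr A. \<forall>y\<in>carr A. \<phi> (star A x y) = star B (\<phi> x) (\<phi> y)) \<and>
     (\<forall>x\<in>carr A. \<forall>y\<in>carr A. \<phi> (dot A x y) = dot B (\<phi> x) (\<phi> y))"


section \<open>Primitive elements and connectedness\<close>

definition reduced_comul ::
    "('k::field, 'v::ab_group_add, 'z) coalg_scheme \<Rightarrow> 'v \<Rightarrow> ('v \<times> 'v \<Rightarrow>\<^sub>0 'k)" where
  "reduced_comul C x = comul C x - tens C C x (one C) - tens C C (one C) x"

definition Prim :: "('k::field, 'v::ab_group_add, 'z) coalg_scheme \<Rightarrow> ('k, 'v) vspace" where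
  "Prim C = \<lparr>carr = {x \<in> carr C. reduced_comul C x = 0}, scl = scl C\<rparr>"

text \<open>\<open>F\<^sub>r \<otimes> F\<^sub>r\<close> is the subspace of \<open>C \<otimes> C\<close> spanned by the \<open>a \<otimes> b\<close> with \<open>a, b \<in> F\<^sub>r\<close>.\<close>

primrec filtration ::
    "('k::field, 'v::ab_group_add, 'z) coalg_scheme \<Rightarrow> nat \<Rightarrow> 'v set" where
  "filtration C 0 = {scl C c (one C) | c. True}"
| "filtration C (Suc r) =
     {x \<in> carr C. reduced_comul C x \<in>
        module.span pscale {tens C C a b | a b. a \<in> filtration C r \<and> b \<in> filtration C r}}"

definition connected_coalgebra ::
    "('k::field, 'v::ab_group_add, 'z) coalg_scheme \<Rightarrow> bool" where
  "connected_coalgebra C \<longleftrightarrow> carr C = (\<Union>r. filtration C r)"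


section \<open>The tensor coalgebra\<close>

text \<open>
  \<open>\<Oplus>\<^sub>n V\<^sup>\<otimes>\<^sup>n\<close> is the space freely generated by the words over \<open>V\<close>, modulo multilinearity in the
  letters.
\<close>

definition word_rel ::
    "('k::field, 'v::ab_group_add, 'z) vspace_scheme \<Rightarrow> ('v list \<Rightarrow>\<^sub>0 'k) set" where
  "word_rel V = module.span pscale
     ({basis (us @ [x + y] @ ws) - basis (us @ [x] @ ws) - basis (us @ [y] @ ws) | us x y ws.
         us \<in> lists (carr V) \<and> x \<in> carr V \<and> y \<in> carr V \<and> ws \<in> lists (carr V)} \<union>
      {basis (us @ [scl V c x] @ ws) - pscale c (basis (us @ [x] @ ws)) | us c x ws.
         us \<in> lists (carr V) \<and> x \<in> carr V \<and> ws \<in> lists (carr V)})"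

definition word_space ::
    "('k::field, 'v::ab_group_add, 'z) vspace_scheme \<Rightarrow> ('k, 'v list \<Rightarrow>\<^sub>0 'k) vspace" where
  "word_space V = quotient_space (free_on (lists (carr V))) (word_rel V)"

definition word ::
    "('k::field, 'v::ab_group_add, 'z) vspace_scheme \<Rightarrow> 'v list \<Rightarrow> ('v list \<Rightarrow>\<^sub>0 'k)" where
  "word V vs = coset_rep (word_rel V) (basis vs)"

definition tensor_coalgebra ::
    "('k::field, 'v::ab_group_add, 'z) vspace_scheme \<Rightarrow> ('k, 'v list \<Rightarrow>\<^sub>0 'k) coalg" where
  "tensor_coalgebra V =
    \<lparr>carr = carr (word_space V), scl = scl (word_space V),
     comul = lin_ext pscale (\<lambda>vs. \<Sum>i\<le>length vs.
       tens (word_space V) (word_space V) (word V (take i vs)) (word V (drop i vs))),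
     counit = (\<lambda>f. Poly_Mapping.lookup f []),
     one = word V []\<rparr>"


section \<open>From 2-associative algebras to B-infinity algebras\<close>

text \<open>
  Multilinear maps on \<open>R\<^sup>\<otimes>\<^sup>p \<otimes> R\<^sup>\<otimes>\<^sup>q\<close> are written as functions of two lists of lengths \<open>p\<close> and \<open>q\<close>.
  For a product \<open>d\<close>, \<open>iterated d [x\<^sub>1, \<dots>, x\<^sub>n]\<close> is the product of the \<open>x\<^sub>i\<close>; it is only used
  for \<open>n \<ge> 1\<close>.
\<close>

fun iterated :: "('v \<Rightarrow> 'v \<Rightarrow> 'v) \<Rightarrow> 'v list \<Rightarrow> 'v" where
  "iterated d [] = undefined"
| "iterated d [x] = x"
| "iterated d (x # y # xs) = d x (iterated d (y # xs))"

text \<open>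
  A pair of \<open>k\<close>-tuples \<open>i, j\<close> with \<open>\<Sum>i\<^sub>s = p\<close> and \<open>\<Sum>j\<^sub>s = q\<close> corresponds to a simultaneous
  cutting of the two words into \<open>k\<close> consecutive (possibly empty) pieces.  Cuttings with an
  \<open>(i\<^sub>s, j\<^sub>s) = (0, 0)\<close> are left out, since they contribute \<open>0\<close> because of \<open>M\<^sub>0\<^sub>0 = 0\<close>.
\<close>

definition cuttings :: "'v list \<Rightarrow> 'v list \<Rightarrow> ('v list \<times> 'v list) list set" where
  "cuttings us vs = {ps. concat (map fst ps) = us \<and> concat (map snd ps) = vs \<and> ([], []) \<notin> set ps}"

lemma cuttings_smaller:
  assumes "ps \<in> cuttings us vs" "2 \<le> length ps" "p \<in> set ps"
  shows "length (fst p) + length (snd p) < length us + length vs"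
proof -
  have total: "length us + length vs = (\<Sum>q\<leftarrow>ps. length (fst q) + length (snd q))"
    using assms(1) by (auto simp: cuttings_def length_concat comp_def sum_list_addf)
  obtain as bs where ps: "ps = as @ p # bs"
    using assms(3) by (meson split_list)
  then obtain q where q: "q \<in> set (as @ bs)"
    using assms(2) by (cases "as @ bs") auto
  have "q \<noteq> ([], [])"
    using assms(1) q ps by (auto simp: cuttings_def)
  then have "0 < length (fst q) + length (snd q)"
    by (cases q) auto
  also have "\<dots> \<le> (\<Sum>q\<leftarrow>as @ bs. length (fst q) + length (snd q))"
    using q by (intro member_le_sum_list) auto
  finally show ?thesis
    unfolding total ps by simp
qed

function M_op :: "('v \<Rightarrow> 'v \<Rightarrow> 'v) \<Rightarrow> ('v \<Rightarrow> 'v \<Rightarrow> 'v) \<Rightarrow> 'v list \<Rightarrow> 'v list \<Rightarrow> 'v::ab_group_add" where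
  "M_op st d us vs =
    (if us = [] then (if length vs = 1 then hd vs else 0)
     else if vs = [] then (if length us = 1 then hd us else 0)
     else st (iterated d us) (iterated d vs)
       - (\<Sum>ps | ps \<in> cuttings us vs \<and> 2 \<le> length ps.
            iterated d (map (\<lambda>p. M_op st d (fst p) (snd p)) ps)))"
  by pat_completeness auto
termination
  by (relation "measure (\<lambda>(st, d, us, vs). length us + length vs)")
     (auto dest: cuttings_smaller)

declare M_op.simps [simp del]

text \<open>
  The operations of a B-infinity algebra: \<open>Mop R us vs\<close> is \<open>M\<^sub>p\<^sub>q(u\<^sub>1\<cdots>u\<^sub>p, v\<^sub>1\<cdots>v\<^sub>q)\<close>.  Their
  relations are not recorded: they hold automatically for \<open>Binf_of A\<close> and for \<open>Prim_Binf H\<close>, and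
  the construction of \<open>U2\<close> only involves the operations.
\<close>

record (overloaded) ('k, 'v) Binf = "('k, 'v) vspace" +
  Mop :: "'v list \<Rightarrow> 'v list \<Rightarrow> 'v"

definition Binf_of :: "('k::field, 'v::ab_group_add, 'z) bialg2_scheme \<Rightarrow> ('k, 'v) Binf" where
  "Binf_of A = \<lparr>carr = carr A, scl = scl A, Mop = M_op (star A) (dot A)\<rparr>"

definition Prim_Binf :: "('k::field, 'v::ab_group_add, 'z) bialg2_scheme \<Rightarrow> ('k, 'v) Binf" where
  "Prim_Binf H = (Binf_of H)\<lparr>carr := carr (Prim H)\<rparr>"


section \<open>The free 2-associative algebra\<close>

text \<open>
  \<open>2as(V)\<close> is the free vector space on all non-associative expressions in a unit, the elements
  of \<open>V\<close> and two binary operations, modulo the ideal generated by the unit and associativity laws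
  and the linearity of the inclusion of \<open>V\<close>.
\<close>

datatype 'v expr = EOne | EGen 'v | EStar "'v expr" "'v expr" | EDot "'v expr" "'v expr"

definition exprs :: "('k::field, 'v::ab_group_add, 'z) vspace_scheme \<Rightarrow> 'v expr set" where
  "exprs V = {t. set_expr t \<subseteq> carr V}"

definition expr_mult ::
    "('v expr \<Rightarrow> 'v expr \<Rightarrow> 'v expr)
      \<Rightarrow> ('v expr \<Rightarrow>\<^sub>0 'k::field) \<Rightarrow> ('v expr \<Rightarrow>\<^sub>0 'k) \<Rightarrow> ('v expr \<Rightarrow>\<^sub>0 'k)" where
  "expr_mult op f g = lin_ext pscale (\<lambda>s. lin_ext pscale (\<lambda>t. basis (op s t)) g) f"

definition generated_ideal ::
    "('v expr \<Rightarrow>\<^sub>0 'k::field) set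
      \<Rightarrow> (('v expr \<Rightarrow>\<^sub>0 'k) \<Rightarrow> ('v expr \<Rightarrow>\<^sub>0 'k) \<Rightarrow> ('v expr \<Rightarrow>\<^sub>0 'k))
      \<Rightarrow> (('v expr \<Rightarrow>\<^sub>0 'k) \<Rightarrow> ('v expr \<Rightarrow>\<^sub>0 'k) \<Rightarrow> ('v expr \<Rightarrow>\<^sub>0 'k))
      \<Rightarrow> ('v expr \<Rightarrow>\<^sub>0 'k) set \<Rightarrow> ('v expr \<Rightarrow>\<^sub>0 'k) set" where
  "generated_ideal C st d X =
     \<Inter>{I. X \<subseteq> I \<and> I \<subseteq> C \<and> module.subspace pscale I \<and>
         (\<forall>a\<in>C. \<forall>x\<in>I. st a x \<in> I \<and> st x a \<in> I \<and> d a x \<in> I \<and> d x a \<in> I)}"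

definition two_as_rel ::
    "('k::field, 'v::ab_group_add, 'z) vspace_scheme \<Rightarrow> ('v expr \<Rightarrow>\<^sub>0 'k) set" where
  "two_as_rel V = generated_ideal (free_on (exprs V)) (expr_mult EStar) (expr_mult EDot)
     ({basis (EGen (x + y)) - basis (EGen x) - basis (EGen y) | x y. x \<in> carr V \<and> y \<in> carr V} \<union>
      {basis (EGen (scl V c x)) - pscale c (basis (EGen x)) | c x. x \<in> carr V} \<union>
      (\<Union>op\<in>{EStar, EDot}.
        {basis (op EOne t) - basis t | t. t \<in> exprs V} \<union>
        {basis (op t EOne) - basis t | t. t \<in> exprs V} \<union>
        {basis (op (op s t) u) - basis (op s (op t u)) | s t u.
           s \<in> exprs V \<and> t \<in> exprs V \<and> u \<in> exprs V}))"

definition two_as_class ::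
    "('k::field, 'v::ab_group_add, 'z) vspace_scheme \<Rightarrow> 'v expr \<Rightarrow> ('v expr \<Rightarrow>\<^sub>0 'k)" where
  "two_as_class V t = coset_rep (two_as_rel V) (basis t)"

definition two_as_mult ::
    "('k::field, 'v::ab_group_add, 'z) vspace_scheme \<Rightarrow> ('v expr \<Rightarrow> 'v expr \<Rightarrow> 'v expr)
      \<Rightarrow> ('v expr \<Rightarrow>\<^sub>0 'k) \<Rightarrow> ('v expr \<Rightarrow>\<^sub>0 'k) \<Rightarrow> ('v expr \<Rightarrow>\<^sub>0 'k)" where
  "two_as_mult V op f g = coset_rep (two_as_rel V) (expr_mult op f g)"

definition two_as_space ::
    "('k::field, 'v::ab_group_add, 'z) vspace_scheme \<Rightarrow> ('k, 'v expr \<Rightarrow>\<^sub>0 'k) vspace" where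
  "two_as_space V = quotient_space (free_on (exprs V)) (two_as_rel V)"

text \<open>
  The coproduct of \<open>2as(V)\<close>: its values on expressions are forced by the axioms of a
  2-associative bialgebra and by primitivity of the generators.
\<close>

primrec expr_comul ::
  "('k::field, 'v::ab_group_add, 'z) vspace_scheme \<Rightarrow> 'v expr
    \<Rightarrow> (('v expr \<Rightarrow>\<^sub>0 'k) \<times> ('v expr \<Rightarrow>\<^sub>0 'k) \<Rightarrow>\<^sub>0 'k)" where
  "expr_comul V EOne =
     tens (two_as_space V) (two_as_space V) (two_as_class V EOne) (two_as_class V EOne)"
| "expr_comul V (EGen v) =
     tens (two_as_space V) (two_as_space V) (two_as_class V (EGen v)) (two_as_class V EOne)
     + tens (two_as_space V) (two_as_space V) (two_as_class V EOne) (two_as_class V (EGen v))"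
| "expr_comul V (EStar s t) =
     tensor_mult (two_as_space V) (two_as_mult V EStar) (expr_comul V s) (expr_comul V t)"
| "expr_comul V (EDot s t) =
     tensor_mult (two_as_space V) (two_as_mult V EDot)
       (tens (two_as_space V) (two_as_space V) (two_as_class V s) (two_as_class V EOne))
       (expr_comul V t)
     + tensor_mult (two_as_space V) (two_as_mult V EDot)
       (expr_comul V s)
       (tens (two_as_space V) (two_as_space V) (two_as_class V EOne) (two_as_class V t))
     - tens (two_as_space V) (two_as_space V) (two_as_class V s) (two_as_class V t)"

primrec expr_counit :: "'v expr \<Rightarrow> 'k::field" where
  "expr_counit EOne = 1"
| "expr_counit (EGen v) = 0"
| "expr_counit (EStar s t) = expr_counit s * expr_counit t"
| "expr_counit (EDot s t) = expr_counit s * expr_counit t"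

definition two_as ::
    "('k::field, 'v::ab_group_add, 'z) vspace_scheme \<Rightarrow> ('k, 'v expr \<Rightarrow>\<^sub>0 'k) bialg2" where
  "two_as V =
    \<lparr>carr = carr (two_as_space V), scl = scl (two_as_space V),
     comul = lin_ext pscale (expr_comul V),
     counit = lin_ext (*) expr_counit,
     one = two_as_class V EOne,
     star = two_as_mult V EStar,
     dot = two_as_mult V EDot\<rparr>"


section \<open>The universal enveloping 2-associative algebra\<close>

definition U2_ideal :: "('k::field, 'v::ab_group_add, 'z) Binf_scheme \<Rightarrow> ('v expr \<Rightarrow>\<^sub>0 'k) set" where
  "U2_ideal R =
     (let A = two_as R; gen = (\<lambda>r. two_as_class R (EGen r)) in
      generated_ideal (carr A) (star A) (dot A)
        {gen (Mop R rs ss) - Mop (Binf_of A) (map gen rs) (map gen ss) | rs ss.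
           rs \<in> lists (carr R) \<and> ss \<in> lists (carr R)})"

definition U2 ::
    "('k::field, 'v::ab_group_add, 'z) Binf_scheme \<Rightarrow> ('k, 'v expr \<Rightarrow>\<^sub>0 'k) bialg2" where
  "U2 R =
     (let A = two_as R; \<pi> = coset_rep (U2_ideal R);
          Q = quotient_space (carr A) (U2_ideal R) in
      \<lparr>carr = carr Q, scl = scl Q,
       comul = (\<lambda>x. tensor_map Q Q \<pi> \<pi> (comul A x)),
       counit = counit A,
       one = \<pi> (one A),
       star = (\<lambda>x y. \<pi> (star A x y)),
       dot = (\<lambda>x y. \<pi> (dot A x y))\<rparr>)"

end

theory Submission
  imports Defs
begin

text \<open>
  \<^emph>\<open>Connected implies cofree and enveloping.\<close>  In a connected unital infinitesimal bialgebra the convolution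
  equation \<open>e * id = id - \<epsilon>\<close> has a solution \<open>e\<close>; its values are primitive, and it vanishes on products
  \<open>p\<^sub>1 \<cdot> \<dots> \<cdot> p\<^sub>n\<close> of primitive elements with \<open>n \<noteq> 1\<close>.  Iterating \<open>x \<mapsto> e(x') \<otimes> x''\<close> therefore inverts the coalgebra
  map \<open>T\<^sup>c(Prim H) \<rightarrow> H\<close>, \<open>p\<^sub>1 \<dots> p\<^sub>n \<mapsto> p\<^sub>1 \<cdot> \<dots> \<cdot> p\<^sub>n\<close>.  This map factors through \<open>U2(Prim H) \<rightarrow> H\<close>, and the first
  factor is onto because in \<open>U2\<close> the product \<open>*\<close> of two words is a sum of words
  \<open>M(\<dots>) \<cdot> \<dots> \<cdot> M(\<dots>)\<close> in generators; hence both factors are bijective.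

  \<^emph>\<open>Converses.\<close>  \<open>U2\<close> is spanned by products \<open>\<cdot>\<close> of primitive generators, and so is a cofree \<open>H\<close> with the
  concatenation product of \<open>T\<^sup>c(Prim H)\<close>; a 2-associative bialgebra spanned in this way is connected.  That the
  unit of concatenation is the unit of \<open>H\<close> follows since \<open>T\<^sup>c(V)\<close> has only one group-like element.
\<close>

section \<open>Vector spaces, linear and bilinear maps\<close>

text \<open>Words appear because for a primitive \<open>p\<close> the correction
  \<open>- x \<otimes> y\<close> in the coproduct of \<open>x \<cdot> y\<close> cancels one term,
  leaving \<Delta>(p\<cdot>y) = (p\<otimes>1)\<cdot>\<Delta>(y) + 1\<otimes>(p\<cdot>y). Products of
  primitive elements are thus deconcatenated like words, and the same identity makes the values of
  \<open>e\<close> primitive. On the reduced coproduct the equation for \<open>e\<close> becomes a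
  recursion, since the factors there lie in the previous filtration step.

  On the enveloping side the obstacle is that the structure of \<open>2as\<close> and
  \<open>U2\<close> is given by formulas on chosen representatives. The coproduct must be shown to
  respect both ideals, and its kernel alone is not visibly an ideal, because \<Delta>(x\<cdot>y)
  involves \<open>x\<close> and \<open>y\<close> themselves; the joint kernel of projection and
  coproduct is one. It contains the relations of \<open>U2\<close> because the operations
  \<open>M\<close> send primitive elements to primitive elements, which follows from reading their
  definition as a formula for the product \<open>*\<close> of two words, summed over simultaneous
  cuttings.\<close>

lemma is_vspaceD:
  assumes "is_vspace V"
  shows is_vspace_vector_space: "vector_space (scl V)"
    and is_vspace_module: "module (scl V)"
    and is_vspace_subspace: "module.subspace (scl V) (carr V)"
  using assms by (auto simp: is_vspace_def module_iff_vector_space)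

lemma vs_zero [simp]: "is_vspace V \<Longrightarrow> 0 \<in> carr V"
  by (rule module.subspace_0[OF is_vspaceD(2,3)])

lemma vs_add [simp]: "is_vspace V \<Longrightarrow> x \<in> carr V \<Longrightarrow> y \<in> carr V \<Longrightarrow> x + y \<in> carr V"
  by (rule module.subspace_add[OF is_vspaceD(2,3)])

lemma vs_scl [simp]: "is_vspace V \<Longrightarrow> x \<in> carr V \<Longrightarrow> scl V c x \<in> carr V"
  by (rule module.subspace_scale[OF is_vspaceD(2,3)])

lemma vs_neg [simp]: "is_vspace V \<Longrightarrow> x \<in> carr V \<Longrightarrow> - x \<in> carr V"
  by (rule module.subspace_neg[OF is_vspaceD(2,3)])

lemma vs_diff [simp]: "is_vspace V \<Longrightarrow> x \<in> carr V \<Longrightarrow> y \<in> carr V \<Longrightarrow> x - y \<in> carr V"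
  by (rule module.subspace_diff[OF is_vspaceD(2,3)])

lemma vs_sum: "is_vspace V \<Longrightarrow> (\<And>i. i \<in> I \<Longrightarrow> f i \<in> carr V) \<Longrightarrow> sum f I \<in> carr V"
  by (rule module.subspace_sum[OF is_vspaceD(2,3)])

lemma scl_simps [simp]:
  assumes "is_vspace V"
  shows "scl V 0 x = 0" "scl V c 0 = 0" "scl V 1 x = x" "scl V a (scl V b x) = scl V (a * b) x"
  using is_vspaceD(2)[OF assms]
  by (auto simp: module.scale_zero_left module.scale_zero_right module.scale_one module.scale_scale)

lemma scl_distribs:
  assumes "is_vspace V"
  shows "scl V c (x + y) = scl V c x + scl V c y" "scl V (a + b) x = scl V a x + scl V b x"
    "scl V c (x - y) = scl V c x - scl V c y" "scl V (- c) x = - scl V c x"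
    "scl V c (- x) = - scl V c x" "scl V c (sum f I) = (\<Sum>i\<in>I. scl V c (f i))"
  using is_vspaceD(2)[OF assms]
  by (auto simp: module.scale_right_distrib module.scale_left_distrib module.scale_right_diff_distrib
      module.scale_minus_left module.scale_minus_right module.scale_sum_right)

lemma is_vspace_ground_field [simp]: "is_vspace ground_field"
  by (auto simp: is_vspace_def ground_field_def module_iff_vector_space vector_space_def
      module.subspace_def algebra_simps)

lemma carr_ground_field [simp]: "carr ground_field = UNIV"
  and scl_ground_field [simp]: "scl ground_field = (*)"
  by (auto simp: ground_field_def)

lemma linear_mapI:
  assumes "\<And>x. x \<in> carr V \<Longrightarrow> f x \<in> carr W"
    and "\<And>x y. x \<in> carr V \<Longrightarrow> y \<in> carr V \<Longrightarrow> f (x + y) = f x + f y"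
    and "\<And>c x. x \<in> carr V \<Longrightarrow> f (scl V c x) = scl W c (f x)"
  shows "linear_map V W f"
  using assms by (auto simp: linear_map_def)

lemma lm_closed: "linear_map V W f \<Longrightarrow> x \<in> carr V \<Longrightarrow> f x \<in> carr W"
  and lm_add: "linear_map V W f \<Longrightarrow> x \<in> carr V \<Longrightarrow> y \<in> carr V \<Longrightarrow> f (x + y) = f x + f y"
  and lm_scl: "linear_map V W f \<Longrightarrow> x \<in> carr V \<Longrightarrow> f (scl V c x) = scl W c (f x)"
  by (auto simp: linear_map_def)

lemma lm_zero: "is_vspace V \<Longrightarrow> linear_map V W f \<Longrightarrow> f 0 = 0"
  using lm_add[of V W f 0 0] by simp

lemma lm_neg:
  assumes "is_vspace V" "linear_map V W f" "x \<in> carr V"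
  shows "f (- x) = - f x"
  using lm_add[OF assms(2), of x "- x"] assms by (simp add: lm_zero eq_neg_iff_add_eq_0 add.commute)

lemma lm_diff:
  assumes "is_vspace V" "linear_map V W f" "x \<in> carr V" "y \<in> carr V"
  shows "f (x - y) = f x - f y"
  using lm_add[OF assms(2), of x "- y"] assms by (simp add: lm_neg)

lemma lm_sum:
  assumes "is_vspace V" "linear_map V W f" "\<And>i. i \<in> I \<Longrightarrow> g i \<in> carr V"
  shows "f (sum g I) = (\<Sum>i\<in>I. f (g i))"
  using assms(3)
proof (induction I rule: infinite_finite_induct)
  case (insert i I)
  then have "g i \<in> carr V" "sum g I \<in> carr V"
    using assms(1) by (auto intro: vs_sum)
  then show ?case using insert by (simp add: lm_add[OF assms(2)])
qed (use lm_zero[OF assms(1,2)] in auto)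

lemma lm_comp: "linear_map V W f \<Longrightarrow> linear_map W U g \<Longrightarrow> linear_map V U (\<lambda>x. g (f x))"
  by (auto simp: linear_map_def)

lemma lm_id [simp]: "linear_map V V (\<lambda>x. x)"
  by (auto simp: linear_map_def)

lemma lm_plus:
  assumes "is_vspace W" "linear_map V W f" "linear_map V W g"
  shows "linear_map V W (\<lambda>x. f x + g x)"
  using assms by (intro linear_mapI) (auto simp: lm_closed lm_add lm_scl scl_distribs algebra_simps)

lemma lm_minus:
  assumes "is_vspace W" "linear_map V W f" "linear_map V W g"
  shows "linear_map V W (\<lambda>x. f x - g x)"
  using assms by (intro linear_mapI) (auto simp: lm_closed lm_add lm_scl scl_distribs algebra_simps)

lemma lm_const_zero: "is_vspace W \<Longrightarrow> linear_map V W (\<lambda>x. 0)"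
  by (intro linear_mapI) auto

lemma lm_scl_const:
  "is_vspace W \<Longrightarrow> y \<in> carr W \<Longrightarrow> linear_map V ground_field f \<Longrightarrow> linear_map V W (\<lambda>x. scl W (f x) y)"
  by (intro linear_mapI) (auto simp: lm_add lm_scl scl_distribs)

lemma lm_inv_into:
  assumes "is_vspace V" "linear_map V W f" "bij_betw f (carr V) (carr W)"
  shows "linear_map W V (inv_into (carr V) f)"
proof (rule linear_mapI)
  let ?g = "inv_into (carr V) f"
  have g: "?g y \<in> carr V" "f (?g y) = y" if "y \<in> carr W" for y
    using that assms(3) by (auto simp: bij_betw_def inv_into_into f_inv_into_f)
  have gf: "?g (f x) = x" if "x \<in> carr V" for x
    using that assms(3) by (simp add: bij_betw_inv_into_left)
  show "?g y \<in> carr V" if "y \<in> carr W" for y using g that by auto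
  show "?g (x + y) = ?g x + ?g y" if "x \<in> carr W" "y \<in> carr W" for x y
    using gf[of "?g x + ?g y"] lm_add[OF assms(2), of "?g x" "?g y"] g that assms by auto
  show "?g (scl W c x) = scl V c (?g x)" if "x \<in> carr W" for c x
    using gf[of "scl V c (?g x)"] lm_scl[OF assms(2), of "?g x"] g that assms by auto
qed

lemma bilinear_mapI:
  assumes "\<And>x y. x \<in> carr V \<Longrightarrow> y \<in> carr W \<Longrightarrow> f x y \<in> carr U"
    and "\<And>x x' y. x \<in> carr V \<Longrightarrow> x' \<in> carr V \<Longrightarrow> y \<in> carr W \<Longrightarrow> f (x + x') y = f x y + f x' y"
    and "\<And>c x y. x \<in> carr V \<Longrightarrow> y \<in> carr W \<Longrightarrow> f (scl V c x) y = scl U c (f x y)"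
    and "\<And>x y y'. x \<in> carr V \<Longrightarrow> y \<in> carr W \<Longrightarrow> y' \<in> carr W \<Longrightarrow> f x (y + y') = f x y + f x y'"
    and "\<And>c x y. x \<in> carr V \<Longrightarrow> y \<in> carr W \<Longrightarrow> f x (scl W c y) = scl U c (f x y)"
  shows "bilinear_map V W U f"
  using assms by (auto simp: bilinear_map_def linear_map_def)

lemma bl_left: "bilinear_map V W U f \<Longrightarrow> y \<in> carr W \<Longrightarrow> linear_map V U (\<lambda>x. f x y)"
  and bl_right: "bilinear_map V W U f \<Longrightarrow> x \<in> carr V \<Longrightarrow> linear_map W U (f x)"
  by (auto simp: bilinear_map_def)

lemma bl_closed: "bilinear_map V W U f \<Longrightarrow> x \<in> carr V \<Longrightarrow> y \<in> carr W \<Longrightarrow> f x y \<in> carr U"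
  using lm_closed[OF bl_right[of V W U f x], of y] by blast

lemma bl_add_left: "bilinear_map V W U f \<Longrightarrow> x \<in> carr V \<Longrightarrow> x' \<in> carr V \<Longrightarrow> y \<in> carr W
    \<Longrightarrow> f (x + x') y = f x y + f x' y"
  using lm_add[OF bl_left[of V W U f y], of x x'] by blast

lemma bl_add_right: "bilinear_map V W U f \<Longrightarrow> x \<in> carr V \<Longrightarrow> y \<in> carr W \<Longrightarrow> y' \<in> carr W
    \<Longrightarrow> f x (y + y') = f x y + f x y'"
  using lm_add[OF bl_right[of V W U f x], of y y'] by blast

lemma bl_scl_left: "bilinear_map V W U f \<Longrightarrow> x \<in> carr V \<Longrightarrow> y \<in> carr W
    \<Longrightarrow> f (scl V c x) y = scl U c (f x y)"
  using lm_scl[OF bl_left[of V W U f y], of x c] by blast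

lemma bl_scl_right: "bilinear_map V W U f \<Longrightarrow> x \<in> carr V \<Longrightarrow> y \<in> carr W
    \<Longrightarrow> f x (scl W c y) = scl U c (f x y)"
  using lm_scl[OF bl_right[of V W U f x], of y c] by blast

lemma bl_diff_left: "is_vspace V \<Longrightarrow> bilinear_map V W U f \<Longrightarrow> x \<in> carr V \<Longrightarrow> x' \<in> carr V
    \<Longrightarrow> y \<in> carr W \<Longrightarrow> f (x - x') y = f x y - f x' y"
  using lm_diff[OF _ bl_left[of V W U f y], of x x'] by blast

lemma bl_diff_right: "is_vspace W \<Longrightarrow> bilinear_map V W U f \<Longrightarrow> x \<in> carr V \<Longrightarrow> y \<in> carr W
    \<Longrightarrow> y' \<in> carr W \<Longrightarrow> f x (y - y') = f x y - f x y'"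
  using lm_diff[OF _ bl_right[of V W U f x], of y y'] by blast

lemma bl_zero_left: "is_vspace V \<Longrightarrow> bilinear_map V W U f \<Longrightarrow> y \<in> carr W \<Longrightarrow> f 0 y = 0"
  using lm_zero[OF _ bl_left[of V W U f y]] by blast

lemma bl_zero_right: "is_vspace W \<Longrightarrow> bilinear_map V W U f \<Longrightarrow> x \<in> carr V \<Longrightarrow> f x 0 = 0"
  using lm_zero[OF _ bl_right[of V W U f x]] by blast

lemma bl_sum_left: "is_vspace V \<Longrightarrow> bilinear_map V W U f \<Longrightarrow> (\<And>i. i \<in> I \<Longrightarrow> g i \<in> carr V)
    \<Longrightarrow> y \<in> carr W \<Longrightarrow> f (sum g I) y = (\<Sum>i\<in>I. f (g i) y)"
  using lm_sum[OF _ bl_left[of V W U f y], of I g] by blast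

lemma bl_sum_right: "is_vspace W \<Longrightarrow> bilinear_map V W U f \<Longrightarrow> (\<And>i. i \<in> I \<Longrightarrow> g i \<in> carr W)
    \<Longrightarrow> x \<in> carr V \<Longrightarrow> f x (sum g I) = (\<Sum>i\<in>I. f x (g i))"
  using lm_sum[OF _ bl_right[of V W U f x], of I g] by blast

lemma bl_comp:
  assumes b: "bilinear_map V' W' U b" and f: "linear_map V V' f" and g: "linear_map W W' g"
  shows "bilinear_map V W U (\<lambda>x y. b (f x) (g y))"
  by (intro bilinear_mapI)
    (simp_all add: lm_closed[OF f] lm_closed[OF g] lm_add[OF f] lm_add[OF g] lm_scl[OF f]
      lm_scl[OF g] bl_closed[OF b] bl_add_left[OF b] bl_add_right[OF b] bl_scl_left[OF b]
      bl_scl_right[OF b])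

lemma bl_lm:
  assumes b: "bilinear_map V W U b" and g: "linear_map U U' g"
  shows "bilinear_map V W U' (\<lambda>x y. g (b x y))"
  by (intro bilinear_mapI)
    (simp_all add: lm_closed[OF g] lm_add[OF g] lm_scl[OF g] bl_closed[OF b] bl_add_left[OF b]
      bl_add_right[OF b] bl_scl_left[OF b] bl_scl_right[OF b])


section \<open>Free vector spaces and quotients\<close>

definition free_space :: "'x set \<Rightarrow> ('k::field, 'x \<Rightarrow>\<^sub>0 'k) vspace" where
  "free_space X = \<lparr>carr = free_on X, scl = pscale\<rparr>"

lemma module_pscale: "module pscale"
  using vector_space_pscale by (simp add: module_iff_vector_space)

lemma subspace_pscale_iff:
  "module.subspace pscale S \<longleftrightarrow>
     0 \<in> S \<and> (\<forall>x\<in>S. \<forall>y\<in>S. x + y \<in> S) \<and> (\<forall>c. \<forall>x\<in>S. pscale c x \<in> S)"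
  using module.subspace_def[OF module_pscale, of S] by auto

lemma pscale_simps [simp]:
  "pscale 0 f = 0" "pscale c 0 = 0" "pscale 1 f = f" "pscale a (pscale b f) = pscale (a * b) f"
  by (auto intro!: poly_mapping_eqI)

lemma is_vspaceI_pscale: "scl V = pscale \<Longrightarrow> module.subspace pscale (carr V) \<Longrightarrow> is_vspace V"
  by (simp add: is_vspace_def vector_space_pscale)

lemma subspace_free_on: "module.subspace pscale (free_on X :: ('x \<Rightarrow>\<^sub>0 'k::field) set)"
proof -
  have "Poly_Mapping.keys (f + g) \<subseteq> X" if "Poly_Mapping.keys f \<subseteq> X" "Poly_Mapping.keys g \<subseteq> X" for f g :: "'x \<Rightarrow>\<^sub>0 'k"
    using that keys_add[of f g] by auto
  moreover have "Poly_Mapping.keys (pscale c f) \<subseteq> X" if "Poly_Mapping.keys f \<subseteq> X" for c and f :: "'x \<Rightarrow>\<^sub>0 'k"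
    using that by (auto simp: in_keys_iff)
  ultimately show ?thesis
    by (auto simp: subspace_pscale_iff free_on_def)
qed

lemma is_vspace_free_space [simp]: "is_vspace (free_space X)"
  by (rule is_vspaceI_pscale) (auto simp: free_space_def subspace_free_on)

lemma carr_free_space [simp]: "carr (free_space X) = free_on X"
  and scl_free_space [simp]: "scl (free_space X) = pscale"
  by (auto simp: free_space_def)

lemma basis_in_free_on [simp]: "x \<in> X \<Longrightarrow> basis x \<in> free_on X"
  by (auto simp: free_on_def)

lemma poly_mapping_eq_sum: "f = (\<Sum>x\<in>Poly_Mapping.keys f. pscale (Poly_Mapping.lookup f x) (basis x))"
  by (intro poly_mapping_eqI) (auto simp: lookup_sum lookup_single when_def if_distrib
      in_keys_iff sum.delta cong: if_cong)

lemma free_on_induct [consumes 1, case_names zero basis add]: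
  assumes "f \<in> free_on X"
    and "P 0" and "\<And>c x. x \<in> X \<Longrightarrow> P (pscale c (basis x))"
    and "\<And>f g. f \<in> free_on X \<Longrightarrow> g \<in> free_on X \<Longrightarrow> P f \<Longrightarrow> P g \<Longrightarrow> P (f + g)"
  shows "P f"
proof -
  have "P (\<Sum>x\<in>A. pscale (Poly_Mapping.lookup f x) (basis x)) \<and>
      (\<Sum>x\<in>A. pscale (Poly_Mapping.lookup f x) (basis x)) \<in> free_on X" if "finite A" "A \<subseteq> X" for A
    using that
  proof (induction A)
    case empty
    then show ?case using assms(2) module.subspace_0[OF module_pscale subspace_free_on] by auto
  next
    case (insert a A)
    let ?g = "pscale (Poly_Mapping.lookup f a) (basis a)"
    let ?h = "\<Sum>x\<in>A. pscale (Poly_Mapping.lookup f x) (basis x)"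
    have "?g \<in> free_on X" "?h \<in> free_on X" "P ?g" "P ?h"
      using insert assms(3) vs_scl[of "free_space X" "basis a"] by auto
    then show ?case
      using insert assms(4)[of ?g ?h] vs_add[of "free_space X" ?g ?h] by auto
  qed
  then have "P (\<Sum>x\<in>Poly_Mapping.keys f. pscale (Poly_Mapping.lookup f x) (basis x))"
    using assms(1) by (auto simp: free_on_def)
  then show ?thesis
    by (subst poly_mapping_eq_sum)
qed

text \<open>\<open>lin_ext\<close> sums over the support, which changes under addition and under
  scaling by zero. Over a common finite superset, additivity and homogeneity hold term by
  term.\<close>

lemma lin_ext_superset:
  assumes "module s" "finite A" "Poly_Mapping.keys f \<subseteq> A"
  shows "lin_ext s F f = (\<Sum>x\<in>A. s (Poly_Mapping.lookup f x) (F x))"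
  unfolding lin_ext_def using assms
  by (intro sum.mono_neutral_left) (auto simp: in_keys_iff module.scale_zero_left)

lemma lin_ext_basis [simp]: "module s \<Longrightarrow> lin_ext s F (basis x) = F x"
  by (simp add: lin_ext_def module.scale_one)

lemma lin_ext_zero [simp]: "lin_ext s F 0 = 0"
  by (simp add: lin_ext_def)

lemma lin_ext_add: 
  assumes "module s"
  shows "lin_ext s F (f + g) = lin_ext s F f + lin_ext s F g"
proof -
  have "finite (Poly_Mapping.keys f \<union> Poly_Mapping.keys g)" by simp
  note * = lin_ext_superset[OF assms this]
  show ?thesis using keys_add[of f g]
    by (subst (1 2 3) *) (auto simp: lookup_add module.scale_left_distrib[OF assms] sum.distrib)
qed

lemma lin_ext_pscale:
  assumes "module s"
  shows "lin_ext s F (pscale c f) = s c (lin_ext s F f)"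
proof -
  have "Poly_Mapping.keys (pscale c f) \<subseteq> Poly_Mapping.keys f" by (auto simp: in_keys_iff)
  then show ?thesis
    by (subst (1 2) lin_ext_superset[OF assms, of "Poly_Mapping.keys f"])
      (auto simp: module.scale_sum_right[OF assms] module.scale_scale[OF assms])
qed

lemma lin_ext_lm: "is_vspace U \<Longrightarrow> (\<And>x. x \<in> X \<Longrightarrow> F x \<in> carr U)
    \<Longrightarrow> linear_map (free_space X) U (lin_ext (scl U) F)"
  by (intro linear_mapI)
    (simp_all add: lin_ext_add lin_ext_pscale is_vspaceD(2), auto simp: lin_ext_def free_on_def
      intro!: vs_sum vs_scl)

lemma lin_ext_diff: "module s \<Longrightarrow> lin_ext s F (f - g) = lin_ext s F f - lin_ext s F g"
  using lin_ext_add[of s F "f - g" g] by simp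

lemma lin_ext_closed: "is_vspace U \<Longrightarrow> f \<in> free_on X \<Longrightarrow> (\<And>x. x \<in> X \<Longrightarrow> F x \<in> carr U)
    \<Longrightarrow> lin_ext (scl U) F f \<in> carr U"
  using lm_closed[OF lin_ext_lm, of U X F f] by auto

lemma lin_ext_cong: "f \<in> free_on X \<Longrightarrow> (\<And>x. x \<in> X \<Longrightarrow> F x = G x) \<Longrightarrow> lin_ext s F f = lin_ext s G f"
  by (auto simp: lin_ext_def free_on_def subset_eq intro!: sum.cong)

lemma subspace_lin_ext_kernel: "module s \<Longrightarrow> module.subspace pscale {f. lin_ext s F f = 0}"
  by (auto simp: subspace_pscale_iff lin_ext_add lin_ext_pscale module.scale_zero_right)

lemma lin_ext_span_zero:
  assumes "module s" "\<And>g. g \<in> G \<Longrightarrow> lin_ext s F g = 0" "f \<in> module.span pscale G"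
  shows "lin_ext s F f = 0"
  using module.span_minimal[OF module_pscale _ subspace_lin_ext_kernel[OF assms(1), of F], of G]
    assms(2,3) by auto

text \<open>A representative differs from \<open>f\<close> by an element of \<open>N\<close>. Hence
  a linear map that kills \<open>N\<close> may be evaluated on any formal sum in the coset; this is
  how maps out of quotients are computed below.\<close>

lemma lin_ext_coset_rep:
  assumes "module s" "module.subspace pscale N" "\<And>f. f \<in> N \<Longrightarrow> lin_ext s F f = 0"
  shows "lin_ext s F (coset_rep N f) = lin_ext s F f"
  using assms(3)[OF coset_rep_in_coset[OF assms(2), of f]]
  by (simp add: lin_ext_diff[OF assms(1)])

section \<open>Quotients of subspaces realised by linear representatives\<close>

locale quot =
  fixes C N :: "('x \<Rightarrow>\<^sub>0 'k::field) set"
  assumes C: "module.subspace pscale C" and N: "module.subspace pscale N" and NC: "N \<subseteq> C"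
begin

abbreviation (input) "Q \<equiv> quotient_space C N"

lemma scl_Q [simp]: "scl Q = pscale"
  by (simp add: quotient_space_def)

lemma carr_Q: "carr Q = coset_rep N ` C"
  by (simp add: quotient_space_def)

lemma rep_add: "coset_rep N (f + g) = coset_rep N f + coset_rep N g"
  and rep_pscale: "coset_rep N (pscale c f) = pscale c (coset_rep N f)"
proof -
  interpret l: Vector_Spaces.linear pscale pscale "coset_rep N" by (rule linear_coset_rep[OF N])
  show "coset_rep N (f + g) = coset_rep N f + coset_rep N g"
    and "coset_rep N (pscale c f) = pscale c (coset_rep N f)"
    by (rule l.add, rule l.scale)
qed

lemma rep_in_C: "f \<in> C \<Longrightarrow> coset_rep N f \<in> C"
  using module.subspace_add[OF module_pscale C, of "coset_rep N f - f" f]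
    coset_rep_in_coset[OF N, of f] NC by auto

lemma Q_sub_C: "x \<in> carr Q \<Longrightarrow> x \<in> C"
  using rep_in_C by (auto simp: carr_Q)

lemma rep_closed [simp]: "f \<in> C \<Longrightarrow> coset_rep N f \<in> carr Q"
  by (simp add: carr_Q)

lemma rep_idem [simp]: "coset_rep N (coset_rep N f) = coset_rep N f"
  using coset_rep_eq_iff[OF N, of "coset_rep N f" f] coset_rep_in_coset[OF N, of f] by simp

lemma rep_id: "x \<in> carr Q \<Longrightarrow> coset_rep N x = x"
  by (auto simp: carr_Q)

lemma is_vspace_Q [simp]: "is_vspace Q"
proof -
  have "0 = coset_rep N 0" using coset_rep_zero[OF N] module.subspace_0[OF module_pscale N] by auto
  then have zero: "0 \<in> coset_rep N ` C" using module.subspace_0[OF module_pscale C] by blast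
  have add: "x + y \<in> coset_rep N ` C" if "x \<in> coset_rep N ` C" "y \<in> coset_rep N ` C" for x y
  proof -
    from that obtain f g where "f \<in> C" "g \<in> C" "x = coset_rep N f" "y = coset_rep N g" by blast
    then show ?thesis using module.subspace_add[OF module_pscale C, of f g] rep_add[of f g]
      by (metis imageI)
  qed
  have scale: "pscale c x \<in> coset_rep N ` C" if "x \<in> coset_rep N ` C" for c x
  proof -
    from that obtain f where "f \<in> C" "x = coset_rep N f" by blast
    then show ?thesis
      using module.subspace_scale[OF module_pscale C, of f c] rep_pscale[of c f]
      by (metis imageI)
  qed
  have "module.subspace pscale (coset_rep N ` C)"
    using zero add scale unfolding subspace_pscale_iff by blast
  then show ?thesis
    unfolding carr_Q[symmetric] by (rule is_vspaceI_pscale[OF scl_Q])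
qed

end

section \<open>Tensor products\<close>

lemma free_on_simps [simp]:
  "0 \<in> free_on X" "f \<in> free_on X \<Longrightarrow> g \<in> free_on X \<Longrightarrow> f + g \<in> free_on X"
  "f \<in> free_on X \<Longrightarrow> g \<in> free_on X \<Longrightarrow> f - g \<in> free_on X"
  "f \<in> free_on X \<Longrightarrow> pscale c f \<in> free_on X"
  using vs_zero[OF is_vspace_free_space[of X]] vs_add[OF is_vspace_free_space[of X], of f g]
    vs_diff[OF is_vspace_free_space[of X], of f g] vs_scl[OF is_vspace_free_space[of X], of f c]
  by auto

lemma lin_ext_fun_add:
  assumes "module s"
  shows "lin_ext s (\<lambda>x. F x + G x) f = lin_ext s F f + lin_ext s G f"
  by (simp add: lin_ext_def sum.distrib module.scale_right_distrib[OF assms])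

lemma lin_ext_fun_scl:
  assumes "module s"
  shows "lin_ext s (\<lambda>x. s c (F x)) f = s c (lin_ext s F f)"
  by (simp add: lin_ext_def module.scale_sum_right[OF assms] module.scale_scale[OF assms] mult.commute)

lemma lin_ext_param_lm:
  assumes "is_vspace U" "scl U = s" "Y \<in> free_on Z" "\<And>z. z \<in> Z \<Longrightarrow> linear_map A U (\<lambda>a. F a z)"
  shows "linear_map A U (\<lambda>a. lin_ext s (F a) Y)"
proof (rule linear_mapI)
  have s: "module s" using assms by (auto simp: is_vspaceD(2))
  show "lin_ext s (F a) Y \<in> carr U" if "a \<in> carr A" for a
    using lin_ext_closed[of U Y Z "F a"] lm_closed[OF assms(4) that] assms by auto
  show "lin_ext s (F (a + b)) Y = lin_ext s (F a) Y + lin_ext s (F b) Y"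
    if "a \<in> carr A" "b \<in> carr A" for a b
    unfolding lin_ext_fun_add[OF s, symmetric]
    by (rule lin_ext_cong[OF assms(3)]) (rule lm_add[OF assms(4)], use that in auto)
  show "lin_ext s (F (scl A c a)) Y = scl U c (lin_ext s (F a) Y)" if "a \<in> carr A" for c a
    unfolding assms(2) lin_ext_fun_scl[OF s, symmetric] using lm_scl[OF assms(4) that]
    by (intro lin_ext_cong[OF assms(3)]) (simp add: assms(2))
qed

lemma lin_ext_param_bl:
  assumes "is_vspace U" "scl U = s" "Y \<in> free_on Z"
    and "\<And>z. z \<in> Z \<Longrightarrow> bilinear_map A B U (\<lambda>a b. F a b z)"
  shows "bilinear_map A B U (\<lambda>a b. lin_ext s (F a b) Y)"
  unfolding bilinear_map_def
proof (intro conjI ballI)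
  show "linear_map B U (\<lambda>b. lin_ext s (F a b) Y)" if "a \<in> carr A" for a
    by (rule lin_ext_param_lm[OF assms(1-3)]) (rule bl_right[OF assms(4) that])
  show "linear_map A U (\<lambda>a. lin_ext s (F a b) Y)" if "b \<in> carr B" for b
    by (rule lin_ext_param_lm[OF assms(1-3)]) (rule bl_left[OF assms(4) that])
qed

lemma tensor_rel_sub:
  assumes "is_vspace V" "is_vspace W"
  shows "tensor_rel V W \<subseteq> free_on (carr V \<times> carr W)"
  unfolding tensor_rel_def
  by (rule module.span_minimal[OF module_pscale _ subspace_free_on]) (use assms in auto)

lemma quot_tensor:
  assumes "is_vspace V" "is_vspace W"
  shows "quot (free_on (carr V \<times> carr W)) (tensor_rel V W)"
  using tensor_rel_sub[OF assms] by (simp add: quot_def subspace_free_on)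
    (simp add: tensor_rel_def module.subspace_span[OF module_pscale])

lemma is_vspace_tensor [simp]: "is_vspace V \<Longrightarrow> is_vspace W \<Longrightarrow> is_vspace (tensor V W)"
  unfolding tensor_def by (rule quot.is_vspace_Q[OF quot_tensor])

lemma scl_tensor [simp]: "scl (tensor V W) = pscale"
  by (simp add: tensor_def quotient_space_def)

lemma tens_closed [simp]:
  "is_vspace V \<Longrightarrow> is_vspace W \<Longrightarrow> x \<in> carr V \<Longrightarrow> y \<in> carr W \<Longrightarrow> tens V W x y \<in> carr (tensor V W)"
  unfolding tensor_def tens_def by (rule quot.rep_closed[OF quot_tensor]) auto

lemma tensor_sub_free:
  "is_vspace V \<Longrightarrow> is_vspace W \<Longrightarrow> X \<in> carr (tensor V W) \<Longrightarrow> X \<in> free_on (carr V \<times> carr W)"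
  unfolding tensor_def by (rule quot.Q_sub_C[OF quot_tensor])

lemma tens_bl:
  assumes "is_vspace V" "is_vspace W"
  shows "bilinear_map V W (tensor V W) (tens V W)"
proof (rule bilinear_mapI)
  interpret quot "free_on (carr V \<times> carr W)" "tensor_rel V W" by (rule quot_tensor[OF assms])
  note eq = coset_rep_eq_iff[OF N, THEN iffD2]
  note base = module.span_base[OF module_pscale]
  show "tens V W (x + x') y = tens V W x y + tens V W x' y"
    if "x \<in> carr V" "x' \<in> carr V" "y \<in> carr W" for x x' y
    unfolding tens_def rep_add[symmetric] using that
    by (intro eq) (auto simp: tensor_rel_def diff_diff_add[symmetric] intro!: base)
  show "tens V W x (y + y') = tens V W x y + tens V W x y'"
    if "x \<in> carr V" "y \<in> carr W" "y' \<in> carr W" for x y y'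
    unfolding tens_def rep_add[symmetric] using that
    by (intro eq) (auto simp: tensor_rel_def diff_diff_add[symmetric] intro!: base)
  show "tens V W (scl V c x) y = scl (tensor V W) c (tens V W x y)"
    if "x \<in> carr V" "y \<in> carr W" for c x y
    unfolding tens_def scl_tensor rep_pscale[symmetric] using that
    by (intro eq) (auto simp: tensor_rel_def intro!: base)
  show "tens V W x (scl W c y) = scl (tensor V W) c (tens V W x y)"
    if "x \<in> carr V" "y \<in> carr W" for c x y
    unfolding tens_def scl_tensor rep_pscale[symmetric] using that
    by (intro eq) (auto simp: tensor_rel_def intro!: base)
qed (use assms in auto)

text \<open>Scalars need no case of their own: a multiple of a pure tensor is again a pure tensor,
  the scalar being absorbed by the left factor.\<close>

lemma tensor_induct [consumes 3, case_names zero tens add]: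
  assumes V: "is_vspace V" and W: "is_vspace W" and X: "X \<in> carr (tensor V W)"
    and zero: "P 0" and tens: "\<And>x y. x \<in> carr V \<Longrightarrow> y \<in> carr W \<Longrightarrow> P (tens V W x y)"
    and add: "\<And>X Y. X \<in> carr (tensor V W) \<Longrightarrow> Y \<in> carr (tensor V W) \<Longrightarrow> P X \<Longrightarrow> P Y \<Longrightarrow> P (X + Y)"
  shows "P X"
proof -
  interpret quot "free_on (carr V \<times> carr W)" "tensor_rel V W" by (rule quot_tensor[OF V W])
  have "P (coset_rep (tensor_rel V W) f)" if "f \<in> free_on (carr V \<times> carr W)" for f
    using that
  proof (induction f rule: free_on_induct)
    case zero
    then show ?case using assms(4) coset_rep_zero[OF N, of 0] module.subspace_0[OF module_pscale N]
      by simp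
  next
    case (basis c z)
    obtain x y where z: "z = (x, y)" "x \<in> carr V" "y \<in> carr W" using basis by auto
    then have "coset_rep (tensor_rel V W) (pscale c (basis z)) = tens V W (scl V c x) y"
      using bl_scl_left[OF tens_bl[OF V W], of x y c] by (simp add: rep_pscale tens_def)
    then show ?case using tens[of "scl V c x" y] z V by simp
  next
    case (add f g)
    then show ?case
      using assms(6)[of "coset_rep (tensor_rel V W) f" "coset_rep (tensor_rel V W) g"]
      by (simp add: rep_add tensor_def)
  qed
  moreover obtain f where "f \<in> free_on (carr V \<times> carr W)" "X = coset_rep (tensor_rel V W) f"
    using X unfolding tensor_def carr_Q by blast
  ultimately show ?thesis by simp
qed

lemma tensor_eqI:
  assumes "is_vspace V" "is_vspace W" "X \<in> carr (tensor V W)"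
    and f: "linear_map (tensor V W) U f" and g: "linear_map (tensor V W) U g"
    and "\<And>x y. x \<in> carr V \<Longrightarrow> y \<in> carr W \<Longrightarrow> f (tens V W x y) = g (tens V W x y)"
  shows "f X = g X"
  using assms(1-3)
proof (induction rule: tensor_induct)
  case zero
  then show ?case using lm_zero[OF _ f] lm_zero[OF _ g] assms by simp
qed (auto simp: assms(6) lm_add[OF f] lm_add[OF g])

text \<open>Universal property of the tensor product. The formal extension of a bilinear
  \<open>b\<close> kills the four families of generators of \<open>tensor_rel\<close>, so choosing
  representatives does not affect its values.\<close>

lemma
  assumes V: "is_vspace V" and W: "is_vspace W" and U: "is_vspace U" and s: "scl U = s"
    and b: "bilinear_map V W U b"
  shows lift_lm: "linear_map (tensor V W) U (lin_ext s (\<lambda>(x, y). b x y))"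
    and lift_tens: "x \<in> carr V \<Longrightarrow> y \<in> carr W \<Longrightarrow> lin_ext s (\<lambda>(x, y). b x y) (tens V W x y) = b x y"
proof -
  interpret quot "free_on (carr V \<times> carr W)" "tensor_rel V W" by (rule quot_tensor[OF V W])
  have s': "module s" using U s by (auto simp: is_vspaceD(2))
  have rel: "lin_ext s (\<lambda>(x, y). b x y) f = 0" if "f \<in> tensor_rel V W" for f
    by (rule lin_ext_span_zero[OF s' _ that[unfolded tensor_rel_def]])
      (auto simp: lin_ext_diff[OF s'] lin_ext_pscale[OF s'] s' bl_add_left[OF b] bl_add_right[OF b]
        bl_scl_left[OF b] bl_scl_right[OF b] s)
  note rep = lin_ext_coset_rep[OF s' N rel]
  show "lin_ext s (\<lambda>(x, y). b x y) (tens V W x y) = b x y" if "x \<in> carr V" "y \<in> carr W"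
    using that by (simp add: tens_def rep s')
  show "linear_map (tensor V W) U (lin_ext s (\<lambda>(x, y). b x y))"
  proof (rule linear_mapI)
    show "lin_ext s (\<lambda>(x, y). b x y) X \<in> carr U" if "X \<in> carr (tensor V W)" for X
      using lin_ext_closed[OF U tensor_sub_free[OF V W that], of "\<lambda>(x, y). b x y"]
      by (auto simp: s bl_closed[OF b])
  qed (auto simp: lin_ext_add s' lin_ext_pscale s)
qed

text \<open>Tensors are formal sums supported on pairs from the two carriers, so only the values of
  \<open>b\<close> on such pairs enter the sum.\<close>

lemma tensor_lift_cong:
  assumes "is_vspace V" "is_vspace W" "X \<in> carr (tensor V W)"
    and "\<And>x y. x \<in> carr V \<Longrightarrow> y \<in> carr W \<Longrightarrow> b x y = b' x y"
  shows "lin_ext s (\<lambda>(x, y). b x y) X = lin_ext s (\<lambda>(x, y). b' x y) X"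
  by (rule lin_ext_cong[OF tensor_sub_free[OF assms(1-3)]]) (auto simp: assms(4))

section \<open>Tensor products of linear maps\<close>

context
  fixes V :: "('k::field, 'v::ab_group_add, 'z) vspace_scheme"
    and W :: "('k, 'w::ab_group_add, 'y) vspace_scheme"
    and V' :: "('k, 'v'::ab_group_add, 'z') vspace_scheme"
    and W' :: "('k, 'w'::ab_group_add, 'y') vspace_scheme"
  assumes V [simp]: "is_vspace V" and W [simp]: "is_vspace W"
    and V' [simp]: "is_vspace V'" and W' [simp]: "is_vspace W'"
begin

lemma tensor_map_bl:
  assumes "linear_map V V' f" "linear_map W W' g"
  shows "bilinear_map V W (tensor V' W') (\<lambda>x y. tens V' W' (f x) (g y))"
  by (rule bl_comp[OF tens_bl assms]) auto

lemma tensor_map_lm: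
  assumes "linear_map V V' f" "linear_map W W' g"
  shows "linear_map (tensor V W) (tensor V' W') (tensor_map V' W' f g)"
  unfolding tensor_map_def by (rule lift_lm[OF _ _ _ _ tensor_map_bl[OF assms]]) auto

lemma tensor_map_tens:
  assumes "linear_map V V' f" "linear_map W W' g" "x \<in> carr V" "y \<in> carr W"
  shows "tensor_map V' W' f g (tens V W x y) = tens V' W' (f x) (g y)"
  unfolding tensor_map_def by (rule lift_tens[OF _ _ _ _ tensor_map_bl[OF assms(1,2)]]) (use assms in auto)

lemma tensor_map_cong:
  assumes "X \<in> carr (tensor V W)"
    and "\<And>x. x \<in> carr V \<Longrightarrow> f x = f' x" "\<And>x. x \<in> carr W \<Longrightarrow> g x = g' x"
  shows "tensor_map V' W' f g X = tensor_map V' W' f' g' X"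
  unfolding tensor_map_def by (rule tensor_lift_cong[OF V W assms(1)]) (simp add: assms)

end

lemma tensor_map_comp:
  assumes [simp]: "is_vspace V" "is_vspace W" "is_vspace V'" "is_vspace W'" "is_vspace V''"
    "is_vspace W''"
    and f: "linear_map V V' f" "linear_map W W' g" "linear_map V' V'' f'" "linear_map W' W'' g'"
    and X: "X \<in> carr (tensor V W)"
  shows "tensor_map V'' W'' f' g' (tensor_map V' W' f g X)
    = tensor_map V'' W'' (\<lambda>x. f' (f x)) (\<lambda>x. g' (g x)) X"
proof (rule tensor_eqI[OF _ _ X])
  note l = lm_comp[OF f(1,3)] lm_comp[OF f(2,4)]
  show "linear_map (tensor V W) (tensor V'' W'') (\<lambda>X. tensor_map V'' W'' f' g' (tensor_map V' W' f g X))"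
    by (intro lm_comp[OF tensor_map_lm tensor_map_lm]) (use f in auto)
  show "linear_map (tensor V W) (tensor V'' W'') (tensor_map V'' W'' (\<lambda>x. f' (f x)) (\<lambda>x. g' (g x)))"
    by (intro tensor_map_lm l) auto
  fix x y assume "x \<in> carr V" "y \<in> carr W"
  then show "tensor_map V'' W'' f' g' (tensor_map V' W' f g (tens V W x y))
     = tensor_map V'' W'' (\<lambda>x. f' (f x)) (\<lambda>x. g' (g x)) (tens V W x y)"
    by (simp add: tensor_map_tens f l lm_closed[OF f(1)] lm_closed[OF f(2)])
qed auto

lemma tensor_map_id:
  assumes [simp]: "is_vspace V" "is_vspace W" and X: "X \<in> carr (tensor V W)"
  shows "tensor_map V W (\<lambda>x. x) (\<lambda>x. x) X = X"
  by (rule tensor_eqI[OF _ _ X, where U = "tensor V W"]) (auto simp: tensor_map_tens intro!: tensor_map_lm)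

lemma tensor_rel_cong:
  "carr V = carr V' \<Longrightarrow> scl V = scl V' \<Longrightarrow> carr W = carr W' \<Longrightarrow> scl W = scl W'
    \<Longrightarrow> tensor_rel V W = tensor_rel V' W'"
  by (simp add: tensor_rel_def)

section \<open>The componentwise product on a tensor square\<close>

context
  fixes V :: "('k::field, 'v::ab_group_add, 'z) vspace_scheme" and m
  assumes V [simp]: "is_vspace V" and m: "bilinear_map V V V m"
begin

lemma tensor_mult_inner_bl:
  assumes "a \<in> carr V" "b \<in> carr V"
  shows "bilinear_map V V (tensor V V) (\<lambda>a' b'. tens V V (m a a') (m b b'))"
  by (rule bl_comp[OF tens_bl]) (use assms bl_right[OF m] in auto)

lemma tensor_mult_outer_bl:
  assumes "Y \<in> carr (tensor V V)"
  shows "bilinear_map V V (tensor V V)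
    (\<lambda>a b. lin_ext pscale (\<lambda>(a', b'). tens V V (m a a') (m b b')) Y)"
proof (rule lin_ext_param_bl[OF _ _ tensor_sub_free[OF V V assms]])
  fix z assume "z \<in> carr V \<times> carr V"
  then show "bilinear_map V V (tensor V V) (\<lambda>a b. case z of (a', b') \<Rightarrow> tens V V (m a a') (m b b'))"
    using bl_comp[OF tens_bl bl_left[OF m] bl_left[OF m], of "fst z" "snd z"] by auto
qed auto

lemma tensor_mult_bl: "bilinear_map (tensor V V) (tensor V V) (tensor V V) (tensor_mult V m)"
  unfolding bilinear_map_def
proof (intro conjI ballI)
  fix Y assume Y: "Y \<in> carr (tensor V V)"
  show "linear_map (tensor V V) (tensor V V) (\<lambda>x. tensor_mult V m x Y)"
    unfolding tensor_mult_def by (rule lift_lm[OF _ _ _ _ tensor_mult_outer_bl[OF Y]]) auto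
  show "linear_map (tensor V V) (tensor V V) (tensor_mult V m Y)"
    unfolding tensor_mult_def
  proof (rule lin_ext_param_lm[OF _ _ tensor_sub_free[OF V V Y]])
    fix z assume z: "z \<in> carr V \<times> carr V"
    show "linear_map (tensor V V) (tensor V V)
      (\<lambda>Y. case z of (a, b) \<Rightarrow> lin_ext pscale (\<lambda>(a', b'). tens V V (m a a') (m b b')) Y)"
      using z lift_lm[OF _ _ _ _ tensor_mult_inner_bl] by (auto split: prod.splits)
  qed auto
qed

lemma tensor_mult_tens:
  assumes [simp]: "a \<in> carr V" "b \<in> carr V" "a' \<in> carr V" "b' \<in> carr V"
  shows "tensor_mult V m (tens V V a b) (tens V V a' b') = tens V V (m a a') (m b b')"
  unfolding tensor_mult_def
  by (simp add: lift_tens[OF _ _ _ _ tensor_mult_outer_bl] lift_tens[OF _ _ _ _ tensor_mult_inner_bl])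

end

lemma tensor_map_mult:
  assumes V [simp]: "is_vspace V" and W [simp]: "is_vspace W"
    and m: "bilinear_map V V V m" and n: "bilinear_map W W W n"
    and h: "linear_map V W h" and hom: "\<And>x y. x \<in> carr V \<Longrightarrow> y \<in> carr V \<Longrightarrow> h (m x y) = n (h x) (h y)"
    and X: "X \<in> carr (tensor V V)" and Y: "Y \<in> carr (tensor V V)"
  shows "tensor_map W W h h (tensor_mult V m X Y)
    = tensor_mult W n (tensor_map W W h h X) (tensor_map W W h h Y)"
proof -
  note mb = tensor_mult_bl[OF V m] and nb = tensor_mult_bl[OF W n]
  note hh = tensor_map_lm[OF V V W W h h]
  note bl = bl_lm[OF mb hh] bl_comp[OF nb hh hh]
  have "tensor_map W W h h (tensor_mult V m (tens V V a b) Y)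
    = tensor_mult W n (tensor_map W W h h (tens V V a b)) (tensor_map W W h h Y)"
    if "a \<in> carr V" "b \<in> carr V" for a b
    by (rule tensor_eqI[OF V V Y bl_right[OF bl(1)] bl_right[OF bl(2)]])
      (use that in \<open>auto simp: tensor_mult_tens[OF V m] tensor_mult_tens[OF W n] tensor_map_tens[OF V V W W h h]
        bl_closed[OF m] lm_closed[OF h] hom\<close>)
  then show ?thesis
    by (intro tensor_eqI[OF V V X bl_left[OF bl(1)] bl_left[OF bl(2)]]) (use Y in auto)
qed

lemma tensor_mult_assoc:
  assumes V [simp]: "is_vspace V" and m: "bilinear_map V V V m"
    and assoc: "\<And>x y z. x \<in> carr V \<Longrightarrow> y \<in> carr V \<Longrightarrow> z \<in> carr V \<Longrightarrow> m (m x y) z = m x (m y z)"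
    and X: "X \<in> carr (tensor V V)" and Y: "Y \<in> carr (tensor V V)" and Z: "Z \<in> carr (tensor V V)"
  shows "tensor_mult V m (tensor_mult V m X Y) Z = tensor_mult V m X (tensor_mult V m Y Z)"
proof -
  let ?T = "tensor_mult V m" and ?V = "tensor V V" and ?t = "tens V V"
  note b = tensor_mult_bl[OF V m]
  note cl = bl_closed[OF b] bl_closed[OF m]
  have 1: "?T (?T (?t a a') (?t b b')) Z = ?T (?t a a') (?T (?t b b') Z)"
    if "a \<in> carr V" "a' \<in> carr V" "b \<in> carr V" "b' \<in> carr V" for a a' b b'
    by (rule tensor_eqI[OF V V Z bl_right[OF b] lm_comp[OF bl_right[OF b] bl_right[OF b]]])
      (use that in \<open>auto simp: tensor_mult_tens[OF V m] cl assoc\<close>)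
  have 2: "?T (?T (?t a a') Y) Z = ?T (?t a a') (?T Y Z)" if "a \<in> carr V" "a' \<in> carr V" for a a'
    by (rule tensor_eqI[OF V V Y lm_comp[OF bl_right[OF b] bl_left[OF b]]
          lm_comp[OF bl_left[OF b] bl_right[OF b]]])
      (use that Z in \<open>auto simp: 1\<close>)
  show ?thesis
    by (rule tensor_eqI[OF V V X lm_comp[OF bl_left[OF b] bl_left[OF b]] bl_left[OF b]])
      (use Y Z in \<open>auto simp: 2 cl\<close>)
qed


section \<open>Coalgebras\<close>

lemma counital_coassociativeD:
  assumes "counital_coassociative C"
  shows cc_vspace: "is_vspace C"
    and cc_comul: "linear_map C (tensor C C) (comul C)"
    and cc_counit: "linear_map C ground_field (counit C)"
    and cc_counit_left: "x \<in> carr C \<Longrightarrow> lin_ext (scl C) (\<lambda>(a, b). scl C (counit C a) b) (comul C x) = x"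
    and cc_counit_right: "x \<in> carr C \<Longrightarrow> lin_ext (scl C) (\<lambda>(a, b). scl C (counit C b) a) (comul C x) = x"
  using assms by (auto simp: counital_coassociative_def)

text \<open>Coassociativity in the form in which Sweedler notation uses it.\<close>

lemma coassoc_lift:
  fixes C :: "('k::field, 'v::ab_group_add, 'z) coalg_scheme"
  assumes cc: "counital_coassociative C" and U: "is_vspace U" and s: "scl U = s"
    and g12: "\<And>c. c \<in> carr C \<Longrightarrow> bilinear_map C C U (\<lambda>a b. g a b c)"
    and g23: "\<And>a. a \<in> carr C \<Longrightarrow> bilinear_map C C U (\<lambda>b c. g a b c)"
    and z: "z \<in> carr C"
  shows "lin_ext s (\<lambda>(x, c). lin_ext s (\<lambda>(a, b). g a b c) (comul C x)) (comul C z)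
       = lin_ext s (\<lambda>(a, x). lin_ext s (\<lambda>(b, c). g a b c) (comul C x)) (comul C z)"
proof -
  note C [simp] = cc_vspace[OF cc] and D = cc_comul[OF cc]
  let ?D = "comul C" and ?T = "tensor C C"
  have Dz: "?D z \<in> carr ?T" by (rule lm_closed[OF D z])
  \<comment> \<open>\<open>G\<close> evaluates \<open>g\<close> on
    \<open>C \<otimes> (C \<otimes> C)\<close>. The right side of the claim is \<open>G\<close> on
    one iterated coproduct, the left side is \<open>G\<close> on the other one after reassociation,
    so the coassociativity axiom identifies them.\<close>
  define G where "G = lin_ext s (\<lambda>(a, Z). lin_ext s (\<lambda>(b, c). g a b c) Z)"
  have in1: "bilinear_map C ?T U (\<lambda>a Z. lin_ext s (\<lambda>(b, c). g a b c) Z)"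
    unfolding bilinear_map_def
  proof (intro conjI ballI)
    show "linear_map ?T U (lin_ext s (\<lambda>(b, c). g a b c))" if "a \<in> carr C" for a
      by (rule lift_lm[OF C C U s g23[OF that]])
    show "linear_map C U (\<lambda>a. lin_ext s (\<lambda>(b, c). g a b c) Z)" if "Z \<in> carr ?T" for Z
    proof (rule lin_ext_param_lm[OF U s tensor_sub_free[OF C C that]])
      show "linear_map C U (\<lambda>a. case z of (b, c) \<Rightarrow> g a b c)" if "z \<in> carr C \<times> carr C" for z
        using that bl_left[OF g12, of "snd z" "fst z"] by auto
    qed
  qed
  have G_lm: "linear_map (tensor C ?T) U G"
    unfolding G_def by (rule lift_lm[OF _ _ U s in1]) auto
  have G_tens: "G (tens C ?T a Z) = lin_ext s (\<lambda>(b, c). g a b c) Z" if "a \<in> carr C" "Z \<in> carr ?T" for a Z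
    unfolding G_def by (rule lift_tens[OF _ _ U s in1]) (use that in auto)
  have R: "lin_ext s (\<lambda>(a, x). lin_ext s (\<lambda>(b, c). g a b c) (?D x)) (?D z)
      = G (tensor_map C ?T id ?D (?D z))"
  proof (rule tensor_eqI[OF C C Dz])
    have bl: "bilinear_map C C U (\<lambda>a x. lin_ext s (\<lambda>(b, c). g a b c) (?D x))"
      using bl_comp[OF in1 lm_id D] .
    show "linear_map ?T U (lin_ext s (\<lambda>(a, x). lin_ext s (\<lambda>(b, c). g a b c) (?D x)))"
      by (rule lift_lm[OF C C U s bl])
    have i: "linear_map C C id" by (simp add: id_def)
    show "linear_map ?T U (\<lambda>X. G (tensor_map C ?T id ?D X))"
      by (rule lm_comp[OF tensor_map_lm[OF _ _ _ _ i D] G_lm]) auto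
    fix x y assume "x \<in> carr C" "y \<in> carr C"
    then show "lin_ext s (\<lambda>(a, x). lin_ext s (\<lambda>(b, c). g a b c) (?D x)) (tens C C x y)
        = G (tensor_map C ?T id ?D (tens C C x y))"
      by (simp add: lift_tens[OF C C U s bl] tensor_map_tens[OF _ _ _ _ i D] G_tens lm_closed[OF D])
  qed
  have as_in: "bilinear_map C C (tensor C ?T) (\<lambda>u v. tens C ?T u (tens C C v w))" if "w \<in> carr C" for w
    by (rule bl_comp[OF tens_bl lm_id bl_left[OF tens_bl]]) (use that in auto)
  have as_out: "bilinear_map ?T C (tensor C ?T)
      (\<lambda>X w. lin_ext pscale (\<lambda>(u, v). tens C ?T u (tens C C v w)) X)"
    unfolding bilinear_map_def
  proof (intro conjI ballI)
    show "linear_map ?T (tensor C ?T) (\<lambda>X. lin_ext pscale (\<lambda>(u, v). tens C ?T u (tens C C v w)) X)"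
      if "w \<in> carr C" for w
      by (rule lift_lm[OF _ _ _ _ as_in[OF that]]) auto
    show "linear_map C (tensor C ?T) (\<lambda>w. lin_ext pscale (\<lambda>(u, v). tens C ?T u (tens C C v w)) X)"
      if "X \<in> carr ?T" for X
    proof (rule lin_ext_param_lm[OF _ _ tensor_sub_free[OF C C that]])
      show "linear_map C (tensor C ?T) (\<lambda>w. case z of (u, v) \<Rightarrow> tens C ?T u (tens C C v w))"
        if "z \<in> carr C \<times> carr C" for z
        using that lm_comp[OF bl_right[OF tens_bl[OF C C], of "snd z"]
            bl_right[OF tens_bl[of C ?T], of "fst z"]] by auto
    qed auto
  qed
  have as_lm: "linear_map (tensor ?T C) (tensor C ?T) (tensor_assoc C C C)"
    unfolding tensor_assoc_def by (rule lift_lm[OF _ _ _ _ as_out]) auto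
  have as_tens: "tensor_assoc C C C (tens ?T C X w) = lin_ext pscale (\<lambda>(u, v). tens C ?T u (tens C C v w)) X"
    if "X \<in> carr ?T" "w \<in> carr C" for X w
    unfolding tensor_assoc_def by (rule lift_tens[OF _ _ _ _ as_out]) (use that in auto)
  \<comment> \<open>After reassociation \<open>G\<close> contracts the first two slots with the
    third one fixed. On a pure tensor in the first slot both sides reduce to a single value of
    \<open>g\<close>.\<close>
  have G_as: "G (tensor_assoc C C C (tens ?T C X w)) = lin_ext s (\<lambda>(a, b). g a b w) X"
    if X: "X \<in> carr ?T" and w: "w \<in> carr C" for X w
  proof -
    have "G (lin_ext pscale (\<lambda>(u, v). tens C ?T u (tens C C v w)) X) = lin_ext s (\<lambda>(a, b). g a b w) X"
    proof (rule tensor_eqI[OF C C X])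
      show "linear_map ?T U (\<lambda>X. G (lin_ext pscale (\<lambda>(u, v). tens C ?T u (tens C C v w)) X))"
        by (rule lm_comp[OF bl_left[OF as_out w] G_lm])
      show "linear_map ?T U (lin_ext s (\<lambda>(a, b). g a b w))"
        by (rule lift_lm[OF C C U s g12[OF w]])
      fix x y assume xy: "x \<in> carr C" "y \<in> carr C"
      have "lin_ext pscale (\<lambda>(u, v). tens C ?T u (tens C C v w)) (tens C C x y) = tens C ?T x (tens C C y w)"
        by (rule lift_tens[OF _ _ _ _ as_in[OF w]]) (use xy in auto)
      then show "G (lin_ext pscale (\<lambda>(u, v). tens C ?T u (tens C C v w)) (tens C C x y))
          = lin_ext s (\<lambda>(a, b). g a b w) (tens C C x y)"
        using xy w by (simp add: G_tens lift_tens[OF C C U s g12[OF w]] lift_tens[OF C C U s g23])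
    qed
    then show ?thesis by (simp add: as_tens[OF that])
  qed
  have L: "lin_ext s (\<lambda>(x, c). lin_ext s (\<lambda>(a, b). g a b c) (?D x)) (?D z)
      = G (tensor_assoc C C C (tensor_map ?T C ?D id (?D z)))"
  proof (rule tensor_eqI[OF C C Dz])
    have bl0: "bilinear_map ?T C U (\<lambda>X c. lin_ext s (\<lambda>(a, b). g a b c) X)"
      unfolding bilinear_map_def
    proof (intro conjI ballI)
      show "linear_map ?T U (\<lambda>X. lin_ext s (\<lambda>(a, b). g a b c) X)" if "c \<in> carr C" for c
        by (rule lift_lm[OF C C U s g12[OF that]])
      show "linear_map C U (\<lambda>c. lin_ext s (\<lambda>(a, b). g a b c) Z)" if "Z \<in> carr ?T" for Z
      proof (rule lin_ext_param_lm[OF U s tensor_sub_free[OF C C that]])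
        show "linear_map C U (\<lambda>c. case z of (a, b) \<Rightarrow> g a b c)" if "z \<in> carr C \<times> carr C" for z
          using that bl_right[OF g23, of "fst z" "snd z"] by auto
      qed
    qed
    have bl: "bilinear_map C C U (\<lambda>x c. lin_ext s (\<lambda>(a, b). g a b c) (?D x))"
      using bl_comp[OF bl0 D lm_id] .
    show "linear_map ?T U (lin_ext s (\<lambda>(x, c). lin_ext s (\<lambda>(a, b). g a b c) (?D x)))"
      by (rule lift_lm[OF C C U s bl])
    have i: "linear_map C C id" by (simp add: id_def)
    show "linear_map ?T U (\<lambda>X. G (tensor_assoc C C C (tensor_map ?T C ?D id X)))"
      by (rule lm_comp[OF tensor_map_lm[OF _ _ _ _ D i] lm_comp[OF as_lm G_lm]]) auto
    fix x y assume "x \<in> carr C" "y \<in> carr C"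
    then show "lin_ext s (\<lambda>(x, c). lin_ext s (\<lambda>(a, b). g a b c) (?D x)) (tens C C x y)
        = G (tensor_assoc C C C (tensor_map ?T C ?D id (tens C C x y)))"
      by (simp add: lift_tens[OF C C U s bl] tensor_map_tens[OF _ _ _ _ D i] G_as lm_closed[OF D])
  qed
  show ?thesis unfolding L R using cc z by (auto simp: counital_coassociative_def)
qed

section \<open>The tensor coalgebra\<close>

text \<open>Words of all lengths are treated at once: such an \<open>F\<close> amounts to a linear
  map on the direct sum of all tensor powers, through \<open>word_lift\<close>.\<close>

definition multilinear ::
  "('k::field, 'v::ab_group_add, 'y) vspace_scheme \<Rightarrow> ('k, 'w::ab_group_add, 'z) vspace_scheme
    \<Rightarrow> ('v list \<Rightarrow> 'w) \<Rightarrow> bool" where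
  "multilinear V U F \<longleftrightarrow>
     (\<forall>vs\<in>lists (carr V). F vs \<in> carr U) \<and>
     (\<forall>us\<in>lists (carr V). \<forall>ws\<in>lists (carr V). linear_map V U (\<lambda>x. F (us @ x # ws)))"

lemma multilinearI:
  assumes "\<And>vs. vs \<in> lists (carr V) \<Longrightarrow> F vs \<in> carr U"
    and "\<And>us x y ws. us \<in> lists (carr V) \<Longrightarrow> ws \<in> lists (carr V) \<Longrightarrow> x \<in> carr V \<Longrightarrow> y \<in> carr V
      \<Longrightarrow> F (us @ (x + y) # ws) = F (us @ x # ws) + F (us @ y # ws)"
    and "\<And>us c x ws. us \<in> lists (carr V) \<Longrightarrow> ws \<in> lists (carr V) \<Longrightarrow> x \<in> carr V
      \<Longrightarrow> F (us @ scl V c x # ws) = scl U c (F (us @ x # ws))"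
  shows "multilinear V U F"
  using assms by (simp add: multilinear_def linear_map_def)

lemma ml_closed: "multilinear V U F \<Longrightarrow> vs \<in> lists (carr V) \<Longrightarrow> F vs \<in> carr U"
  and ml_lm: "multilinear V U F \<Longrightarrow> us \<in> lists (carr V) \<Longrightarrow> ws \<in> lists (carr V)
    \<Longrightarrow> linear_map V U (\<lambda>x. F (us @ x # ws))"
  by (auto simp: multilinear_def)

lemma lin_ext_param_ml:
  assumes "is_vspace U" "scl U = s" "Y \<in> free_on Z" "\<And>z. z \<in> Z \<Longrightarrow> multilinear V U (\<lambda>vs. F vs z)"
  shows "multilinear V U (\<lambda>vs. lin_ext s (F vs) Y)"
  unfolding multilinear_def
proof (intro conjI ballI)
  show "lin_ext s (F vs) Y \<in> carr U" if "vs \<in> lists (carr V)" for vs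
    using lin_ext_closed[OF assms(1,3)] ml_closed[OF assms(4) that] assms(2) by auto
  show "linear_map V U (\<lambda>x. lin_ext s (F (us @ x # ws)) Y)"
    if "us \<in> lists (carr V)" "ws \<in> lists (carr V)" for us ws
    by (rule lin_ext_param_lm[OF assms(1-3)]) (rule ml_lm[OF assms(4) that])
qed

lemma scl_word_space [simp]: "scl (word_space V) = pscale"
  by (simp add: word_space_def quotient_space_def)

context
  fixes V :: "('k::field, 'v::ab_group_add, 'z) vspace_scheme"
  assumes V [simp]: "is_vspace V"
begin

lemma quot_word: "quot (free_on (lists (carr V))) (word_rel V)"
proof -
  have "word_rel V \<subseteq> free_on (lists (carr V))"
    unfolding word_rel_def
    by (rule module.span_minimal[OF module_pscale _ subspace_free_on])
      (auto intro!: free_on_simps(3,4) basis_in_free_on)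
  then show ?thesis by (simp add: quot_def subspace_free_on)
    (simp add: word_rel_def module.subspace_span[OF module_pscale])
qed

interpretation quot "free_on (lists (carr V))" "word_rel V" by (rule quot_word)

lemma is_vspace_word_space [simp]: "is_vspace (word_space V)"
  unfolding word_space_def by (rule is_vspace_Q)

lemma word_sub_free: "X \<in> carr (word_space V) \<Longrightarrow> X \<in> free_on (lists (carr V))"
  unfolding word_space_def by (rule Q_sub_C)

lemma word_closed: "vs \<in> lists (carr V) \<Longrightarrow> word V vs \<in> carr (word_space V)"
  unfolding word_space_def word_def by (rule rep_closed) simp

lemma word_ml: "multilinear V (word_space V) (word V)"
proof (rule multilinearI)
  note eq = coset_rep_eq_iff[OF N, THEN iffD2]
  note base = module.span_base[OF module_pscale]
  fix us ws assume *: "us \<in> lists (carr V)" "ws \<in> lists (carr V)"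
  show "word V (us @ (x + y) # ws) = word V (us @ x # ws) + word V (us @ y # ws)"
    if "x \<in> carr V" "y \<in> carr V" for x y
    unfolding word_def rep_add[symmetric] word_rel_def[symmetric] using that *
    by (intro eq) (unfold word_rel_def diff_diff_add[symmetric], rule base, rule UnI1, simp, blast)
  show "word V (us @ scl V c x # ws) = scl (word_space V) c (word V (us @ x # ws))"
    if "x \<in> carr V" for c x
    unfolding word_def scl_word_space rep_pscale[symmetric] using that *
    by (intro eq) (unfold word_rel_def, rule base, rule UnI2, simp, blast)
qed (rule word_closed)

text \<open>In contrast to \<open>tensor_induct\<close> the scalar stays in the generating case,
  because the empty word has no letter that could absorb it.\<close>

lemma word_induct [consumes 1, case_names zero word add]:
  assumes X: "X \<in> carr (word_space V)"
    and zero: "P 0" and wd: "\<And>c vs. vs \<in> lists (carr V) \<Longrightarrow> P (pscale c (word V vs))"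
    and add: "\<And>X Y. X \<in> carr (word_space V) \<Longrightarrow> Y \<in> carr (word_space V) \<Longrightarrow> P X \<Longrightarrow> P Y \<Longrightarrow> P (X + Y)"
  shows "P X"
proof -
  have "P (coset_rep (word_rel V) f)" if "f \<in> free_on (lists (carr V))" for f
    using that
  proof (induction f rule: free_on_induct)
    case zero
    then show ?case using assms(2) coset_rep_zero[OF N, of 0] module.subspace_0[OF module_pscale N]
      by simp
  next
    case (basis c vs)
    then show ?case using wd[of vs c] by (simp add: rep_pscale word_def)
  next
    case (add f g)
    then show ?case
      using assms(4)[of "coset_rep (word_rel V) f" "coset_rep (word_rel V) g"]
      by (simp add: rep_add word_space_def)
  qed
  moreover obtain f where "f \<in> free_on (lists (carr V))" "X = coset_rep (word_rel V) f"
    using X unfolding word_space_def carr_Q by blast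
  ultimately show ?thesis by simp
qed

lemma word_eqI:
  assumes "X \<in> carr (word_space V)"
    and f: "linear_map (word_space V) U f" and g: "linear_map (word_space V) U g"
    and eq: "\<And>vs. vs \<in> lists (carr V) \<Longrightarrow> f (word V vs) = g (word V vs)"
  shows "f X = g X"
  using assms(1)
proof (induction rule: word_induct)
  case zero
  then show ?case using lm_zero[OF _ f] lm_zero[OF _ g] by simp
next
  case (word c vs)
  then show ?case using lm_scl[OF f word_closed, of vs c] lm_scl[OF g word_closed, of vs c]
    by (simp add: eq)
qed (auto simp: lm_add[OF f] lm_add[OF g])

text \<open>Universal property of the sum of tensor powers: the two families of generators of
  \<open>word_rel\<close> are exactly the failures of linearity in one letter, and a multilinear
  \<open>F\<close> kills them.\<close>

lemma
  assumes U: "is_vspace U" and s: "scl U = s" and F: "multilinear V U F"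
  shows word_lift_lm: "linear_map (word_space V) U (lin_ext s F)"
    and word_lift: "vs \<in> lists (carr V) \<Longrightarrow> lin_ext s F (word V vs) = F vs"
proof -
  have s': "module s" using U s by (auto simp: is_vspaceD(2))
  note F_simps = lm_add[OF ml_lm[OF F]] lm_scl[OF ml_lm[OF F], unfolded s]
  have rel: "lin_ext s F f = 0" if "f \<in> word_rel V" for f
    by (rule lin_ext_span_zero[OF s' _ that[unfolded word_rel_def]])
      (elim UnE CollectE exE conjE; simp add: lin_ext_diff[OF s'] lin_ext_pscale[OF s'] s' F_simps
        del: in_lists_conv_set)
  note rep = lin_ext_coset_rep[OF s' N rel]
  show "lin_ext s F (word V vs) = F vs" if "vs \<in> lists (carr V)"
    using that by (simp add: word_def rep s')
  show "linear_map (word_space V) U (lin_ext s F)"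
  proof (rule linear_mapI)
    show "lin_ext s F X \<in> carr U" if "X \<in> carr (word_space V)" for X
      using lin_ext_closed[OF U word_sub_free[OF that], of F] by (simp add: s ml_closed[OF F])
  qed (auto simp: lin_ext_add s' lin_ext_pscale s)
qed

section \<open>The concatenation product of the tensor algebra\<close>

definition wcat :: "('v list \<Rightarrow>\<^sub>0 'k) \<Rightarrow> ('v list \<Rightarrow>\<^sub>0 'k) \<Rightarrow> ('v list \<Rightarrow>\<^sub>0 'k)" where
  "wcat X Y = lin_ext pscale (\<lambda>us. lin_ext pscale (\<lambda>vs. word V (us @ vs)) Y) X"

lemma word_append_ml:
  assumes "us \<in> lists (carr V)"
  shows "multilinear V (word_space V) (\<lambda>vs. word V (us @ vs))"
    and "multilinear V (word_space V) (\<lambda>vs. word V (vs @ us))"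
  using assms word_closed ml_lm[OF word_ml] ml_lm[OF word_ml, of "us @ _"]
  by (auto simp: multilinear_def)

lemma wcat_outer_ml:
  assumes "Y \<in> carr (word_space V)"
  shows "multilinear V (word_space V) (\<lambda>us. lin_ext pscale (\<lambda>vs. word V (us @ vs)) Y)"
  by (rule lin_ext_param_ml[OF _ _ word_sub_free[OF assms]]) (use word_append_ml in auto)

lemma wcat_bl: "bilinear_map (word_space V) (word_space V) (word_space V) wcat"
  unfolding bilinear_map_def
proof (intro conjI ballI)
  fix Y assume Y: "Y \<in> carr (word_space V)"
  show "linear_map (word_space V) (word_space V) (\<lambda>X. wcat X Y)"
    unfolding wcat_def by (rule word_lift_lm[OF _ _ wcat_outer_ml[OF Y]]) auto
  show "linear_map (word_space V) (word_space V) (wcat Y)"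
    unfolding wcat_def
    by (rule lin_ext_param_lm[OF _ _ word_sub_free[OF Y]])
      (auto intro!: word_lift_lm word_append_ml)
qed

lemma wcat_word:
  assumes "us \<in> lists (carr V)" "vs \<in> lists (carr V)"
  shows "wcat (word V us) (word V vs) = word V (us @ vs)"
  unfolding wcat_def using assms
  by (simp add: word_lift[OF _ _ wcat_outer_ml] word_lift[OF _ _ word_append_ml(1)] word_closed)

lemma wcat_assoc:
  assumes X: "X \<in> carr (word_space V)" and Y: "Y \<in> carr (word_space V)" and Z: "Z \<in> carr (word_space V)"
  shows "wcat (wcat X Y) Z = wcat X (wcat Y Z)"
proof -
  note b = wcat_bl
  have 1: "wcat (wcat (word V us) (word V vs)) Z = wcat (word V us) (wcat (word V vs) Z)"
    if "us \<in> lists (carr V)" "vs \<in> lists (carr V)" for us vs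
    by (rule word_eqI[OF Z bl_right[OF b] lm_comp[OF bl_right[OF b] bl_right[OF b]]])
      (use that in \<open>auto simp: wcat_word bl_closed[OF b] word_closed\<close>)
  have 2: "wcat (wcat (word V us) Y) Z = wcat (word V us) (wcat Y Z)"
    if "us \<in> lists (carr V)" for us
    by (rule word_eqI[OF Y lm_comp[OF bl_right[OF b] bl_left[OF b]]
          lm_comp[OF bl_left[OF b] bl_right[OF b]]])
      (use that Z in \<open>auto simp: 1 word_closed\<close>)
  show ?thesis
    by (rule word_eqI[OF X lm_comp[OF bl_left[OF b] bl_left[OF b]] bl_left[OF b]])
      (use Y Z in \<open>auto simp: 2 bl_closed[OF b]\<close>)
qed

lemma wcat_unit:
  assumes X: "X \<in> carr (word_space V)"
  shows "wcat (word V []) X = X" "wcat X (word V []) = X"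
  by (rule word_eqI[OF X bl_right[OF wcat_bl] lm_id], simp_all add: wcat_word word_closed)
    (rule word_eqI[OF X bl_left[OF wcat_bl] lm_id], simp_all add: wcat_word word_closed)

text \<open>The number of cuts depends only on the length of the word, and each cut puts the varying
  letter into exactly one of the two factors, where the summand is linear in it.\<close>

lemma split_word_ml:
  "multilinear V (tensor (word_space V) (word_space V))
     (\<lambda>vs. \<Sum>i\<le>length vs. tens (word_space V) (word_space V) (word V (take i vs)) (word V (drop i vs)))"
proof -
  let ?W = "word_space V"
  let ?t = "\<lambda>i vs. tens ?W ?W (word V (take i vs)) (word V (drop i vs))"
  have lm: "linear_map V (tensor ?W ?W) (\<lambda>x. ?t i (us @ x # ws))"
    if us: "us \<in> lists (carr V)" and ws: "ws \<in> lists (carr V)" for us ws i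
  proof (cases "i \<le> length us")
    case True
    have "linear_map V (tensor ?W ?W) (\<lambda>x. tens ?W ?W (word V (take i us)) (word V (drop i us @ x # ws)))"
      by (rule lm_comp[OF ml_lm[OF word_ml] bl_right[OF tens_bl]])
        (use us ws in \<open>auto dest: in_set_takeD in_set_dropD intro: word_closed\<close>)
    then show ?thesis using True by simp
  next
    case False
    \<comment> \<open>The cut lies behind \<open>x\<close>, so the left factor ends with
      \<open>x\<close> and the first \<open>j\<close> letters of \<open>ws\<close>.\<close>
    then obtain j where j: "i - length us = Suc j" by (cases "i - length us") auto
    have "linear_map V (tensor ?W ?W) (\<lambda>x. tens ?W ?W (word V (us @ x # take j ws)) (word V (drop j ws)))"
      by (rule lm_comp[OF ml_lm[OF word_ml] bl_left[OF tens_bl]])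
        (use us ws in \<open>auto dest: in_set_takeD in_set_dropD intro: word_closed\<close>)
    then show ?thesis using False j by simp
  qed
  have sum: "linear_map V (tensor ?W ?W) (\<lambda>x. \<Sum>i\<le>n. ?t i (us @ x # ws))"
    if us: "us \<in> lists (carr V)" and ws: "ws \<in> lists (carr V)" for us ws and n :: nat
    using lm[OF us ws, of 0] lm[OF us ws, of "Suc _"]
    by (induction n) (simp_all del: take_append drop_append take_Suc_Cons drop_Suc_Cons
        add: lm_plus)
  show ?thesis
    unfolding multilinear_def
  proof (intro conjI ballI)
    show "(\<Sum>i\<le>length vs. ?t i vs) \<in> carr (tensor ?W ?W)" if "vs \<in> lists (carr V)" for vs
      using that by (auto intro!: vs_sum tens_closed word_closed dest: in_set_takeD in_set_dropD)
    show "linear_map V (tensor ?W ?W) (\<lambda>x. \<Sum>i\<le>length (us @ x # ws). ?t i (us @ x # ws))"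
      if "us \<in> lists (carr V)" "ws \<in> lists (carr V)" for us ws
      using sum[OF that, of "Suc (length us + length ws)"]
      by (simp del: take_append drop_append sum.atMost_Suc)
  qed
qed

section \<open>The structure maps of the tensor coalgebra on words\<close>

abbreviation (input) "TC \<equiv> tensor_coalgebra V"

lemma tc_simps [simp]:
  "carr TC = carr (word_space V)" "scl TC = pscale" "one TC = word V []"
  by (simp_all add: tensor_coalgebra_def)

lemma tc_tens [simp]:
  "tensor_rel TC TC = tensor_rel (word_space V) (word_space V)"
  "tensor TC TC = tensor (word_space V) (word_space V)"
  "tens TC TC = tens (word_space V) (word_space V)"
  by (auto simp: tensor_def tens_def tensor_rel_def fun_eq_iff)

lemma comul_word: "vs \<in> lists (carr V) \<Longrightarrow> comul TC (word V vs) =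
    (\<Sum>i\<le>length vs. tens (word_space V) (word_space V) (word V (take i vs)) (word V (drop i vs)))"
  unfolding tensor_coalgebra_def using word_lift[OF _ _ split_word_ml] by simp

lemma comul_word_lm: "linear_map (word_space V) (tensor (word_space V) (word_space V)) (comul TC)"
  unfolding tensor_coalgebra_def using word_lift_lm[OF _ _ split_word_ml] by simp

text \<open>The counit is defined as a coefficient of a representative. It is nevertheless well
  defined, being the extension of the indicator function of the empty word: that function is
  multilinear because it vanishes on every word with a letter.\<close>

lemma
  shows counit_word: "vs \<in> lists (carr V) \<Longrightarrow> counit TC (word V vs) = (if vs = [] then 1 else 0)"
    and counit_word_lm: "linear_map (word_space V) ground_field (counit TC)"
proof -
  let ?F = "\<lambda>vs. if vs = [] then 1 else 0 :: 'k"
  have ml: "multilinear V ground_field ?F" by (rule multilinearI) auto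
  have "lin_ext (*) ?F f = counit TC f" for f
    by (auto simp: lin_ext_def tensor_coalgebra_def if_distrib in_keys_iff cong: if_cong)
  then have eq: "counit TC = lin_ext (*) ?F" by auto
  show "vs \<in> lists (carr V) \<Longrightarrow> counit TC (word V vs) = ?F vs"
    unfolding eq by (rule word_lift[OF _ _ ml]) auto
  show "linear_map (word_space V) ground_field (counit TC)"
    unfolding eq by (rule word_lift_lm[OF _ _ ml]) auto
qed

end

section \<open>Cuttings\<close>

text \<open>The possible sizes of the first piece of a cutting; \<open>(0, 0)\<close> is excluded
  just as \<open>([], [])\<close> is excluded in \<open>cuttings\<close>.\<close>

definition first_cuts :: "'a list \<Rightarrow> 'a list \<Rightarrow> (nat \<times> nat) set" where
  "first_cuts us vs = {(i, j). i \<le> length us \<and> j \<le> length vs \<and> (i, j) \<noteq> (0, 0)}"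

lemma finite_first_cuts [simp]: "finite (first_cuts us vs)"
  by (rule finite_subset[of _ "{..length us} \<times> {..length vs}"]) (auto simp: first_cuts_def)

lemma cuttings_Nil [simp]: "cuttings [] [] = {[]}"
proof -
  have "ps = []" if "ps \<in> cuttings [] []" for ps :: "('a list \<times> 'a list) list"
    using that by (cases ps) (auto simp: cuttings_def)
  then show ?thesis by (auto simp: cuttings_def)
qed

lemma Nil_in_cuttings [simp]: "[] \<in> cuttings us vs \<longleftrightarrow> us = [] \<and> vs = []"
  by (auto simp: cuttings_def)

text \<open>A recursive description of cuttings in which the first piece is encoded by its two
  lengths; finiteness and summation by the first piece rest on it.\<close>

lemma Cons_in_cuttings:
  "p # ps \<in> cuttings us vs \<longleftrightarrow>
     (length (fst p), length (snd p)) \<in> first_cuts us vs \<and> fst p = take (length (fst p)) us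
     \<and> snd p = take (length (snd p)) vs
     \<and> ps \<in> cuttings (drop (length (fst p)) us) (drop (length (snd p)) vs)"
proof -
  have *: "xs @ ys = zs \<longleftrightarrow> length xs \<le> length zs \<and> xs = take (length xs) zs \<and> ys = drop (length xs) zs"
    for xs ys zs :: "'a list"
    by (metis append_eq_conv_conj append_take_drop_id length_append le_add1)
  show ?thesis
    unfolding cuttings_def first_cuts_def by (cases p) (auto simp: * simp del: append_take_drop_id)
qed

text \<open>Every piece uses up at least one letter, so the rest of a cutting belongs to a shorter
  pair of words. Without finiteness the sums over cuttings would be \<open>0\<close> by
  convention.\<close>

lemma finite_cuttings [simp]: "finite (cuttings us vs)"
proof (induction "length us + length vs" arbitrary: us vs rule: less_induct)
  case less
  let ?S = "\<Union>(i, j)\<in>first_cuts us vs.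
    (#) (take i us, take j vs) ` cuttings (drop i us) (drop j vs)"
  have "cuttings us vs \<subseteq> insert [] ?S"
  proof
    fix ps assume "ps \<in> cuttings us vs"
    then show "ps \<in> insert [] ?S"
      by (cases ps) (force simp: Cons_in_cuttings)+
  qed
  moreover have "finite ?S"
    by (intro finite_UN_I finite_first_cuts) (auto simp: first_cuts_def intro!: less)
  ultimately show ?case by (meson finite.insertI finite_subset)
qed

text \<open>A nonempty cutting corresponds to the sizes of its first piece together with a cutting
  of what remains; the assumption excludes the empty cutting.\<close>

lemma sum_cuttings_first:
  assumes "us \<noteq> [] \<or> vs \<noteq> []"
  shows "(\<Sum>ps\<in>cuttings us vs. F ps) =
    (\<Sum>(i, j)\<in>first_cuts us vs. \<Sum>ps\<in>cuttings (drop i us) (drop j vs). F ((take i us, take j vs) # ps))"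
proof -
  let ?S = "Sigma (first_cuts us vs) (\<lambda>(i, j). cuttings (drop i us) (drop j vs))"
  have "(\<Sum>(i, j)\<in>first_cuts us vs. \<Sum>ps\<in>cuttings (drop i us) (drop j vs). F ((take i us, take j vs) # ps))
      = (\<Sum>(ij, ps)\<in>?S. F ((take (fst ij) us, take (snd ij) vs) # ps))"
    by (subst sum.Sigma[symmetric]) (auto intro!: sum.cong)
  also have "\<dots> = (\<Sum>ps\<in>cuttings us vs. F ps)"
  proof (rule sum.reindex_bij_witness[where
        j = "\<lambda>(ij, ps). (take (fst ij) us, take (snd ij) vs) # ps"
        and i = "\<lambda>ps. ((length (fst (hd ps)), length (snd (hd ps))), tl ps)"])
    fix ps assume ps: "ps \<in> cuttings us vs"
    then obtain p qs where "ps = p # qs" using assms by (cases ps) auto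
    with ps show "(case ((length (fst (hd ps)), length (snd (hd ps))), tl ps) of
          (ij, ps) \<Rightarrow> (take (fst ij) us, take (snd ij) vs) # ps) = ps"
        "((length (fst (hd ps)), length (snd (hd ps))), tl ps) \<in> ?S"
      by (cases p; simp add: Cons_in_cuttings)+
  qed (auto simp: Cons_in_cuttings first_cuts_def min_def)
  finally show ?thesis ..
qed

text \<open>A cutting is determined by the lengths of its pieces, so the cuttings of the two pairs
  of words correspond bijectively, whether or not \<open>h\<close> is injective.\<close>

lemma sum_cuttings_map:
  "(\<Sum>ps\<in>cuttings (map h us) (map h vs). F ps)
    = (\<Sum>ps\<in>cuttings us vs. F (map (\<lambda>p. (map h (fst p), map h (snd p))) ps))"
proof (induction "length us + length vs" arbitrary: us vs F rule: less_induct)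
  case less
  show ?case
  proof (cases "us = [] \<and> vs = []")
    case False
    have "(\<Sum>ps\<in>cuttings (map h us) (map h vs). F ps) =
      (\<Sum>(i, j)\<in>first_cuts us vs. \<Sum>ps\<in>cuttings (drop i us) (drop j vs).
         F (map (\<lambda>p. (map h (fst p), map h (snd p))) ((take i us, take j vs) # ps)))"
      using False
      by (subst sum_cuttings_first)
        (auto simp: first_cuts_def take_map drop_map less intro!: sum.cong)
    also have "\<dots> = (\<Sum>ps\<in>cuttings us vs. F (map (\<lambda>p. (map h (fst p), map h (snd p))) ps))"
      using False by (subst sum_cuttings_first) auto
    finally show ?thesis .
  qed simp
qed

lemma append_in_cuttings:
  "ps @ qs \<in> cuttings us vs \<longleftrightarrow>
    (\<exists>i\<le>length us. \<exists>j\<le>length vs. ps \<in> cuttings (take i us) (take j vs) \<and> qs \<in> cuttings (drop i us) (drop j vs))"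
proof
  assume *: "ps @ qs \<in> cuttings us vs"
  let ?i = "length (concat (map fst ps))" and ?j = "length (concat (map snd ps))"
  have "?i \<le> length us" "?j \<le> length vs" "ps \<in> cuttings (take ?i us) (take ?j vs)"
    "qs \<in> cuttings (drop ?i us) (drop ?j vs)"
    using * by (auto simp: cuttings_def simp del: length_concat)
  then show "\<exists>i\<le>length us. \<exists>j\<le>length vs. ps \<in> cuttings (take i us) (take j vs) \<and> qs \<in> cuttings (drop i us) (drop j vs)"
    by blast
qed (auto simp: cuttings_def)

text \<open>Cutting both words once and then refining each half is the same as cutting the whole and
  choosing a gap between two pieces, or one of the two ends; the gap \<open>l\<close> is recovered
  as the length of \<open>ps\<close>. This is what makes deconcatenation compatible with the
  products of words.\<close>

lemma sum_cuttings_split: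
  "(\<Sum>i\<le>length us. \<Sum>j\<le>length vs. \<Sum>ps\<in>cuttings (take i us) (take j vs).
      \<Sum>qs\<in>cuttings (drop i us) (drop j vs). G ps qs)
    = (\<Sum>ps\<in>cuttings us vs. \<Sum>l\<le>length ps. G (take l ps) (drop l ps))"
proof -
  let ?A = "SIGMA ij:{..length us}\<times>{..length vs}. cuttings (take (fst ij) us) (take (snd ij) vs)
     \<times> cuttings (drop (fst ij) us) (drop (snd ij) vs)"
  let ?B = "SIGMA ps:cuttings us vs. {..length ps}"
  have "(\<Sum>i\<le>length us. \<Sum>j\<le>length vs. \<Sum>ps\<in>cuttings (take i us) (take j vs).
      \<Sum>qs\<in>cuttings (drop i us) (drop j vs). G ps qs)
    = (\<Sum>(ij, ps, qs)\<in>?A. G ps qs)"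
    by (subst sum.Sigma[symmetric]) (auto simp: sum.cartesian_product split_def)
  also have "\<dots> = (\<Sum>(ps, l)\<in>?B. G (take l ps) (drop l ps))"
  proof (rule sum.reindex_bij_witness[where
        j = "\<lambda>(ij, ps, qs). (ps @ qs, length ps)"
        and i = "\<lambda>(ps, l). ((length (concat (map fst (take l ps))), length (concat (map snd (take l ps)))),
           take l ps, drop l ps)"])
    fix a assume "a \<in> ?B"
    then obtain ps l where a: "a = (ps, l)" "ps \<in> cuttings us vs" "l \<le> length ps" by auto
    let ?i = "length (concat (map fst (take l ps)))" and ?j = "length (concat (map snd (take l ps)))"
    have ps: "take l ps @ drop l ps \<in> cuttings us vs" using a by simp
    have "concat (map fst (take l ps)) @ concat (map fst (drop l ps)) = us"
      "concat (map snd (take l ps)) @ concat (map snd (drop l ps)) = vs"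
      "([], []) \<notin> set (take l ps)" "([], []) \<notin> set (drop l ps)"
      using ps unfolding cuttings_def
      by (auto simp flip: concat_append map_append dest: in_set_takeD in_set_dropD)
    then have "?i \<le> length us" "?j \<le> length vs" "take l ps \<in> cuttings (take ?i us) (take ?j vs)"
      "drop l ps \<in> cuttings (drop ?i us) (drop ?j vs)"
      by (auto simp: cuttings_def simp del: length_concat)
    then show "(case a of (ps, l) \<Rightarrow> ((length (concat (map fst (take l ps))), length (concat (map snd (take l ps)))),
           take l ps, drop l ps)) \<in> ?A"
      by (simp add: a del: length_concat)
  next
    fix a assume "a \<in> ?A"
    then obtain i j ps qs where a: "a = ((i, j), ps, qs)" "i \<le> length us" "j \<le> length vs"
      "ps \<in> cuttings (take i us) (take j vs)" "qs \<in> cuttings (drop i us) (drop j vs)" by auto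
    then show "(case a of (ij, ps, qs) \<Rightarrow> (ps @ qs, length ps)) \<in> ?B"
      using append_in_cuttings[of ps qs us vs] by auto
    show "(case case a of (ij, ps, qs) \<Rightarrow> (ps @ qs, length ps) of
       (ps, l) \<Rightarrow> ((length (concat (map fst (take l ps))), length (concat (map snd (take l ps)))),
           take l ps, drop l ps)) = a"
      using a by (simp add: cuttings_def min_def del: length_concat)
  qed auto
  also have "\<dots> = (\<Sum>ps\<in>cuttings us vs. \<Sum>l\<le>length ps. G (take l ps) (drop l ps))"
    by (subst sum.Sigma[symmetric]) auto
  finally show ?thesis .
qed


lemma take_lists: "xs \<in> lists S \<Longrightarrow> take i xs \<in> lists S"
  and drop_lists: "xs \<in> lists S \<Longrightarrow> drop i xs \<in> lists S"
  by (auto dest: in_set_takeD in_set_dropD)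


section \<open>2-associative algebras and the operations \<open>M\<^sub>p\<^sub>q\<close>\<close>

lemma unital_associativeD:
  assumes "unital_associative A m e"
  shows ua_vspace: "is_vspace A" and ua_bl: "bilinear_map A A A m" and ua_unit: "e \<in> carr A"
    and ua_left: "x \<in> carr A \<Longrightarrow> m e x = x" and ua_right: "x \<in> carr A \<Longrightarrow> m x e = x"
    and ua_assoc: "x \<in> carr A \<Longrightarrow> y \<in> carr A \<Longrightarrow> z \<in> carr A \<Longrightarrow> m (m x y) z = m x (m y z)"
  using assms by (auto simp: unital_associative_def)

lemma iterated_closed:
  "\<lbrakk>\<And>x y. x \<in> S \<Longrightarrow> y \<in> S \<Longrightarrow> d x y \<in> S; xs \<in> lists S; xs \<noteq> []\<rbrakk> \<Longrightarrow> iterated d xs \<in> S"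
  by (induction xs rule: induct_list012) auto

lemma iterated_hom:
  assumes "\<And>x y. x \<in> S \<Longrightarrow> y \<in> S \<Longrightarrow> d x y \<in> S"
    and "\<And>x y. x \<in> S \<Longrightarrow> y \<in> S \<Longrightarrow> h (d x y) = d' (h x) (h y)"
  shows "xs \<in> lists S \<Longrightarrow> xs \<noteq> [] \<Longrightarrow> h (iterated d xs) = iterated d' (map h xs)"
  by (induction xs rule: induct_list012)
    (auto simp: assms(2) iterated_closed[OF assms(1)] in_lists_conv_set)

lemma cuttings_lists:
  assumes "ps \<in> cuttings us vs" "us \<in> lists S" "vs \<in> lists S" "p \<in> set ps"
  shows "fst p \<in> lists S" "snd p \<in> lists S"
  using assms by (auto simp: cuttings_def in_lists_conv_set)

lemma M_op_Nil [simp]: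
  "M_op st d [] vs = (if length vs = 1 then hd vs else 0)"
  "M_op st d us [] = (if length us = 1 then hd us else 0)"
  by (auto simp: M_op.simps)

lemma M_op_Cons:
  assumes "us \<noteq> []" "vs \<noteq> []"
  shows "M_op st d us vs = st (iterated d us) (iterated d vs)
    - (\<Sum>ps | ps \<in> cuttings us vs \<and> 2 \<le> length ps. iterated d (map (\<lambda>p. M_op st d (fst p) (snd p)) ps))"
  using assms by (subst M_op.simps) simp

lemma M_op_closed:
  assumes A [simp]: "is_vspace A" and st: "bilinear_map A A A st" and d: "bilinear_map A A A d"
    and "us \<in> lists (carr A)" "vs \<in> lists (carr A)"
  shows "M_op st d us vs \<in> carr A"
  using assms(4-)
proof (induction "length us + length vs" arbitrary: us vs rule: less_induct)
  case less
  note cl = bl_closed[OF st] bl_closed[OF d]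
  show ?case
  proof (cases "us = [] \<or> vs = []")
    case True
    then show ?thesis using less.prems by (cases us; cases vs) auto
  next
    case False
    let ?it = "\<lambda>ps. iterated d (map (\<lambda>p. M_op st d (fst p) (snd p)) ps)"
    have "?it ps \<in> carr A" if "ps \<in> cuttings us vs" "2 \<le> length ps" for ps
      using less.hyps[OF cuttings_smaller[OF that]] cuttings_lists[OF that(1) less.prems] that
      by (intro iterated_closed cl) (auto simp: in_lists_conv_set)
    then have "(\<Sum>ps | ps \<in> cuttings us vs \<and> 2 \<le> length ps. ?it ps) \<in> carr A"
      by (intro vs_sum) auto
    moreover have "iterated d us \<in> carr A" "iterated d vs \<in> carr A"
      using False less.prems cl by (auto intro!: iterated_closed)
    ultimately show ?thesis using False by (simp add: M_op_Cons cl)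
  qed
qed

text \<open>The operations are universal expressions in the two products, so every homomorphism
  respects them; the recursion is matched on both sides because cuttings are transported by
  \<open>h\<close>.\<close>

lemma M_op_hom:
  assumes A [simp]: "is_vspace A" and B: "is_vspace B" and st: "bilinear_map A A A st" and d: "bilinear_map A A A d"
    and h: "linear_map A B h"
    and hst: "\<And>x y. x \<in> carr A \<Longrightarrow> y \<in> carr A \<Longrightarrow> h (st x y) = st' (h x) (h y)"
    and hd: "\<And>x y. x \<in> carr A \<Longrightarrow> y \<in> carr A \<Longrightarrow> h (d x y) = d' (h x) (h y)"
    and "us \<in> lists (carr A)" "vs \<in> lists (carr A)"
  shows "h (M_op st d us vs) = M_op st' d' (map h us) (map h vs)"
  using assms(8-)
proof (induction "length us + length vs" arbitrary: us vs rule: less_induct)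
  case less
  note cl = bl_closed[OF st] bl_closed[OF d]
  show ?case
  proof (cases "us = [] \<or> vs = []")
    case True
    then show ?thesis using less.prems lm_zero[OF A h] by (cases us; cases vs) auto
  next
    case False
    let ?M = "\<lambda>ps. map (\<lambda>p. M_op st d (fst p) (snd p)) ps"
    let ?M' = "\<lambda>ps. map (\<lambda>p. M_op st' d' (fst p) (snd p)) ps"
    let ?h = "\<lambda>ps. map (\<lambda>p. (map h (fst p), map h (snd p))) ps"
    have M: "?M ps \<in> lists (carr A)" if "ps \<in> cuttings us vs" for ps
      using M_op_closed[OF A st d] cuttings_lists[OF that less.prems]
      by (auto simp: in_lists_conv_set)
    have it: "iterated d (?M ps) \<in> carr A" if "ps \<in> cuttings us vs" "2 \<le> length ps" for ps
      by (rule iterated_closed) (use cl M that in auto)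
    have hM: "h (iterated d (?M ps)) = iterated d' (?M' (?h ps))" if "ps \<in> cuttings us vs" "2 \<le> length ps" for ps
    proof -
      have "h (iterated d (?M ps)) = iterated d' (map h (?M ps))"
        by (rule iterated_hom[of "carr A"]) (use that M cl hd in auto)
      also have "map h (?M ps) = ?M' (?h ps)"
        using less.hyps[OF cuttings_smaller[OF that]] cuttings_lists[OF that(1) less.prems] by auto
      finally show ?thesis .
    qed
    have hi: "h (iterated d us) = iterated d' (map h us)" "h (iterated d vs) = iterated d' (map h vs)"
      by (rule iterated_hom[of "carr A"]; use False less.prems cl hd in auto)+
    \<comment> \<open>The restriction to at least two pieces becomes an indicator, since
      \<open>sum_cuttings_map\<close> speaks about all cuttings; the number of pieces does not
      change under \<open>h\<close>.\<close>
    have "(\<Sum>ps | ps \<in> cuttings (map h us) (map h vs) \<and> 2 \<le> length ps. iterated d' (?M' ps))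
      = (\<Sum>ps\<in>cuttings (map h us) (map h vs). if 2 \<le> length ps then iterated d' (?M' ps) else 0)"
      by (simp add: sum.inter_filter)
    also have "\<dots> = (\<Sum>ps\<in>cuttings us vs. if 2 \<le> length ps then iterated d' (?M' (?h ps)) else 0)"
      by (subst sum_cuttings_map, rule sum.cong[OF refl]) (simp only: length_map)
    also have "\<dots> = (\<Sum>ps | ps \<in> cuttings us vs \<and> 2 \<le> length ps. iterated d' (?M' (?h ps)))"
      by (rule sum.inter_filter[symmetric]) simp
    also have "\<dots> = (\<Sum>ps | ps \<in> cuttings us vs \<and> 2 \<le> length ps. h (iterated d (?M ps)))"
      by (rule sum.cong) (use hM in auto)
    also have "\<dots> = h (\<Sum>ps | ps \<in> cuttings us vs \<and> 2 \<le> length ps. iterated d (?M ps))"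
      by (rule lm_sum[OF A h, symmetric]) (use it in auto)
    finally have sum: "h (\<Sum>ps | ps \<in> cuttings us vs \<and> 2 \<le> length ps. iterated d (?M ps))
      = (\<Sum>ps | ps \<in> cuttings (map h us) (map h vs) \<and> 2 \<le> length ps. iterated d' (?M' ps))" ..
    have "(\<Sum>ps | ps \<in> cuttings us vs \<and> 2 \<le> length ps. iterated d (?M ps)) \<in> carr A"
      by (rule vs_sum) (use it in auto)
    moreover have "iterated d us \<in> carr A" "iterated d vs \<in> carr A"
      using False less.prems cl by (auto intro!: iterated_closed)
    ultimately show ?thesis
      using False by (simp add: M_op_Cons lm_diff[OF A h] cl hst hi sum)
  qed
qed

text \<open>Stated for a space with two operations instead of a record, so that it can be
  instantiated at \<open>H\<close>, at the free 2-associative algebra and at its quotient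
  \<open>U2\<close>.\<close>

locale two_as_algebra =
  fixes B :: "('k::field, 'v::ab_group_add, 'z) vspace_scheme" and st d :: "'v \<Rightarrow> 'v \<Rightarrow> 'v" and e :: 'v
  assumes st: "unital_associative B st e" and d: "unital_associative B d e"
begin

lemma B [simp]: "is_vspace B" and e [simp]: "e \<in> carr B"
  by (rule ua_vspace[OF st], rule ua_unit[OF st])

lemmas st_bl = ua_bl[OF st] and d_bl = ua_bl[OF d]

lemma closed [simp]:
  "x \<in> carr B \<Longrightarrow> y \<in> carr B \<Longrightarrow> st x y \<in> carr B" "x \<in> carr B \<Longrightarrow> y \<in> carr B \<Longrightarrow> d x y \<in> carr B"
  by (rule bl_closed[OF st_bl], assumption+) (rule bl_closed[OF d_bl], assumption+)

lemma units [simp]: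
  "x \<in> carr B \<Longrightarrow> st e x = x" "x \<in> carr B \<Longrightarrow> st x e = x" "x \<in> carr B \<Longrightarrow> d e x = x" "x \<in> carr B \<Longrightarrow> d x e = x"
  using ua_left[OF st] ua_right[OF st] ua_left[OF d] ua_right[OF d] by auto

text \<open>A total version of \<open>iterated\<close>, which is \<open>undefined\<close> on the
  empty list: here the empty word has the unit as its value, as required of a map on the whole
  tensor algebra.\<close>

definition dp :: "'v list \<Rightarrow> 'v" where
  "dp xs = foldr d xs e"

lemma dp_simps [simp]: "dp [] = e" "dp (x # xs) = d x (dp xs)"
  by (simp_all add: dp_def)

lemma dp_closed [simp]: "xs \<in> lists (carr B) \<Longrightarrow> dp xs \<in> carr B"
  by (induction xs) (auto simp: in_lists_conv_set)

lemma dp_append: "xs \<in> lists (carr B) \<Longrightarrow> ys \<in> lists (carr B) \<Longrightarrow> dp (xs @ ys) = d (dp xs) (dp ys)"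
  by (induction xs) (auto simp: ua_assoc[OF d] in_lists_conv_set)

lemma iterated_dp: "xs \<in> lists (carr B) \<Longrightarrow> xs \<noteq> [] \<Longrightarrow> iterated d xs = dp xs"
  by (induction xs rule: induct_list012) (auto simp: in_lists_conv_set)

lemma dp_ml:
  assumes g: "linear_map R B g"
  shows "multilinear R B (\<lambda>rs. dp (map g rs))"
proof -
  have cl: "map g rs \<in> lists (carr B)" if "rs \<in> lists (carr R)" for rs
    using that lm_closed[OF g] by auto
  note c = bl_closed[OF d_bl] dp_closed[OF cl]
  have "linear_map R B (\<lambda>x. d (dp (map g us)) (d (g x) (dp (map g ws))))"
    if us: "us \<in> lists (carr R)" and ws: "ws \<in> lists (carr R)" for us ws
    by (rule lm_comp[OF lm_comp[OF g bl_left[OF d_bl]] bl_right[OF d_bl]]) (use c us ws in auto)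
  then show ?thesis
    using lm_closed[OF g] c
    by (intro multilinearI) (auto simp: dp_append cl lm_add[OF g] lm_scl[OF g] bl_add_left[OF d_bl]
        bl_add_right[OF d_bl] bl_scl_left[OF d_bl] bl_scl_right[OF d_bl] in_lists_conv_set)
qed

abbreviation (input) "M \<equiv> M_op st d"
abbreviation (input) "Mc \<equiv> \<lambda>ps. map (\<lambda>p. M (fst p) (snd p)) ps"

lemma M_closed [simp]: "us \<in> lists (carr B) \<Longrightarrow> vs \<in> lists (carr B) \<Longrightarrow> M us vs \<in> carr B"
  by (rule M_op_closed[OF B st_bl d_bl])

lemma Mc_closed:
  "ps \<in> cuttings us vs \<Longrightarrow> us \<in> lists (carr B) \<Longrightarrow> vs \<in> lists (carr B) \<Longrightarrow> Mc ps \<in> lists (carr B)"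
  using cuttings_lists[of ps us vs "carr B"] M_closed by (auto simp: in_lists_conv_set)

lemma cuttings_eq:
  assumes "us \<noteq> []" "vs \<noteq> []"
  shows "cuttings us vs = insert [(us, vs)] {ps \<in> cuttings us vs. 2 \<le> length ps}"
proof -
  have "ps = [(us, vs)]" if "ps \<in> cuttings us vs" "\<not> 2 \<le> length ps" for ps
    using that assms by (cases ps; cases "tl ps") (auto simp: cuttings_def)
  moreover have "[(us, vs)] \<in> cuttings us vs" using assms by (auto simp: cuttings_def)
  ultimately show ?thesis by blast
qed

lemma sum_cuttings_eq:
  assumes "us \<noteq> []" "vs \<noteq> []"
  shows "sum F (cuttings us vs) = F [(us, vs)] + sum F {ps \<in> cuttings us vs. 2 \<le> length ps}"
  by (subst cuttings_eq[OF assms], subst sum.insert) auto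

lemma sum_dp_first:
  assumes "us \<noteq> [] \<or> vs \<noteq> []" "us \<in> lists (carr B)" "vs \<in> lists (carr B)"
  shows "(\<Sum>ps\<in>cuttings us vs. dp (Mc ps)) = (\<Sum>(i, j)\<in>first_cuts us vs.
     d (M (take i us) (take j vs)) (\<Sum>ps\<in>cuttings (drop i us) (drop j vs). dp (Mc ps)))"
proof -
  have l: "take i us \<in> lists (carr B)" "take j vs \<in> lists (carr B)" "drop i us \<in> lists (carr B)" "drop j vs \<in> lists (carr B)" for i j
    using assms by (auto intro!: take_lists drop_lists simp del: in_lists_conv_set)
  have "(\<Sum>ps\<in>cuttings (drop i us) (drop j vs). d (M (take i us) (take j vs)) (dp (Mc ps)))
     = d (M (take i us) (take j vs)) (\<Sum>ps\<in>cuttings (drop i us) (drop j vs). dp (Mc ps))" for i j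
    by (rule bl_sum_right[OF B d_bl, symmetric]) (use l Mc_closed in auto)
  then show ?thesis by (subst sum_cuttings_first[OF assms(1)]) simp
qed

text \<open>Against an empty word \<open>M_op\<close> vanishes on pieces with more than one letter,
  so only the cutting into single letters contributes, and its contribution is the word
  itself.\<close>

lemma sum_dp_Nil:
  "us \<in> lists (carr B) \<Longrightarrow> (\<Sum>ps\<in>cuttings us []. dp (Mc ps)) = dp us"
  "us \<in> lists (carr B) \<Longrightarrow> (\<Sum>ps\<in>cuttings [] us. dp (Mc ps)) = dp us"
proof (induction us)
  case (Cons u us)
  {
    case 1
    have ul: "u \<in> carr B" "us \<in> lists (carr B)" using 1 by auto
    have cl: "(\<Sum>ps\<in>cuttings (drop i (u # us)) []. dp (Mc ps)) \<in> carr B" for i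
      by (rule vs_sum) (use Mc_closed[OF _ drop_lists[OF 1], of _ i "[]"] in auto)
    have "(\<Sum>ps\<in>cuttings (u # us) []. dp (Mc ps)) = (\<Sum>(i, j)\<in>first_cuts (u # us) [].
     d (M (take i (u # us)) (take j [])) (\<Sum>ps\<in>cuttings (drop i (u # us)) (drop j []). dp (Mc ps)))"
      by (rule sum_dp_first) (use 1 in auto)
    also have "\<dots> = (\<Sum>(i, j)\<in>{(1, 0)}.
     d (M (take i (u # us)) (take j [])) (\<Sum>ps\<in>cuttings (drop i (u # us)) (drop j []). dp (Mc ps)))"
      by (rule sum.mono_neutral_right[OF finite_first_cuts])
        (auto simp: first_cuts_def min_def bl_zero_left[OF B d_bl cl] split: if_splits)
    finally show ?case using Cons.IH(1) ul by simp
  }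
  {
    case 2
    have ul: "u \<in> carr B" "us \<in> lists (carr B)" using 2 by auto
    have cl: "(\<Sum>ps\<in>cuttings [] (drop i (u # us)). dp (Mc ps)) \<in> carr B" for i
      by (rule vs_sum) (use Mc_closed[OF _ _ drop_lists[OF 2], of _ "[]" i] in auto)
    have "(\<Sum>ps\<in>cuttings [] (u # us). dp (Mc ps)) = (\<Sum>(i, j)\<in>first_cuts [] (u # us).
     d (M (take i []) (take j (u # us))) (\<Sum>ps\<in>cuttings (drop i []) (drop j (u # us)). dp (Mc ps)))"
      by (rule sum_dp_first) (use 2 in auto)
    also have "\<dots> = (\<Sum>(i, j)\<in>{(0, 1)}.
     d (M (take i []) (take j (u # us))) (\<Sum>ps\<in>cuttings (drop i []) (drop j (u # us)). dp (Mc ps)))"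
      by (rule sum.mono_neutral_right[OF finite_first_cuts])
        (auto simp: first_cuts_def min_def bl_zero_left[OF B d_bl cl] split: if_splits)
    finally show ?case using Cons.IH(2) ul by simp
  }
qed auto

text \<open>This is the recursive definition of \<open>M_op\<close> solved for the product: the
  one-piece cutting supplies \<open>M us vs\<close>, the subtracted sum supplies all the others.
  Words with no letter are covered by \<open>sum_dp_Nil\<close>.\<close>

lemma st_dp:
  assumes us: "us \<in> lists (carr B)" and vs: "vs \<in> lists (carr B)"
  shows "st (dp us) (dp vs) = (\<Sum>ps\<in>cuttings us vs. dp (Mc ps))"
proof (cases "us = [] \<or> vs = []")
  case True
  then show ?thesis
    using sum_dp_Nil(1)[OF us] sum_dp_Nil(2)[OF vs] dp_closed[OF us] dp_closed[OF vs] by auto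
next
  case False
  then have ne: "us \<noteq> []" "vs \<noteq> []" by auto
  have "(\<Sum>ps | ps \<in> cuttings us vs \<and> 2 \<le> length ps. iterated d (Mc ps))
    = (\<Sum>ps | ps \<in> cuttings us vs \<and> 2 \<le> length ps. dp (Mc ps))"
    by (rule sum.cong[OF refl iterated_dp[OF Mc_closed[OF _ us vs]]]) auto
  then have "M us vs = st (dp us) (dp vs) - (\<Sum>ps | ps \<in> cuttings us vs \<and> 2 \<le> length ps. dp (Mc ps))"
    by (simp only: M_op_Cons[OF ne] iterated_dp[OF us ne(1)] iterated_dp[OF vs ne(2)])
  moreover have "(\<Sum>ps\<in>cuttings us vs. dp (Mc ps))
    = M us vs + (\<Sum>ps | ps \<in> cuttings us vs \<and> 2 \<le> length ps. dp (Mc ps))"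
    using M_closed[OF us vs] by (simp add: sum_cuttings_eq[OF ne])
  ultimately show ?thesis by (simp only: diff_add_cancel)
qed

end

section \<open>Compatible coproducts\<close>

text \<open>Collects what the primitivity of the operations \<open>M\<close> rests on, in a form
  that is available both for \<open>H\<close> and for the free algebra.\<close>

locale two_as_comult = two_as_algebra B st d e
  for B :: "('k::field, 'v::ab_group_add, 'z) vspace_scheme" and st d :: "'v \<Rightarrow> 'v \<Rightarrow> 'v" and e :: 'v +
  fixes D :: "'v \<Rightarrow> ('v \<times> 'v \<Rightarrow>\<^sub>0 'k)"
  assumes D: "linear_map B (tensor B B) D"
    and D_one: "D e = tens B B e e"
    and D_st: "\<And>x y. x \<in> carr B \<Longrightarrow> y \<in> carr B \<Longrightarrow> D (st x y) = tensor_mult B st (D x) (D y)"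
    and D_d: "\<And>x y. x \<in> carr B \<Longrightarrow> y \<in> carr B \<Longrightarrow> D (d x y) =
      tensor_mult B d (tens B B x e) (D y) + tensor_mult B d (D x) (tens B B e y) - tens B B x y"
begin

abbreviation (input) "T \<equiv> tensor B B"
abbreviation (input) "t \<equiv> tens B B"

lemmas t_bl = tens_bl[OF B B]
lemmas tm_st = tensor_mult_tens[OF B st_bl] and tm_d = tensor_mult_tens[OF B d_bl]
lemmas tmb_st = tensor_mult_bl[OF B st_bl] and tmb_d = tensor_mult_bl[OF B d_bl]

lemma D_closed [simp]: "x \<in> carr B \<Longrightarrow> D x \<in> carr T"
  by (rule lm_closed[OF D])

definition prim :: "'v \<Rightarrow> bool" where
  "prim x \<longleftrightarrow> x \<in> carr B \<and> D x = t x e + t e x"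

lemma prim_closed: "prim x \<Longrightarrow> x \<in> carr B"
  by (simp add: prim_def)

lemma prims_closed: "ps \<in> lists (Collect prim) \<Longrightarrow> ps \<in> lists (carr B)"
  by (auto simp: in_lists_conv_set prim_closed)

lemma subspace_prim: "module.subspace (scl B) (Collect prim)"
proof -
  have "module (scl B)" by (simp add: is_vspaceD(2))
  then show ?thesis
    by (auto simp: module.subspace_def prim_def lm_zero[OF B D] lm_add[OF D] lm_scl[OF D]
        bl_zero_left[OF B t_bl] bl_zero_right[OF B t_bl] bl_add_left[OF t_bl] bl_add_right[OF t_bl]
        bl_scl_left[OF t_bl] bl_scl_right[OF t_bl] scl_distribs[OF is_vspace_tensor[OF B B], simplified])
qed

lemma D_prim_d:
  assumes p: "prim p" and y [simp]: "y \<in> carr B"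
  shows "D (d p y) = tensor_mult B d (t p e) (D y) + t e (d p y)"
proof -
  have [simp]: "p \<in> carr B" and Dp: "D p = t p e + t e p" using p by (auto simp: prim_def)
  have "tensor_mult B d (D p) (t e y) = t p y + t e (d p y)"
    unfolding Dp by (subst bl_add_left[OF tmb_d]) (auto simp: tm_d)
  then show ?thesis by (simp add: D_d)
qed

lemma D_dp:
  "ps \<in> lists (Collect prim) \<Longrightarrow> D (dp ps) = (\<Sum>i\<le>length ps. t (dp (take i ps)) (dp (drop i ps)))"
proof (induction ps)
  case (Cons p ps)
  then have p: "prim p" and ps: "ps \<in> lists (Collect prim)" by auto
  note cl [simp] = prim_closed[OF p] dp_closed[OF prims_closed[OF ps]]
    dp_closed[OF take_lists[OF prims_closed[OF ps]]] dp_closed[OF drop_lists[OF prims_closed[OF ps]]]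
  have "D (dp (p # ps)) = tensor_mult B d (t p e) (\<Sum>i\<le>length ps. t (dp (take i ps)) (dp (drop i ps)))
      + t e (d p (dp ps))"
    using Cons.IH[OF ps] by (simp add: D_prim_d[OF p])
  also have "tensor_mult B d (t p e) (\<Sum>i\<le>length ps. t (dp (take i ps)) (dp (drop i ps)))
    = (\<Sum>i\<le>length ps. t (d p (dp (take i ps))) (dp (drop i ps)))"
    by (subst bl_sum_right[OF _ tmb_d]) (auto simp: tm_d)
  \<comment> \<open>The summand \<open>t e (d p (dp ps))\<close> is the cut in front of
    \<open>p\<close>. It is split off as the index \<open>0\<close>, and every cut of
    \<open>ps\<close> moves one place to the right.\<close>
  finally show ?case
    by (simp only: list.size add_Suc_right add_0_right sum.atMost_Suc_shift) (simp add: add.commute)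
qed (simp add: D_one)

lemma tens_sum:
  assumes "\<And>i. i \<in> I \<Longrightarrow> f i \<in> carr B" "\<And>j. j \<in> J \<Longrightarrow> g j \<in> carr B"
  shows "t (sum f I) (sum g J) = (\<Sum>i\<in>I. \<Sum>j\<in>J. t (f i) (g j))"
  using assms by (subst bl_sum_left[OF B t_bl]) (auto intro!: vs_sum sum.cong bl_sum_right[OF B t_bl])

text \<open>The product of two words is a sum over cuttings, and cutting and then deconcatenating is the
  same as deconcatenating both words and then cutting; so the coproduct of the single piece that is
  not known to be primitive by induction has no room left for other terms.\<close>

lemma M_prim:
  "us \<in> lists (Collect prim) \<Longrightarrow> vs \<in> lists (Collect prim) \<Longrightarrow> prim (M us vs)"
proof (induction "length us + length vs" arbitrary: us vs rule: less_induct)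
  case less
  have us: "us \<in> lists (carr B)" and vs: "vs \<in> lists (carr B)"
    using less.prems by (simp_all only: prims_closed)
  have "prim 0" using subspace_prim by (simp add: module.subspace_def is_vspaceD(2))
  show ?case
  proof (cases "us = [] \<or> vs = []")
    case True
    then show ?thesis using less.prems \<open>prim 0\<close> by (cases us; cases vs) auto
  next
    case False
    then have ne: "us \<noteq> []" "vs \<noteq> []" by auto
    let ?C = "{ps \<in> cuttings us vs. 2 \<le> length ps}"
    let ?F = "\<lambda>ps. \<Sum>l\<le>length ps. t (dp (Mc (take l ps))) (dp (Mc (drop l ps)))"
    have Mus [simp]: "M us vs \<in> carr B" by (rule M_closed[OF us vs])
    have Mc_cl: "Mc ps \<in> lists (carr B)" if "ps \<in> cuttings us vs" for ps
      by (rule Mc_closed[OF that us vs])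
    \<comment> \<open>In a cutting with at least two pieces every piece is shorter than the whole,
      so the induction hypothesis applies to each of them.\<close>
    have Mc_prim: "Mc ps \<in> lists (Collect prim)" if "ps \<in> ?C" for ps
      using that less.hyps[OF cuttings_smaller[of ps us vs]]
        cuttings_lists[OF _ less.prems, of ps] by (auto simp: in_lists_conv_set)
    have "D (st (dp us) (dp vs)) = tensor_mult B st (\<Sum>i\<le>length us. t (dp (take i us)) (dp (drop i us)))
         (\<Sum>j\<le>length vs. t (dp (take j vs)) (dp (drop j vs)))"
      using D_dp[OF less.prems(1)] D_dp[OF less.prems(2)] us vs by (simp add: D_st)
    also have "\<dots> = (\<Sum>i\<le>length us. \<Sum>j\<le>length vs. 
        t (st (dp (take i us)) (dp (take j vs))) (st (dp (drop i us)) (dp (drop j vs))))"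
      using dp_closed[OF take_lists[OF us]] dp_closed[OF drop_lists[OF us]]
        dp_closed[OF take_lists[OF vs]] dp_closed[OF drop_lists[OF vs]]
      by (subst bl_sum_left[OF _ tmb_st])
        (auto intro!: vs_sum sum.cong tens_closed simp: bl_sum_right[OF _ tmb_st] tm_st)
    \<comment> \<open>Both tensor factors are again products \<open>*\<close> of two words, so each
      expands over its own cuttings.\<close>
    also have "\<dots> = (\<Sum>i\<le>length us. \<Sum>j\<le>length vs. \<Sum>ps\<in>cuttings (take i us) (take j vs).
        \<Sum>qs\<in>cuttings (drop i us) (drop j vs). t (dp (Mc ps)) (dp (Mc qs)))"
      by (intro sum.cong refl)
        (simp add: st_dp take_lists[OF us] take_lists[OF vs] drop_lists[OF us] drop_lists[OF vs],
          intro tens_sum dp_closed Mc_closed[OF _ take_lists[OF us] take_lists[OF vs]]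
            Mc_closed[OF _ drop_lists[OF us] drop_lists[OF vs]])
    also have "\<dots> = sum ?F (cuttings us vs)"
      by (rule sum_cuttings_split)
    \<comment> \<open>The one-piece cutting contributes its two ends \<open>l = 0\<close> and
      \<open>l = 1\<close>. All other cuttings give \<open>sum ?F ?C\<close>, which returns below as
      the coproduct of the remaining words and cancels.\<close>
    also have "\<dots> = t e (M us vs) + t (M us vs) e + sum ?F ?C"
      by (simp add: sum_cuttings_eq[OF ne])
    finally have 1: "D (st (dp us) (dp vs)) = t e (M us vs) + t (M us vs) e + sum ?F ?C" .
    have S: "(\<Sum>ps\<in>?C. dp (Mc ps)) \<in> carr B"
      by (rule vs_sum) (simp_all add: dp_closed[OF Mc_cl])
    have "D (st (dp us) (dp vs)) = D (M us vs + (\<Sum>ps\<in>?C. dp (Mc ps)))"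
      using us vs by (simp add: st_dp sum_cuttings_eq[OF ne])
    also have "\<dots> = D (M us vs) + (\<Sum>ps\<in>?C. D (dp (Mc ps)))"
      using S by (subst lm_add[OF D], simp, simp, subst lm_sum[OF B D]) (simp_all add: dp_closed[OF Mc_cl])
    also have "(\<Sum>ps\<in>?C. D (dp (Mc ps))) = sum ?F ?C"
      by (rule sum.cong[OF refl]) (use Mc_prim in \<open>simp add: D_dp take_map drop_map\<close>)
    finally show ?thesis using 1 by (simp add: prim_def add.commute)
  qed
qed

end

lemma coalgebra_iso_inv:
  assumes C [simp]: "is_vspace C" and D [simp]: "is_vspace D"
    and cC: "linear_map C (tensor C C) (comul C)" and iso: "coalgebra_iso C D f"
  shows "coalgebra_iso D C (inv_into (carr C) f)"
proof -
  let ?g = "inv_into (carr C) f"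
  have f: "linear_map C D f" and bij: "bij_betw f (carr C) (carr D)"
    and cm: "\<And>x. x \<in> carr C \<Longrightarrow> comul D (f x) = tensor_map D D f f (comul C x)"
    and cu: "\<And>x. x \<in> carr C \<Longrightarrow> counit D (f x) = counit C x"
    using iso by (auto simp: coalgebra_iso_def)
  have g: "linear_map D C ?g" by (rule lm_inv_into[OF C f bij])
  have fg: "f (?g y) = y" if "y \<in> carr D" for y
    using bij that by (auto simp: bij_betw_def f_inv_into_f)
  have gf: "?g (f x) = x" if "x \<in> carr C" for x
    using bij that by (simp add: bij_betw_inv_into_left)
  show ?thesis
    unfolding coalgebra_iso_def
  proof (intro conjI ballI)
    show "bij_betw ?g (carr D) (carr C)" by (rule bij_betw_inv_into[OF bij])
    fix y assume y: "y \<in> carr D"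
    have X: "comul C (?g y) \<in> carr (tensor C C)" by (rule lm_closed[OF cC lm_closed[OF g y]])
    have "tensor_map C C ?g ?g (comul D y) = tensor_map C C ?g ?g (tensor_map D D f f (comul C (?g y)))"
      using cm[OF lm_closed[OF g y]] fg[OF y] by simp
    also have "\<dots> = tensor_map C C (\<lambda>x. ?g (f x)) (\<lambda>x. ?g (f x)) (comul C (?g y))"
      by (rule tensor_map_comp[OF C C D D C C f f g g X])
    also have "\<dots> = tensor_map C C (\<lambda>x. x) (\<lambda>x. x) (comul C (?g y))"
      by (rule tensor_map_cong[OF C C C C X]) (auto simp: gf)
    also have "\<dots> = comul C (?g y)" by (rule tensor_map_id[OF C C X])
    finally show "comul C (?g y) = tensor_map C C ?g ?g (comul D y)" ..
    show "counit C (?g y) = counit D y" using cu[OF lm_closed[OF g y]] fg[OF y] by simp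
  qed (rule g)
qed


section \<open>Connected 2-associative bialgebras are cofree\<close>

locale two_as_bialgebra =
  fixes H :: "('k::field, 'v::ab_group_add, 'z) bialg2_scheme"
  assumes H2: "two_assoc_bialgebra H"
begin

abbreviation (input) "\<I> \<equiv> one H"
abbreviation (input) "\<epsilon> \<equiv> counit H"

lemma cc: "counital_coassociative H"
  using H2 by (auto simp: two_assoc_bialgebra_def bialgebra_def)

sublocale two_as_comult H "star H" "dot H" "one H" "comul H"
  using H2 cc_comul[OF cc]
  by unfold_locales (auto simp: two_assoc_bialgebra_def bialgebra_def unital_infinitesimal_bialgebra_def)

lemmas eps = cc_counit[OF cc]

lemma eps_one: "\<epsilon> \<I> = 1" and eps_star: "x \<in> carr H \<Longrightarrow> y \<in> carr H \<Longrightarrow> \<epsilon> (star H x y) = \<epsilon> x * \<epsilon> y"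
  using H2 by (auto simp: two_assoc_bialgebra_def bialgebra_def)

lemma carr_Prim: "carr (Prim H) = Collect prim"
  by (auto simp: Prim_def prim_def reduced_comul_def algebra_simps)

lemma scl_Prim [simp]: "scl (Prim H) = scl H"
  by (simp add: Prim_def)

lemma is_vspace_Prim [simp]: "is_vspace (Prim H)"
  using subspace_prim B unfolding is_vspace_def scl_Prim carr_Prim by blast

lemma Prim_incl: "linear_map (Prim H) H (\<lambda>x. x)"
  by (intro linear_mapI) (auto simp: carr_Prim prim_closed)

lemma left_bl: "bilinear_map H H H (\<lambda>a b. scl H (\<epsilon> a) b)"
  and right_bl: "bilinear_map H H H (\<lambda>a b. scl H (\<epsilon> b) a)"
  by (rule bilinear_mapI; simp add: scl_distribs lm_add[OF eps] lm_scl[OF eps] mult.commute)+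

lemma eps_eps_bl: "bilinear_map H H ground_field (\<lambda>a b. \<epsilon> a * \<epsilon> b)"
  by (rule bilinear_mapI) (simp_all add: lm_add[OF eps] lm_scl[OF eps] algebra_simps)

text \<open>Multiplicativity of the counit for \<cdot> is not among the axioms. Applying \<epsilon>
  \<otimes> \<epsilon> to the compatibility of \<cdot> with the coproduct and using the counit laws
  gives \<epsilon>(x\<cdot>y) = 2\<epsilon>(x\<cdot>y) - \<epsilon>(x)\<epsilon>(y), and one copy of
  \<epsilon>(x\<cdot>y) cancels in every characteristic.\<close>

lemma eps_dot:
  assumes x [simp]: "x \<in> carr H" and y [simp]: "y \<in> carr H"
  shows "\<epsilon> (dot H x y) = \<epsilon> x * \<epsilon> y"
proof -
  let ?E = "lin_ext (*) (\<lambda>(a, b). \<epsilon> a * \<epsilon> b)"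
  note El = lift_lm[OF B B is_vspace_ground_field scl_ground_field eps_eps_bl]
  note Et = lift_tens[OF B B is_vspace_ground_field scl_ground_field eps_eps_bl]
  note Ll = lift_lm[OF B B B refl left_bl] and Lt = lift_tens[OF B B B refl left_bl]
  note Rl = lift_lm[OF B B B refl right_bl] and Rt = lift_tens[OF B B B refl right_bl]
  have ED: "?E (comul H z) = \<epsilon> z" if z: "z \<in> carr H" for z
  proof -
    have "?E (comul H z) = \<epsilon> (lin_ext (scl H) (\<lambda>(a, b). scl H (\<epsilon> a) b) (comul H z))"
      by (rule tensor_eqI[OF B B _ El lm_comp[OF Ll eps]]) (use z in \<open>auto simp: Et Lt lm_scl[OF eps]\<close>)
    then show ?thesis by (simp add: cc_counit_left[OF cc z])
  qed
  have 1: "?E (tensor_mult H (dot H) (t x \<I>) (comul H y)) = \<epsilon> (dot H x y)"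
  proof -
    have "?E (tensor_mult H (dot H) (t x \<I>) (comul H y))
      = \<epsilon> (dot H x (lin_ext (scl H) (\<lambda>(a, b). scl H (\<epsilon> b) a) (comul H y)))"
      by (rule tensor_eqI[OF B B _ lm_comp[OF bl_right[OF tmb_d] El]
            lm_comp[OF Rl lm_comp[OF bl_right[OF d_bl] eps]]])
        (auto simp: tm_d Et Rt bl_scl_right[OF d_bl] lm_scl[OF eps])
    then show ?thesis by (simp add: cc_counit_right[OF cc y])
  qed
  have 2: "?E (tensor_mult H (dot H) (comul H x) (t \<I> y)) = \<epsilon> (dot H x y)"
  proof -
    have "?E (tensor_mult H (dot H) (comul H x) (t \<I> y))
      = \<epsilon> (dot H (lin_ext (scl H) (\<lambda>(a, b). scl H (\<epsilon> a) b) (comul H x)) y)"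
      by (rule tensor_eqI[OF B B _ lm_comp[OF bl_left[OF tmb_d] El]
            lm_comp[OF Ll lm_comp[OF bl_left[OF d_bl] eps]]])
        (auto simp: tm_d Et Lt bl_scl_left[OF d_bl] lm_scl[OF eps])
    then show ?thesis by (simp add: cc_counit_left[OF cc x])
  qed
  have c: "tensor_mult H (dot H) (t x \<I>) (comul H y) \<in> carr T" "tensor_mult H (dot H) (comul H x) (t \<I> y) \<in> carr T"
    by (auto intro!: bl_closed[OF tmb_d])
  have "\<epsilon> (dot H x y) = ?E (comul H (dot H x y))" by (simp add: ED)
  also have "\<dots> = \<epsilon> (dot H x y) + \<epsilon> (dot H x y) - \<epsilon> x * \<epsilon> y"
    using c by (simp add: D_d lm_diff[OF _ El] lm_add[OF El] 1 2 Et)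
  finally show ?thesis by simp
qed

text \<open>The left counit law turns \<Delta>(p) = p\<otimes>1 + 1\<otimes>p into p =
  \<epsilon>(p)1 + p; a further application of \<epsilon> isolates the coefficient.\<close>

lemma eps_prim: "prim p \<Longrightarrow> \<epsilon> p = 0"
proof -
  assume p: "prim p"
  then have [simp]: "p \<in> carr H" by (rule prim_closed)
  note Ll = lift_lm[OF B B B refl left_bl] and Lt = lift_tens[OF B B B refl left_bl]
  have "p = lin_ext (scl H) (\<lambda>(a, b). scl H (\<epsilon> a) b) (t p \<I> + t \<I> p)"
    using cc_counit_left[OF cc, of p] p by (simp add: prim_def)
  also have "\<dots> = scl H (\<epsilon> p) \<I> + p"
    by (subst lm_add[OF Ll]) (auto simp: Lt eps_one)
  finally have "\<epsilon> (scl H (\<epsilon> p) \<I>) = 0" using lm_zero[OF B eps] by simp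
  then show ?thesis by (simp add: lm_scl[OF eps] eps_one)
qed

section \<open>The coradical-type filtration and words in primitive elements\<close>

abbreviation (input) "F \<equiv> filtration H"
abbreviation (input) "FF r \<equiv> module.span pscale {tens H H a b | a b. a \<in> F r \<and> b \<in> F r}"

lemma rc_lm: "linear_map H T (reduced_comul H)"
proof -
  have "linear_map H T (\<lambda>x. comul H x - t x \<I> - t \<I> x)"
    by (intro lm_minus D bl_left[OF t_bl] bl_right[OF t_bl]) auto
  moreover have "reduced_comul H = (\<lambda>x. comul H x - t x \<I> - t \<I> x)"
    by (auto simp: reduced_comul_def)
  ultimately show ?thesis by simp
qed

lemma F_subspace: "F r \<subseteq> carr H \<and> module.subspace (scl H) (F r)"
proof -
  have m: "module (scl H)" by (simp add: is_vspaceD(2))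
  show ?thesis
  proof (cases r)
    case 0
    have "x + y \<in> F 0" if xy: "x \<in> F 0" "y \<in> F 0" for x y
    proof -
      from xy obtain a b where "x = scl H a \<I>" "y = scl H b \<I>" by auto
      then have "x + y = scl H (a + b) \<I>" by (simp add: scl_distribs)
      then show ?thesis by auto
    qed
    moreover have "scl H c x \<in> F 0" if "x \<in> F 0" for c x
      using that by auto
    moreover have "0 \<in> F 0" using scl_simps(1)[OF B, of \<I>] by (auto intro: exI[of _ 0])
    ultimately show ?thesis using 0 by (auto simp: module.subspace_def[OF m])
  next
    case (Suc n)
    note s = module.subspace_span[OF module_pscale, of "{tens H H a b | a b. a \<in> F n \<and> b \<in> F n}",
        unfolded subspace_pscale_iff]
    show ?thesis
      unfolding Suc using s
      by (auto simp: module.subspace_def[OF m] lm_zero[OF B rc_lm] lm_add[OF rc_lm] lm_scl[OF rc_lm])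
  qed
qed

lemma F_closed: "x \<in> F r \<Longrightarrow> x \<in> carr H"
  using F_subspace by blast

lemma F_scl: "x \<in> F r \<Longrightarrow> scl H c x \<in> F r" and F_add: "x \<in> F r \<Longrightarrow> y \<in> F r \<Longrightarrow> x + y \<in> F r"
  using F_subspace[of r] by (auto simp: module.subspace_def is_vspaceD(2))

lemma FF_induct [consumes 1, case_names zero tens add]:
  assumes "X \<in> FF r" and zero: "P 0" and tens: "\<And>a b. a \<in> F r \<Longrightarrow> b \<in> F r \<Longrightarrow> P (t a b)"
    and add: "\<And>X Y. X \<in> carr T \<Longrightarrow> Y \<in> carr T \<Longrightarrow> P X \<Longrightarrow> P Y \<Longrightarrow> P (X + Y)"
  shows "P X"
proof -
  have "P X \<and> X \<in> carr T"
  proof (rule module.span_induct_alt[OF module_pscale assms(1)])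
    show "P 0 \<and> 0 \<in> carr T" using zero by simp
    fix c x y assume "x \<in> {tens H H a b | a b. a \<in> F r \<and> b \<in> F r}" and y: "P y \<and> y \<in> carr T"
    then obtain a b where ab: "x = t a b" "a \<in> F r" "b \<in> F r" by auto
    then have "pscale c x = t (scl H c a) b"
      using bl_scl_left[OF t_bl, of a b c] F_closed by simp
    then show "P (pscale c x + y) \<and> pscale c x + y \<in> carr T"
      using ab y add[of "pscale c x" y] tens[OF F_scl[of a r c], of b] F_closed[of a r] F_closed[of b r] by simp
  qed
  then show ?thesis ..
qed

lemma FF_eqI:
  assumes "X \<in> FF r" and f: "linear_map T U f" and g: "linear_map T U g"
    and "\<And>a b. a \<in> F r \<Longrightarrow> b \<in> F r \<Longrightarrow> f (t a b) = g (t a b)"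
  shows "f X = g X"
  using assms(1) by (induction rule: FF_induct)
    (use lm_zero[OF _ f] lm_zero[OF _ g] assms(4) in \<open>auto simp: lm_add[OF f] lm_add[OF g]\<close>)

lemma rc_one: "reduced_comul H \<I> = - t \<I> \<I>"
  by (simp add: reduced_comul_def D_one)

text \<open>The reduced coproduct of the unit is \<open>- 1 \<otimes> 1\<close> and not
  \<open>0\<close>; it lies in the span of \<open>F 0 \<otimes> F 0\<close>, which starts the
  induction.\<close>

lemma F_Suc: "F r \<subseteq> F (Suc r)"
proof (induction r)
  case 0
  have I: "\<I> \<in> F 0" using scl_simps(3)[OF B, of \<I>] by (auto intro: exI[of _ 1])
  have "scl H c \<I> \<in> F (Suc 0)" for c
  proof -
    have "reduced_comul H (scl H c \<I>) = - t (scl H c \<I>) \<I>"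
      by (simp add: lm_scl[OF rc_lm] rc_one bl_scl_left[OF t_bl] scl_distribs(5)[OF is_vspace_tensor[OF B B], simplified])
    moreover have "t (scl H c \<I>) \<I> \<in> FF 0"
      by (rule module.span_base[OF module_pscale]) (use I in auto)
    ultimately show ?thesis by (simp add: module.span_neg[OF module_pscale] del: filtration.simps(1))
  qed
  then show ?case by auto
next
  case (Suc r)
  have "FF r \<subseteq> FF (Suc r)"
    by (rule module.span_mono[OF module_pscale]) (use Suc in blast)
  then show ?case by auto
qed

lemma F_mono: "r \<le> s \<Longrightarrow> F r \<subseteq> F s"
  by (rule lift_Suc_mono_le[of F]) (rule F_Suc)

text \<open>The reduced coproduct removes exactly the two trivial cuts of a word. Every remaining
  cut leaves two words that are strictly shorter, so both factors lie one step lower.\<close>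

lemma dp_in_F: "ps \<in> lists (Collect prim) \<Longrightarrow> length ps \<le> n \<Longrightarrow> dp ps \<in> F n"
proof (induction n arbitrary: ps)
  case 0
  then show ?case using scl_simps(3)[OF B, of \<I>] by (auto intro: exI[of _ 1])
next
  case (Suc n)
  note psc = prims_closed[OF Suc.prems(1)]
  show ?case
  proof (cases ps)
    case Nil
    then show ?thesis using F_mono[of n "Suc n"] Suc.IH[of "[]"] by auto
  next
    case (Cons p qs)
    let ?f = "\<lambda>i. t (dp (take i ps)) (dp (drop i ps))"
    have "comul H (dp ps) = ?f 0 + (\<Sum>i=1..length qs. ?f i) + ?f (length ps)"
      unfolding D_dp[OF Suc.prems(1)]
      by (simp add: Cons sum.atLeast0_atMost_Suc atMost_atLeast0 sum.atLeast_Suc_atMost del: dp_simps)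
    then have "reduced_comul H (dp ps) = (\<Sum>i=1..length qs. ?f i)"
      by (simp add: reduced_comul_def)
    moreover have "(\<Sum>i=1..length qs. ?f i) \<in> FF n"
    proof (rule module.span_sum[OF module_pscale])
      fix i assume "i \<in> {1..length qs}"
      then have "dp (take i ps) \<in> F n" "dp (drop i ps) \<in> F n"
        using Suc.prems Cons by (auto intro!: Suc.IH take_lists drop_lists simp del: in_lists_conv_set)
      then show "?f i \<in> FF n" by (intro module.span_base[OF module_pscale]) auto
    qed
    ultimately show ?thesis using dp_closed[OF psc] by simp
  qed
qed

text \<open>A word lies in the step indexed by its length. The steps are nested subspaces, so a
  linear combination lies in the step of its longest word.\<close>

lemma connected_if_generated:
  assumes "carr H \<subseteq> module.span (scl H) (dp ` lists (Collect prim))"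
  shows "connected_coalgebra H"
  unfolding connected_coalgebra_def
proof (intro equalityI subsetI)
  have m: "module (scl H)" by (simp add: is_vspaceD(2))
  fix x assume "x \<in> carr H"
  then have "x \<in> module.span (scl H) (dp ` lists (Collect prim))" using assms by blast
  then show "x \<in> (\<Union>r. F r)"
  proof (rule module.span_induct_alt[OF m])
    have "0 \<in> F 0" using F_subspace[of 0] module.subspace_0[OF m] by blast
    then show "0 \<in> (\<Union>r. F r)" by blast
    fix c x y assume "x \<in> dp ` lists (Collect prim)" "y \<in> (\<Union>r. F r)"
    then obtain ps r where ps: "x = dp ps" "ps \<in> lists (Collect prim)" "y \<in> F r" by blast
    have "x \<in> F (max r (length ps))" "y \<in> F (max r (length ps))"
      using dp_in_F[OF ps(2)] F_mono[of r "max r (length ps)"] ps by auto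
    then have "scl H c x + y \<in> F (max r (length ps))" by (intro F_add F_scl)
    then show "scl H c x + y \<in> (\<Union>r. F r)" by blast
  qed
qed (auto dest: F_closed)

end

locale connected_two_as = two_as_bialgebra H
  for H :: "('k::field, 'v::ab_group_add, 'z) bialg2_scheme" +
  assumes conn: "connected_coalgebra H"
begin

lemma in_F: "x \<in> carr H \<Longrightarrow> \<exists>r. x \<in> F r"
  using conn by (auto simp: connected_coalgebra_def)

lemma conv_bl: "linear_map H H f \<Longrightarrow> bilinear_map H H H (\<lambda>a b. dot H (f a) b)"
  by (rule bl_comp[OF d_bl _ lm_id])

text \<open>Applied to a coproduct this is the convolution of \<open>f\<close> with the identity for
  the product \<cdot>. It is kept as a map on tensors so that it can also be applied to the reduced
  coproduct.\<close>

abbreviation (input) conv :: "('v \<Rightarrow> 'v) \<Rightarrow> ('v \<times> 'v \<Rightarrow>\<^sub>0 'k) \<Rightarrow> 'v" where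
  "conv f \<equiv> lin_ext (scl H) (\<lambda>(a, b). dot H (f a) b)"

lemma conv_lm: "linear_map H H f \<Longrightarrow> linear_map T H (conv f)"
  by (rule lift_lm[OF B B B refl conv_bl])

lemma conv_tens: "linear_map H H f \<Longrightarrow> a \<in> carr H \<Longrightarrow> b \<in> carr H \<Longrightarrow> conv f (t a b) = dot H (f a) b"
  by (rule lift_tens[OF B B B refl conv_bl])

lemma rc_eq: "x \<in> carr H \<Longrightarrow> linear_map T U g \<Longrightarrow>
    g (reduced_comul H x) = g (comul H x) - g (t x \<I>) - g (t \<I> x)"
  unfolding reduced_comul_def by (simp add: lm_diff[of T U g])

text \<open>The convolution quotient \<open>(id - \<epsilon>) * id\<^sup>-\<^sup>1\<close> for the product \<open>\<cdot>\<close>, obtained as the limit of an iteration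
  which is stationary from the \<open>r\<close>-th step on the \<open>r\<close>-th step of the filtration.  It is the
  projection onto the primitive elements along the products of elements of the augmentation ideal.\<close>

primrec eN :: "nat \<Rightarrow> 'v \<Rightarrow> 'v" where
  "eN 0 = (\<lambda>x. 0)"
| "eN (Suc n) = (\<lambda>x. x - scl H (\<epsilon> x) \<I> - conv (eN n) (reduced_comul H x))"

lemma eN_lm: "linear_map H H (eN n)"
  by (induction n)
    (auto intro!: lm_const_zero lm_minus lm_scl_const eps lm_comp[OF rc_lm conv_lm])

lemma eN_one: "eN n \<I> = 0"
proof (induction n)
  case (Suc n)
  then show ?case
    using conv_tens[OF eN_lm, of \<I> \<I> n] lm_neg[OF _ conv_lm[OF eN_lm], of "t \<I> \<I>" n]
    by (simp add: rc_one eps_one bl_zero_left[OF B d_bl])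
qed simp

text \<open>On step \<open>Suc r\<close> the recursion only looks at left factors in step
  \<open>r\<close>, where the iteration is already stationary by induction. At step \<open>0\<close>
  all values vanish because they vanish on the unit.\<close>

lemma eN_stable: "x \<in> F r \<Longrightarrow> r \<le> n \<Longrightarrow> eN n x = eN r x"
proof (induction r arbitrary: x n)
  case 0
  then show ?case by (auto simp: lm_scl[OF eN_lm] eN_one)
next
  case (Suc r)
  then obtain m where n: "n = Suc m" "r \<le> m" by (cases n) auto
  have "reduced_comul H x \<in> FF r" using Suc.prems by simp
  then have "conv (eN m) (reduced_comul H x) = conv (eN r) (reduced_comul H x)"
  proof (rule FF_eqI[OF _ conv_lm[OF eN_lm] conv_lm[OF eN_lm]])
    fix a b assume "a \<in> F r" "b \<in> F r"
    then show "conv (eN m) (t a b) = conv (eN r) (t a b)"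
      using Suc.IH[of a m] n(2) F_closed[of a r] F_closed[of b r] by (simp add: conv_tens[OF eN_lm])
  qed
  then show ?case by (simp add: n)
qed

text \<open>The stationary value of the iteration. The least index is only a choice: by
  \<open>proj_eq\<close> any \<open>n\<close> with \<open>x \<in> F n\<close> gives the same
  value.\<close>

definition proj :: "'v \<Rightarrow> 'v" where
  "proj x = eN (LEAST r. x \<in> F r) x"

lemma proj_eq: "x \<in> F n \<Longrightarrow> proj x = eN n x"
  unfolding proj_def using eN_stable[OF LeastI[of "\<lambda>r. x \<in> F r" n] Least_le[of "\<lambda>r. x \<in> F r" n]] by simp

lemma proj_lm: "linear_map H H proj"
proof (rule linear_mapI)
  fix x y assume x: "x \<in> carr H" and y: "y \<in> carr H"
  obtain r where r: "x \<in> F r" using in_F[OF x] by blast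
  obtain s where s: "y \<in> F s" using in_F[OF y] by blast
  have xy: "x \<in> F (max r s)" "y \<in> F (max r s)"
    using r s F_mono[of r "max r s"] F_mono[of s "max r s"] by auto
  show "proj (x + y) = proj x + proj y"
    using proj_eq[OF F_add[OF xy]] proj_eq[OF xy(1)] proj_eq[OF xy(2)] by (simp add: lm_add[OF eN_lm x y])
next
  fix c x assume x: "x \<in> carr H"
  obtain r where r: "x \<in> F r" using in_F[OF x] by blast
  show "proj x \<in> carr H" using proj_eq[OF r] lm_closed[OF eN_lm x] by simp
  show "proj (scl H c x) = scl H c (proj x)"
    using proj_eq[OF r] proj_eq[OF F_scl[OF r]] by (simp add: lm_scl[OF eN_lm x])
qed

lemma proj_closed [simp]: "x \<in> carr H \<Longrightarrow> proj x \<in> carr H"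
  by (rule lm_closed[OF proj_lm])

lemma one_in_F0: "\<I> \<in> F 0"
  using scl_simps(3)[OF B, of \<I>] by (auto intro: exI[of _ 1])

lemma proj_one [simp]: "proj \<I> = 0"
  using proj_eq[OF one_in_F0] by simp

lemmas proj_conv_lm = conv_lm[OF proj_lm] and proj_conv_tens = conv_tens[OF proj_lm]

text \<open>The limit of the recursion. With \<open>x\<close> placed in step \<open>Suc n\<close>,
  the factors of its reduced coproduct lie in step \<open>n\<close>, and there \<open>eN n\<close>
  is already \<open>proj\<close>.\<close>

lemma proj_reduced:
  assumes x: "x \<in> carr H"
  shows "proj x = x - scl H (\<epsilon> x) \<I> - conv proj (reduced_comul H x)"
proof -
  obtain n where n: "x \<in> F n" using in_F[OF x] by blast
  then have n': "x \<in> F (Suc n)" using F_Suc by blast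
  then have "reduced_comul H x \<in> FF n" by simp
  then have "conv (eN n) (reduced_comul H x) = conv proj (reduced_comul H x)"
    by (rule FF_eqI[OF _ conv_lm[OF eN_lm] proj_conv_lm])
      (use proj_eq F_closed in \<open>auto simp: conv_tens[OF eN_lm] proj_conv_tens\<close>)
  then show ?thesis using proj_eq[OF n'] by simp
qed

text \<open>The convolution equation itself. Going from the reduced to the full coproduct adds the
  terms at \<open>x \<otimes> 1\<close> and \<open>1 \<otimes> x\<close>; the former is
  \<open>proj x\<close>, the latter vanishes as \<open>proj\<close> kills the unit.\<close>

lemma proj_conv:
  assumes x: "x \<in> carr H"
  shows "conv proj (comul H x) = x - scl H (\<epsilon> x) \<I>"
  using proj_reduced[OF x] rc_eq[OF x proj_conv_lm] x
  by (simp add: proj_conv_tens bl_zero_left[OF B d_bl])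

text \<open>Induction along the filtration: the coproduct of \<Sum> e(x')\<cdot>x'' is computed once
  from the primitivity of the e(x') and then simplified by coassociativity and the convolution
  equation for e. Solving for \<Delta>(e(x)) leaves only the two primitive terms.\<close>

lemma prim_proj: "x \<in> carr H \<Longrightarrow> prim (proj x)"
proof -
  have "x \<in> F n \<Longrightarrow> prim (proj x)" for n
  proof (induction n arbitrary: x)
    case 0
    have "prim 0" using subspace_prim by (simp add: module.subspace_def is_vspaceD(2))
    then show ?case using proj_eq[OF 0] by simp
  next
    case (Suc n)
    then have x [simp]: "x \<in> carr H" and rc: "reduced_comul H x \<in> FF n" by auto
    \<comment> \<open>The first term of the coproduct of \<open>proj a \<cdot> b\<close> for
      primitive \<open>proj a\<close>, see \<open>D_prim_d\<close>.\<close>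
    let ?g = "\<lambda>a b. tensor_mult H (dot H) (t (proj a) \<I>) (comul H b)"
    let ?G = "lin_ext pscale (\<lambda>(a, b). ?g a b)"
    have g_bl: "bilinear_map H H T ?g"
      by (rule bl_comp[OF tmb_d lm_comp[OF proj_lm bl_left[OF t_bl]] D]) simp
    note Gl = lift_lm[OF B B is_vspace_tensor[OF B B] scl_tensor g_bl]
    note Gt = lift_tens[OF B B is_vspace_tensor[OF B B] scl_tensor g_bl]
    \<comment> \<open>The reduced coproduct is essential here: its left factors lie in
      \<open>F n\<close>, where the induction hypothesis applies. The full coproduct contains
      \<open>x \<otimes> 1\<close>, for which primitivity of \<open>proj x\<close> is the claim
      itself.\<close>
    have comul_conv: "comul H (conv proj (reduced_comul H x))
      = ?G (reduced_comul H x) + t \<I> (conv proj (reduced_comul H x))"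
    proof (rule FF_eqI[OF rc])
      show "linear_map T T (\<lambda>X. comul H (conv proj X))" by (rule lm_comp[OF proj_conv_lm D])
      show "linear_map T T (\<lambda>X. ?G X + t \<I> (conv proj X))"
        by (intro lm_plus Gl lm_comp[OF proj_conv_lm bl_right[OF t_bl]]) auto
      fix a b assume "a \<in> F n" "b \<in> F n"
      then show "comul H (conv proj (t a b)) = ?G (t a b) + t \<I> (conv proj (t a b))"
        using Suc.IH[of a] F_closed[of a n] F_closed[of b n]
        by (simp add: proj_conv_tens D_prim_d Gt)
    qed
    \<comment> \<open>On the full coproduct the sum reads e(x')\<cdot>x'' \<otimes> x'''.
      Coassociativity brackets the first two factors, the convolution equation replaces their
      product by x' - \<epsilon>(x')1, and the counit collects the rest.\<close>
    have G_comul: "?G (comul H x) = comul H x - t \<I> x"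
    proof -
      let ?k = "\<lambda>a b c. t (dot H (proj a) b) c"
      have k12: "bilinear_map H H T (\<lambda>a b. ?k a b c)" if "c \<in> carr H" for c
        by (rule bl_lm[OF conv_bl[OF proj_lm] bl_left[OF t_bl that]])
      have k23: "bilinear_map H H T (\<lambda>b c. ?k a b c)" if "a \<in> carr H" for a
        by (rule bl_comp[OF t_bl bl_right[OF d_bl] lm_id]) (use that in simp)
      have inner: "?g a y = lin_ext pscale (\<lambda>(b, c). ?k a b c) (comul H y)"
        if a [simp]: "a \<in> carr H" and y [simp]: "y \<in> carr H" for a y
        by (rule tensor_eqI[OF B B D_closed[OF y] bl_right[OF tmb_d]
              lift_lm[OF B B is_vspace_tensor[OF B B] scl_tensor k23[OF a]]])
          (auto simp: tm_d lift_tens[OF B B is_vspace_tensor[OF B B] scl_tensor k23[OF a]])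
      have outer: "lin_ext pscale (\<lambda>(a, b). ?k a b c) (comul H y) = t (y - scl H (\<epsilon> y) \<I>) c"
        if c [simp]: "c \<in> carr H" and y [simp]: "y \<in> carr H" for c y
      proof -
        have "lin_ext pscale (\<lambda>(a, b). ?k a b c) (comul H y) = t (conv proj (comul H y)) c"
          by (rule tensor_eqI[OF B B D_closed[OF y]
              lift_lm[OF B B is_vspace_tensor[OF B B] scl_tensor k12[OF c]]
              lm_comp[OF proj_conv_lm bl_left[OF t_bl c]]])
            (auto simp: proj_conv_tens lift_tens[OF B B is_vspace_tensor[OF B B] scl_tensor k12[OF c]])
        then show ?thesis by (simp add: proj_conv)
      qed
      have "?G (comul H x) = lin_ext pscale (\<lambda>(a, y). lin_ext pscale (\<lambda>(b, c). ?k a b c) (comul H y)) (comul H x)"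
        by (rule tensor_lift_cong[OF B B D_closed[OF x]]) (rule inner)
      also have "\<dots> = lin_ext pscale (\<lambda>(y, c). lin_ext pscale (\<lambda>(a, b). ?k a b c) (comul H y)) (comul H x)"
        by (rule coassoc_lift[OF cc is_vspace_tensor[OF B B] scl_tensor k12 k23 x, symmetric])
      also have "\<dots> = lin_ext pscale (\<lambda>(y, c). t (y - scl H (\<epsilon> y) \<I>) c) (comul H x)"
        by (rule tensor_lift_cong[OF B B D_closed[OF x]]) (rule outer)
      also have "\<dots> = comul H x - t \<I> (lin_ext (scl H) (\<lambda>(a, b). scl H (\<epsilon> a) b) (comul H x))"
      proof (rule tensor_eqI[OF B B D_closed[OF x]])
        have bl: "bilinear_map H H T (\<lambda>y c. t (y - scl H (\<epsilon> y) \<I>) c)"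
          by (rule bl_comp[OF t_bl lm_minus[OF B lm_id lm_scl_const[OF B e eps]] lm_id])
        show "linear_map T T (lin_ext pscale (\<lambda>(y, c). t (y - scl H (\<epsilon> y) \<I>) c))"
          by (rule lift_lm[OF B B is_vspace_tensor[OF B B] scl_tensor bl])
        show "linear_map T T (\<lambda>X. X - t \<I> (lin_ext (scl H) (\<lambda>(a, b). scl H (\<epsilon> a) b) X))"
          by (intro lm_minus lm_id lm_comp[OF lift_lm[OF B B B refl left_bl] bl_right[OF t_bl]]) auto
        fix a b assume [simp]: "a \<in> carr H" "b \<in> carr H"
        show "lin_ext pscale (\<lambda>(y, c). t (y - scl H (\<epsilon> y) \<I>) c) (t a b)
          = t a b - t \<I> (lin_ext (scl H) (\<lambda>(a, b). scl H (\<epsilon> a) b) (t a b))"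
          by (simp add: lift_tens[OF B B is_vspace_tensor[OF B B] scl_tensor bl] lift_tens[OF B B B refl left_bl]
              bl_diff_left[OF B t_bl] bl_scl_left[OF t_bl] bl_scl_right[OF t_bl])
      qed
      finally show ?thesis by (simp add: cc_counit_left[OF cc x])
    qed
    define S where "S = conv proj (reduced_comul H x)"
    have S [simp]: "S \<in> carr H" unfolding S_def by (rule lm_closed[OF proj_conv_lm lm_closed[OF rc_lm x]])
    have p: "proj x = x - scl H (\<epsilon> x) \<I> - S" unfolding S_def by (rule proj_reduced[OF x])
    \<comment> \<open>Returning to the reduced coproduct subtracts the value of \<open>?G\<close> at
      \<open>x \<otimes> 1\<close>, which is \<open>t (proj x) \<I>\<close>, and at
      \<open>1 \<otimes> x\<close>, which is \<open>0\<close>.\<close>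
    have "comul H S = comul H x - t \<I> x - t (proj x) \<I> + t \<I> S"
      using comul_conv by (simp add: S_def[symmetric] rc_eq[OF x Gl] G_comul Gt D_one tm_d
          bl_zero_left[OF B t_bl] bl_zero_left[OF _ tmb_d])
    moreover have "comul H (proj x) = comul H x - comul H (scl H (\<epsilon> x) \<I>) - comul H S"
      by (simp add: p lm_diff[OF B D])
    moreover have "comul H (scl H (\<epsilon> x) \<I>) = t \<I> (scl H (\<epsilon> x) \<I>)"
      by (simp add: lm_scl[OF D] D_one bl_scl_right[OF t_bl])
    moreover have "t \<I> (proj x) = t \<I> x - t \<I> (scl H (\<epsilon> x) \<I>) - t \<I> S"
      by (simp add: p bl_diff_right[OF B t_bl])
    ultimately show ?case by (simp add: prim_def)
  qed
  then show "x \<in> carr H \<Longrightarrow> prim (proj x)" using in_F by blast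
qed

text \<open>The convolution equation on a nonempty word states that the terms
  \<open>proj (dp (take i ps)) \<cdot> dp (drop i ps)\<close> add up to the word. For proper
  prefixes the induction hypothesis leaves only \<open>i = 1\<close>, which already yields the whole
  word; so the last term, the value of \<open>proj\<close> on the word itself, is zero. For a single
  letter the last term is the only one.\<close>

lemma proj_dp: "ps \<in> lists (Collect prim) \<Longrightarrow> proj (dp ps) = (if length ps = 1 then hd ps else 0)"
proof (induction "length ps" arbitrary: ps rule: less_induct)
  case less
  note psc = prims_closed[OF less.prems]
  show ?case
  proof (cases ps)
    case (Cons p qs)
    then have p: "prim p" and [simp]: "p \<in> carr H" "dp qs \<in> carr H"
      using less.prems psc by (auto intro!: dp_closed simp: in_lists_conv_set)
    note cl [simp] = dp_closed[OF take_lists[OF psc]] dp_closed[OF drop_lists[OF psc]]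
    let ?f = "\<lambda>i. dot H (proj (dp (take i ps))) (dp (drop i ps))"
    have "conv proj (comul H (dp ps)) = (\<Sum>i\<le>length ps. ?f i)"
      unfolding D_dp[OF less.prems]
      by (subst lm_sum[OF _ proj_conv_lm]) (auto simp: proj_conv_tens)
    moreover have "conv proj (comul H (dp ps)) = dp ps"
      using proj_conv[OF dp_closed[OF psc]] p by (simp add: Cons eps_dot eps_prim)
    ultimately have sum: "(\<Sum>i\<le>length ps. ?f i) = dp ps" by simp
    have f: "?f i = (if i = 1 then dp ps else 0)" if "i < length ps" for i
    proof -
      have "proj (dp (take i ps)) = (if length (take i ps) = 1 then hd (take i ps) else 0)"
        by (rule less.hyps) (use that take_lists[OF less.prems] in auto)
      moreover have "dot H 0 (dp (drop i ps)) = 0" by (rule bl_zero_left[OF B d_bl cl(2)])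
      ultimately show ?thesis using that by (auto simp: Cons min_def)
    qed
    show ?thesis
    proof (cases qs)
      case Nil
      then show ?thesis using sum p Cons by (simp add: bl_zero_left[OF B d_bl])
    next
      case (Cons q rs)
      have "(\<Sum>i\<le>length ps. ?f i) = (\<Sum>i<length ps. ?f i) + ?f (length ps)"
        by (simp add: lessThan_Suc_atMost[symmetric])
      also have "(\<Sum>i<length ps. ?f i) = (\<Sum>i<length ps. if i = 1 then dp ps else 0)"
        by (rule sum.cong[OF refl]) (rule f, simp)
      also have "\<dots> = dp ps" using \<open>ps = p # qs\<close> Cons by (subst sum.delta) auto
      finally have "?f (length ps) = 0" using sum by simp
      then show ?thesis using \<open>ps = p # qs\<close> Cons dp_closed[OF psc] by simp
    qed
  qed simp
qed

section \<open>The word map and its inverse\<close>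

abbreviation (input) "P \<equiv> Prim H"
abbreviation (input) "TP \<equiv> word_space (Prim H)"

lemma TP [simp]: "is_vspace TP" by simp

lemma projP_lm: "linear_map H P proj"
  using proj_lm by (auto simp: linear_map_def carr_Prim prim_proj)

definition from_words :: "('v list \<Rightarrow>\<^sub>0 'k) \<Rightarrow> 'v" where
  "from_words = lin_ext (scl H) dp"

lemma dp_P_ml: "multilinear P H dp"
  using dp_ml[OF Prim_incl] by simp

lemma from_words_lm: "linear_map TP H from_words"
  unfolding from_words_def by (rule word_lift_lm[OF _ B refl dp_P_ml]) simp

lemma from_words_word: "ps \<in> lists (carr P) \<Longrightarrow> from_words (word P ps) = dp ps"
  unfolding from_words_def by (rule word_lift[OF _ B refl dp_P_ml]) simp

text \<open>Approximate inverse of \<open>from_words\<close>: it splits off at most \<open>n\<close>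
  letters, each by applying \<open>proj\<close> to a left factor of the coproduct, and closes with
  the counit on the empty word.\<close>

primrec hN :: "nat \<Rightarrow> 'v \<Rightarrow> ('v list \<Rightarrow>\<^sub>0 'k)" where
  "hN 0 = (\<lambda>x. pscale (\<epsilon> x) (word P []))"
| "hN (Suc n) = (\<lambda>x. pscale (\<epsilon> x) (word P [])
     + lin_ext pscale (\<lambda>(a, b). wcat P (word P [proj a]) (hN n b)) (comul H x))"

lemma letter_lm: "linear_map P TP (\<lambda>x. word P [x])"
  using ml_lm[OF word_ml[of P], of "[]" "[]"] by simp

lemma word_Nil [simp]: "word P [] \<in> carr TP"
  by (simp add: word_closed)

lemma hN_bl: "linear_map H TP h \<Longrightarrow> bilinear_map H H TP (\<lambda>a b. wcat P (word P [proj a]) (h b))"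
  by (rule bl_comp[OF wcat_bl lm_comp[OF projP_lm letter_lm]]) auto

lemma eps_word_lm: "linear_map H TP (\<lambda>x. pscale (\<epsilon> x) (word P []))"
  using lm_scl_const[OF TP word_Nil eps] by simp

lemma hN_lm: "linear_map H TP (hN n)"
  by (induction n)
    (auto intro!: lm_plus eps_word_lm lm_comp[OF D lift_lm[OF B B TP scl_word_space hN_bl]])

lemmas hNl = lift_lm[OF B B TP scl_word_space hN_bl[OF hN_lm]]
  and hNt = lift_tens[OF B B TP scl_word_space hN_bl[OF hN_lm]]

text \<open>By \<open>proj_dp\<close> only the cut behind the first letter survives. That letter is
  split off unchanged, and the rest has one letter less for an index reduced by one.\<close>

lemma hN_dp: "ps \<in> lists (Collect prim) \<Longrightarrow> length ps \<le> n \<Longrightarrow> hN n (dp ps) = word P ps"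
proof (induction n arbitrary: ps)
  case 0
  then show ?case by (simp add: eps_one)
next
  case (Suc n)
  note psc = prims_closed[OF Suc.prems(1)]
  note cl [simp] = dp_closed[OF take_lists[OF psc]] dp_closed[OF drop_lists[OF psc]]
  have w0: "wcat P (word P [0]) X = 0" if "X \<in> carr TP" for X
    using lm_zero[OF is_vspace_Prim letter_lm] bl_zero_left[OF _ wcat_bl that] by simp
  have "hN (Suc n) (dp ps) = pscale (\<epsilon> (dp ps)) (word P [])
      + (\<Sum>i\<le>length ps. wcat P (word P [proj (dp (take i ps))]) (hN n (dp (drop i ps))))"
    unfolding D_dp[OF Suc.prems(1)] hN.simps
    by (subst lm_sum[OF _ hNl]) (auto simp: hNt)
  also have "\<dots> = word P ps"
  proof (cases ps)
    case Nil
    then show ?thesis by (simp add: eps_one w0 lm_closed[OF hN_lm])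
  next
    case (Cons p qs)
    have pq: "prim p" "qs \<in> lists (Collect prim)" using Cons Suc.prems by auto
    have "(\<Sum>i\<le>length ps. wcat P (word P [proj (dp (take i ps))]) (hN n (dp (drop i ps))))
      = (\<Sum>i\<le>length ps. if i = 1 then word P ps else 0)"
    proof (rule sum.cong[OF refl])
      fix i assume i: "i \<in> {..length ps}"
      have "proj (dp (take i ps)) = (if i = 1 then p else 0)"
        using proj_dp[OF take_lists[OF Suc.prems(1)], of i] i Cons by (auto simp: min_def)
      moreover have "wcat P (word P [p]) (hN n (dp (drop 1 ps))) = word P ps"
        using Suc.IH[OF pq(2)] Suc.prems(2) Cons pq
        by (simp add: wcat_word carr_Prim in_lists_conv_set)
      ultimately show "wcat P (word P [proj (dp (take i ps))]) (hN n (dp (drop i ps)))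
        = (if i = 1 then word P ps else 0)"
        by (auto simp: w0 lm_closed[OF hN_lm])
    qed
    also have "\<dots> = word P ps" using Cons by (subst sum.delta) auto
    finally have "(\<Sum>i\<le>length ps. wcat P (word P [proj (dp (take i ps))]) (hN n (dp (drop i ps))))
      = word P ps" .
    moreover have "\<epsilon> (dp ps) = 0"
      using pq prims_closed[OF pq(2)] by (simp add: Cons eps_dot eps_prim prim_closed dp_closed)
    ultimately show ?thesis by simp
  qed
  finally show ?case .
qed

lemma from_words_wcat:
  assumes v: "v \<in> carr P" and X: "X \<in> carr TP"
  shows "from_words (wcat P (word P [v]) X) = dot H v (from_words X)"
proof (rule word_eqI[OF is_vspace_Prim X])
  have v': "v \<in> carr H" using v by (simp add: carr_Prim prim_closed)
  show "linear_map TP H (\<lambda>X. from_words (wcat P (word P [v]) X))"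
    by (rule lm_comp[OF bl_right[OF wcat_bl] from_words_lm]) (use v in \<open>auto intro!: word_closed\<close>)
  show "linear_map TP H (\<lambda>X. dot H v (from_words X))"
    by (rule lm_comp[OF from_words_lm bl_right[OF d_bl v']])
  show "from_words (wcat P (word P [v]) (word P vs)) = dot H v (from_words (word P vs))"
    if "vs \<in> lists (carr P)" for vs
    using that v by (simp add: wcat_word from_words_word)
qed

text \<open>\<open>from_words\<close> turns the recursion of \<open>hN\<close> into the convolution
  equation. The induction hypothesis serves the right factors of the reduced coproduct; of the two
  terms added by the full coproduct, \<open>1 \<otimes> x\<close> is killed by \<open>proj\<close>,
  and \<open>x \<otimes> 1\<close> only requires the value on the unit.\<close>

lemma from_words_hN: "x \<in> F n \<Longrightarrow> from_words (hN n x) = x"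
proof (induction n arbitrary: x)
  case 0
  then show ?case
    using lm_scl[OF from_words_lm word_Nil] by (auto simp: lm_scl[OF eps] eps_one from_words_word)
next
  case (Suc n)
  then have x [simp]: "x \<in> carr H" and rc: "reduced_comul H x \<in> FF n" by auto
  let ?L = "lin_ext pscale (\<lambda>(a, b). wcat P (word P [proj a]) (hN n b))"
  note fl = lm_comp[OF hNl from_words_lm]
  have ft: "from_words (?L (t a b)) = dot H (proj a) (from_words (hN n b))"
    if "a \<in> carr H" "b \<in> carr H" for a b
    using that by (simp add: hNt from_words_wcat lm_closed[OF projP_lm] lm_closed[OF hN_lm])
  have "from_words (?L (reduced_comul H x)) = conv proj (reduced_comul H x)"
    by (rule FF_eqI[OF rc fl proj_conv_lm]) (use Suc.IH F_closed in \<open>auto simp: ft proj_conv_tens\<close>)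
  moreover have "from_words (hN n \<I>) = \<I>"
    using hN_dp[of "[]" n] from_words_word[of "[]"] by simp
  ultimately have "from_words (?L (comul H x)) = conv proj (comul H x)"
    using rc_eq[OF x fl] rc_eq[OF x proj_conv_lm] lm_closed[OF from_words_lm lm_closed[OF hN_lm x], of n]
    by (simp add: ft proj_conv_tens bl_zero_left[OF B d_bl])
  moreover have "?L (comul H x) \<in> carr TP" by (rule lm_closed[OF hNl]) simp
  ultimately show ?case
    using lm_scl[OF from_words_lm word_Nil, of "\<epsilon> x"]
      vs_scl[OF TP word_Nil, of "\<epsilon> x"]
    by (simp add: lm_add[OF from_words_lm] proj_conv from_words_word)
qed

text \<open>The index has to exceed the lengths of all words in \<open>X\<close>, so none works for
  every \<open>X\<close>. Claiming it for all large \<open>m\<close> is what allows two summands to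
  be compared at a common index.\<close>

lemma from_words_inj:
  assumes X: "X \<in> carr TP"
  shows "\<exists>n. \<forall>m\<ge>n. hN m (from_words X) = X"
proof (rule word_induct[OF is_vspace_Prim X], goal_cases)
  case 1
  then show ?case using lm_zero[OF TP from_words_lm] lm_zero[OF B hN_lm] by simp
next
  case (2 c vs)
  then have "hN m (from_words (pscale c (word P vs))) = pscale c (word P vs)" if "length vs \<le> m" for m
    using that lm_scl[OF from_words_lm word_closed[OF is_vspace_Prim], of vs c]
      dp_closed[OF prims_closed, of vs]
    by (simp add: from_words_word lm_scl[OF hN_lm] hN_dp carr_Prim)
  then show ?case by blast
next
  case (3 X Y)
  then obtain n k where "\<forall>m\<ge>n. hN m (from_words X) = X" "\<forall>m\<ge>k. hN m (from_words Y) = Y" by blast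
  then have "hN m (from_words (X + Y)) = X + Y" if "max n k \<le> m" for m
    using that 3(1,2) by (simp add: lm_add[OF from_words_lm] lm_add[OF hN_lm] lm_closed[OF from_words_lm])
  then show ?case by blast
qed

lemma from_words_bij: "bij_betw from_words (carr TP) (carr H)"
  unfolding bij_betw_def
proof (intro conjI inj_onI equalityI subsetI)
  fix X Y assume *: "X \<in> carr TP" "Y \<in> carr TP" "from_words X = from_words Y"
  obtain n where n: "\<forall>m\<ge>n. hN m (from_words X) = X" using from_words_inj[OF *(1)] by blast
  obtain k where k: "\<forall>m\<ge>k. hN m (from_words Y) = Y" using from_words_inj[OF *(2)] by blast
  have "hN (max n k) (from_words X) = X" by (rule n[rule_format]) (rule max.cobounded1)
  moreover have "hN (max n k) (from_words Y) = Y" by (rule k[rule_format]) (rule max.cobounded2)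
  ultimately show "X = Y" unfolding *(3) by (rule trans[OF sym])
next
  fix x assume "x \<in> carr H"
  then obtain n where "x \<in> F n" using in_F by blast
  then show "x \<in> from_words ` carr TP"
    using imageI[OF lm_closed[OF hN_lm F_closed, of x n n], of from_words] from_words_hN[of x n]
    by simp
qed (auto intro: lm_closed[OF from_words_lm])

lemma from_words_comul:
  assumes X: "X \<in> carr TP"
  shows "comul H (from_words X) = tensor_map H H from_words from_words (comul (tensor_coalgebra P) X)"
proof (rule word_eqI[OF is_vspace_Prim X lm_comp[OF from_words_lm D]])
  note tl = tensor_map_lm[OF TP TP B B from_words_lm from_words_lm]
  show "linear_map TP T (\<lambda>X. tensor_map H H from_words from_words (comul (tensor_coalgebra P) X))"
    by (rule lm_comp[OF comul_word_lm tl]) simp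
  fix vs assume vs: "vs \<in> lists (carr P)"
  note cl = word_closed[OF is_vspace_Prim take_lists[OF vs]] word_closed[OF is_vspace_Prim drop_lists[OF vs]]
  have "tensor_map H H from_words from_words (comul (tensor_coalgebra P) (word P vs))
    = (\<Sum>i\<le>length vs. t (dp (take i vs)) (dp (drop i vs)))"
    using cl vs
    by (simp add: comul_word lm_sum[OF _ tl] tensor_map_tens[OF TP TP B B from_words_lm from_words_lm]
        from_words_word take_lists drop_lists)
  then show "comul H (from_words (word P vs))
    = tensor_map H H from_words from_words (comul (tensor_coalgebra P) (word P vs))"
    using vs by (simp add: from_words_word D_dp carr_Prim)
qed

lemma from_words_counit:
  assumes X: "X \<in> carr TP"
  shows "\<epsilon> (from_words X) = counit (tensor_coalgebra P) X"
proof (rule word_eqI[OF is_vspace_Prim X lm_comp[OF from_words_lm eps] counit_word_lm[OF is_vspace_Prim]])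
  fix vs assume vs: "vs \<in> lists (carr P)"
  show "\<epsilon> (from_words (word P vs)) = counit (tensor_coalgebra P) (word P vs)"
  proof (cases vs)
    case (Cons v ws)
    have "prim v" "dp ws \<in> carr H"
      using vs prims_closed[of ws] by (auto simp: Cons carr_Prim intro!: dp_closed)
    then show ?thesis using vs by (simp add: from_words_word counit_word Cons eps_dot prim_closed eps_prim)
  qed (simp add: from_words_word counit_word eps_one)
qed

lemma cofree: "\<exists>\<phi>. coalgebra_iso H (tensor_coalgebra P) \<phi>"
proof -
  have "coalgebra_iso (tensor_coalgebra P) H from_words"
    unfolding coalgebra_iso_def
    using from_words_lm from_words_bij from_words_comul from_words_counit
    by (simp add: linear_map_def)
  moreover have "is_vspace (tensor_coalgebra P)"
    using TP by (simp only: is_vspace_def tc_simps[OF is_vspace_Prim] scl_word_space)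
  moreover have "linear_map (tensor_coalgebra P) (tensor (tensor_coalgebra P) (tensor_coalgebra P))
      (comul (tensor_coalgebra P))"
    using comul_word_lm[OF is_vspace_Prim] by (simp add: linear_map_def)
  ultimately show ?thesis using coalgebra_iso_inv[OF _ B] by blast
qed

end

section \<open>Ideals and quotient algebras\<close>

definition ideal_of ::
  "('x \<Rightarrow>\<^sub>0 'k::field) set \<Rightarrow> (('x \<Rightarrow>\<^sub>0 'k) \<Rightarrow> ('x \<Rightarrow>\<^sub>0 'k) \<Rightarrow> ('x \<Rightarrow>\<^sub>0 'k))
    \<Rightarrow> (('x \<Rightarrow>\<^sub>0 'k) \<Rightarrow> ('x \<Rightarrow>\<^sub>0 'k) \<Rightarrow> ('x \<Rightarrow>\<^sub>0 'k)) \<Rightarrow> ('x \<Rightarrow>\<^sub>0 'k) set \<Rightarrow> bool" where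
  "ideal_of C st d I \<longleftrightarrow> I \<subseteq> C \<and> module.subspace pscale I \<and>
     (\<forall>a\<in>C. \<forall>x\<in>I. st a x \<in> I \<and> st x a \<in> I \<and> d a x \<in> I \<and> d x a \<in> I)"

lemma generated_ideal_alt: "generated_ideal C st d X = \<Inter>{I. X \<subseteq> I \<and> ideal_of C st d I}"
  by (simp add: generated_ideal_def ideal_of_def)

lemma generated_ideal_least: "X \<subseteq> J \<Longrightarrow> ideal_of C st d J \<Longrightarrow> generated_ideal C st d X \<subseteq> J"
  by (auto simp: generated_ideal_alt)

lemma generated_ideal_sup: "X \<subseteq> generated_ideal C st d X"
  by (auto simp: generated_ideal_alt)

lemma ideal_of_generated_ideal:
  assumes "X \<subseteq> C" "module.subspace pscale C"
    and "\<And>x y. x \<in> C \<Longrightarrow> y \<in> C \<Longrightarrow> st x y \<in> C" "\<And>x y. x \<in> C \<Longrightarrow> y \<in> C \<Longrightarrow> d x y \<in> C"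
  shows "ideal_of C st d (generated_ideal C st d X)"
proof -
  let ?S = "{I. X \<subseteq> I \<and> ideal_of C st d I}"
  have C: "C \<in> ?S" using assms by (auto simp: ideal_of_def)
  have "module.subspace pscale (\<Inter>?S)"
    by (rule module.subspace_Inter[OF module_pscale]) (auto simp: ideal_of_def)
  moreover have "\<forall>a\<in>C. \<forall>x\<in>\<Inter>?S. st a x \<in> \<Inter>?S \<and> st x a \<in> \<Inter>?S \<and> d a x \<in> \<Inter>?S \<and> d x a \<in> \<Inter>?S"
    by (simp add: ideal_of_def)
  ultimately show ?thesis using C unfolding generated_ideal_alt ideal_of_def by blast
qed

locale quot_mult = quot "carr W" N for W :: "('k::field, 'x \<Rightarrow>\<^sub>0 'k) vspace" and N +
  fixes m :: "('x \<Rightarrow>\<^sub>0 'k) \<Rightarrow> ('x \<Rightarrow>\<^sub>0 'k) \<Rightarrow> ('x \<Rightarrow>\<^sub>0 'k)"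
  assumes W [simp]: "is_vspace W" and sW [simp]: "scl W = pscale"
    and m: "bilinear_map W W W m"
    and ideal_left: "\<And>a x. a \<in> carr W \<Longrightarrow> x \<in> N \<Longrightarrow> m a x \<in> N"
    and ideal_right: "\<And>a x. a \<in> carr W \<Longrightarrow> x \<in> N \<Longrightarrow> m x a \<in> N"
begin

lemma rep_lm: "linear_map W Q (coset_rep N)"
  by (rule linear_mapI) (auto simp: rep_add rep_pscale)

lemma incl_lm: "linear_map Q W (\<lambda>x. x)"
  by (rule linear_mapI) (auto dest: Q_sub_C)

lemma mult_rep:
  assumes f: "f \<in> carr W" and g: "g \<in> carr W"
  shows "coset_rep N (m (coset_rep N f) (coset_rep N g)) = coset_rep N (m f g)"
proof -
  have "m (coset_rep N f) (coset_rep N g) - m f g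
    = m (coset_rep N f - f) (coset_rep N g) + m f (coset_rep N g - g)"
    using rep_in_C[OF f] rep_in_C[OF g] f g by (simp add: bl_diff_left[OF W m] bl_diff_right[OF W m])
  also have "\<dots> \<in> N"
    by (intro module.subspace_add[OF module_pscale N] ideal_left ideal_right rep_in_C f g coset_rep_in_coset[OF N])
  finally show ?thesis by (simp add: coset_rep_eq_iff[OF N])
qed

lemma mult_bl: "bilinear_map Q Q Q (\<lambda>x y. coset_rep N (m x y))"
  by (rule bl_comp[OF bl_lm[OF m rep_lm] incl_lm incl_lm])

end

text \<open>The setting of an induced coproduct: \<open>W\<close> is an algebra before and
  \<open>B\<close> one after dividing by relations, \<open>p\<close> is the projection, and \<Delta>
  already takes values in the tensor square of \<open>B\<close>. It is used for formal expressions
  over \<open>2as\<close> and for \<open>2as\<close> over \<open>U2\<close>.\<close>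

locale comult_kernel = two_as_algebra B st d e
  for B :: "('k::field, 'v::ab_group_add, 'z) vspace_scheme" and st d and e :: 'v +
  fixes W :: "('k, 'x \<Rightarrow>\<^sub>0 'k) vspace" and mst md p \<Delta>
  assumes W [simp]: "is_vspace W" and sW [simp]: "scl W = pscale"
    and mst: "bilinear_map W W W mst" and md: "bilinear_map W W W md"
    and p: "linear_map W B p" and \<Delta>: "linear_map W (tensor B B) \<Delta>"
    and p_st: "\<And>x y. x \<in> carr W \<Longrightarrow> y \<in> carr W \<Longrightarrow> p (mst x y) = st (p x) (p y)"
    and p_d: "\<And>x y. x \<in> carr W \<Longrightarrow> y \<in> carr W \<Longrightarrow> p (md x y) = d (p x) (p y)"
    and \<Delta>_st: "\<And>x y. x \<in> carr W \<Longrightarrow> y \<in> carr W \<Longrightarrow> \<Delta> (mst x y) = tensor_mult B st (\<Delta> x) (\<Delta> y)"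
    and \<Delta>_d: "\<And>x y. x \<in> carr W \<Longrightarrow> y \<in> carr W \<Longrightarrow> \<Delta> (md x y) =
      tensor_mult B d (tens B B (p x) e) (\<Delta> y) + tensor_mult B d (\<Delta> x) (tens B B e (p y))
      - tens B B (p x) (p y)"
begin

text \<open>The coproduct of a \<cdot>-product contains \<open>p x\<close> and \<open>p y\<close>
  next to \<Delta>(x) and \<Delta>(y). If one argument is killed by both \<open>p\<close> and
  \<Delta>, each summand has a zero factor.\<close>

lemma kernel_ideal: "ideal_of (carr W) mst md {x \<in> carr W. p x = 0 \<and> \<Delta> x = 0}"
proof -
  note T = is_vspace_tensor[OF B B]
  note b = tensor_mult_bl[OF B st_bl] tensor_mult_bl[OF B d_bl] tens_bl[OF B B]
  have z: "st 0 x = 0" "st x 0 = 0" "d 0 x = 0" "d x 0 = 0" if "x \<in> carr B" for x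
    using that by (auto simp: bl_zero_left[OF B st_bl] bl_zero_left[OF B d_bl]
        bl_zero_right[OF B st_bl] bl_zero_right[OF B d_bl])
  have tz: "tens B B 0 x = 0" "tens B B x 0 = 0" if "x \<in> carr B" for x
    using that by (auto simp: bl_zero_left[OF B b(3)] bl_zero_right[OF B b(3)])
  have mz: "tensor_mult B st 0 X = 0" "tensor_mult B st X 0 = 0"
    "tensor_mult B d 0 X = 0" "tensor_mult B d X 0 = 0" if "X \<in> carr (tensor B B)" for X
    using that by (auto simp: bl_zero_left[OF T b(1)] bl_zero_right[OF T b(1)]
        bl_zero_left[OF T b(2)] bl_zero_right[OF T b(2)])
  have "module.subspace pscale {x \<in> carr W. p x = 0 \<and> \<Delta> x = 0}"
    unfolding subspace_pscale_iff
    using lm_zero[OF W p] lm_zero[OF W \<Delta>] lm_scl[OF p] lm_scl[OF \<Delta>] vs_scl[OF W]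
    by (auto simp: lm_add[OF p] lm_add[OF \<Delta>])
  then show ?thesis
    using lm_closed[OF p] lm_closed[OF \<Delta>]
    by (auto simp: ideal_of_def p_st p_d \<Delta>_st \<Delta>_d z tz mz bl_closed[OF mst] bl_closed[OF md])
qed

end

section \<open>Products of formal sums of expressions\<close>

lemma free_eqI:
  assumes "f \<in> free_on X" and F: "linear_map (free_space X) U F" and G: "linear_map (free_space X) U G"
    and "\<And>x. x \<in> X \<Longrightarrow> F (basis x) = G (basis x)"
  shows "F f = G f"
  using assms(1)
proof (induction f rule: free_on_induct)
  case zero
  then show ?case using lm_zero[OF _ F] lm_zero[OF _ G] by simp
next
  case (basis c x)
  then show ?case using lm_scl[OF F, of "basis x" c] lm_scl[OF G, of "basis x" c] assms(4) by simp
next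
  case (add f g)
  then show ?case using lm_add[OF F, of f g] lm_add[OF G, of f g] by simp
qed

lemma expr_mult_basis: "expr_mult op (basis s) (basis t) = basis (op s t)"
  by (simp add: expr_mult_def module_pscale)

context
  fixes X :: "'v expr set" and op
  assumes op: "\<And>s t. s \<in> X \<Longrightarrow> t \<in> X \<Longrightarrow> op s t \<in> X"
begin

lemma expr_mult_bl: "bilinear_map (free_space X) (free_space X) (free_space X)
    (expr_mult op :: _ \<Rightarrow> _ \<Rightarrow> ('v expr \<Rightarrow>\<^sub>0 'k::field))"
  unfolding bilinear_map_def
proof (intro conjI ballI)
  have inner: "linear_map (free_space X) (free_space X) (lin_ext pscale (\<lambda>t. basis (op s t) :: _ \<Rightarrow>\<^sub>0 'k))"
    if "s \<in> X" for s
    using lin_ext_lm[of "free_space X" X "\<lambda>t. basis (op s t)"] op that by simp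
  fix f :: "'v expr \<Rightarrow>\<^sub>0 'k" assume f: "f \<in> carr (free_space X)"
  show "linear_map (free_space X) (free_space X) (expr_mult op f)"
    unfolding expr_mult_def
    by (rule lin_ext_param_lm[of _ _ _ X]) (use f inner in auto)
  have "lin_ext pscale (\<lambda>t. basis (op s t)) f \<in> free_on X" if "s \<in> X" for s
    using lm_closed[OF inner[OF that]] f by simp
  then show "linear_map (free_space X) (free_space X) (\<lambda>x. expr_mult op x f)"
    unfolding expr_mult_def
    using lin_ext_lm[of "free_space X" X "\<lambda>s. lin_ext pscale (\<lambda>t. basis (op s t)) f"] by simp
qed

text \<open>A bilinear identity on formal sums is reduced to pairs of single expressions, one
  argument at a time; the multiplicativity of the coproduct and of evaluation comes from it.\<close>

lemma expr_mult_eqI: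
  assumes F: "linear_map (free_space X) U F" and b: "bilinear_map W W U b"
    and p: "linear_map (free_space X) W p"
    and eq: "\<And>s t. s \<in> X \<Longrightarrow> t \<in> X \<Longrightarrow> F (basis (op s t)) = b (p (basis s)) (p (basis t))"
    and f: "f \<in> free_on X" and g: "g \<in> free_on X"
  shows "F (expr_mult op f g) = b (p f) (p g)"
proof -
  note l = bl_lm[OF expr_mult_bl F] and r = bl_comp[OF b p p]
  have "F (expr_mult op (basis s) g) = b (p (basis s)) (p g)" if "s \<in> X" for s
    by (rule free_eqI[OF g bl_right[OF l] bl_right[OF r]]) (use that eq in \<open>auto simp: expr_mult_basis\<close>)
  then show ?thesis
    by (intro free_eqI[OF f bl_left[OF l] bl_left[OF r]]) (use g in auto)
qed

end

lemma exprs_simps [simp]: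
  "EOne \<in> exprs V" "EGen v \<in> exprs V \<longleftrightarrow> v \<in> carr V"
  "EStar s t \<in> exprs V \<longleftrightarrow> s \<in> exprs V \<and> t \<in> exprs V"
  "EDot s t \<in> exprs V \<longleftrightarrow> s \<in> exprs V \<and> t \<in> exprs V"
  by (auto simp: exprs_def)

section \<open>Consistency of the coproduct rule with the unit and associativity laws of
  \<cdot>\<close>

context two_as_algebra
begin

abbreviation (input) tmul_d (infixl "\<odot>" 70) where "X \<odot> Y \<equiv> tensor_mult B d X Y"
abbreviation (input) ten (infix "\<otimes>\<^sub>t" 75) where "x \<otimes>\<^sub>t y \<equiv> tens B B x y"

text \<open>The coproduct of \<open>x \<cdot> y\<close> if \<open>x\<close> and \<open>y\<close> have coproducts \<open>X\<close> and \<open>Y\<close>.\<close>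

definition dot_comul where
  "dot_comul x X y Y = (x \<otimes>\<^sub>t e) \<odot> Y + X \<odot> (e \<otimes>\<^sub>t y) - x \<otimes>\<^sub>t y"

lemma tmul_unit:
  assumes X: "X \<in> carr (tensor B B)"
  shows "tensor_mult B st (e \<otimes>\<^sub>t e) X = X" "tensor_mult B st X (e \<otimes>\<^sub>t e) = X"
    and "(e \<otimes>\<^sub>t e) \<odot> X = X" "X \<odot> (e \<otimes>\<^sub>t e) = X"
proof -
  note b = tensor_mult_bl[OF B st_bl] tensor_mult_bl[OF B d_bl]
  note v = tensor_mult_tens[OF B st_bl] tensor_mult_tens[OF B d_bl]
  note ee = tens_closed[OF B B e e]
  show "tensor_mult B st (e \<otimes>\<^sub>t e) X = X" by (rule tensor_eqI[OF B B X bl_right[OF b(1) ee] lm_id]) (simp add: v)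
  show "tensor_mult B st X (e \<otimes>\<^sub>t e) = X" by (rule tensor_eqI[OF B B X bl_left[OF b(1) ee] lm_id]) (simp add: v)
  show "(e \<otimes>\<^sub>t e) \<odot> X = X" by (rule tensor_eqI[OF B B X bl_right[OF b(2) ee] lm_id]) (simp add: v)
  show "X \<odot> (e \<otimes>\<^sub>t e) = X" by (rule tensor_eqI[OF B B X bl_left[OF b(2) ee] lm_id]) (simp add: v)
qed

lemma dot_comul_unit:
  assumes "x \<in> carr B" "X \<in> carr (tensor B B)"
  shows "dot_comul e (e \<otimes>\<^sub>t e) x X = X" "dot_comul x X e (e \<otimes>\<^sub>t e) = X"
  using assms by (simp_all add: dot_comul_def tmul_unit)

text \<open>Both bracketings expand to the same five terms: three with one of \<open>X\<close>,
  \<open>Y\<close>, \<open>Z\<close> in its place, minus \<open>x \<otimes> y\<cdot>z\<close> and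
  \<open>x\<cdot>y \<otimes> z\<close>. The correction \<open>x \<otimes> y\<close> of the inner
  product becomes \<open>x \<otimes> y\<cdot>z\<close> after multiplication by
  \<open>1 \<otimes> z\<close>.\<close>

lemma dot_comul_assoc:
  assumes x [simp]: "x \<in> carr B" and y [simp]: "y \<in> carr B" and z [simp]: "z \<in> carr B"
    and X [simp]: "X \<in> carr (tensor B B)" and Y [simp]: "Y \<in> carr (tensor B B)" and Z [simp]: "Z \<in> carr (tensor B B)"
  shows "dot_comul (d x y) (dot_comul x X y Y) z Z = dot_comul x X (d y z) (dot_comul y Y z Z)"
proof -
  note T = is_vspace_tensor[OF B B]
  note b = tensor_mult_bl[OF B d_bl]
  note [simp] = bl_closed[OF b]
  note v = tensor_mult_tens[OF B d_bl]
  note as = tensor_mult_assoc[OF B d_bl ua_assoc[OF d]]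
  have "dot_comul (d x y) (dot_comul x X y Y) z Z
    = (d x y \<otimes>\<^sub>t e) \<odot> Z + ((x \<otimes>\<^sub>t e) \<odot> Y \<odot> (e \<otimes>\<^sub>t z) + X \<odot> (e \<otimes>\<^sub>t y) \<odot> (e \<otimes>\<^sub>t z) - x \<otimes>\<^sub>t (d y z))
      - d x y \<otimes>\<^sub>t z"
    by (simp add: dot_comul_def bl_add_left[OF b] bl_diff_left[OF T b] v)
  also have "(d x y \<otimes>\<^sub>t e) = (x \<otimes>\<^sub>t e) \<odot> (y \<otimes>\<^sub>t e)" by (simp add: v)
  also have "\<dots> \<odot> Z = (x \<otimes>\<^sub>t e) \<odot> ((y \<otimes>\<^sub>t e) \<odot> Z)" by (rule as) auto
  also have "(x \<otimes>\<^sub>t e) \<odot> Y \<odot> (e \<otimes>\<^sub>t z) = (x \<otimes>\<^sub>t e) \<odot> (Y \<odot> (e \<otimes>\<^sub>t z))" by (rule as) auto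
  also have "X \<odot> (e \<otimes>\<^sub>t y) \<odot> (e \<otimes>\<^sub>t z) = X \<odot> ((e \<otimes>\<^sub>t y) \<odot> (e \<otimes>\<^sub>t z))" by (rule as) auto
  also have "(e \<otimes>\<^sub>t y) \<odot> (e \<otimes>\<^sub>t z) = e \<otimes>\<^sub>t (d y z)" by (simp add: v)
  also have "(x \<otimes>\<^sub>t e) \<odot> ((y \<otimes>\<^sub>t e) \<odot> Z) + ((x \<otimes>\<^sub>t e) \<odot> (Y \<odot> (e \<otimes>\<^sub>t z)) + X \<odot> (e \<otimes>\<^sub>t (d y z))
      - x \<otimes>\<^sub>t (d y z)) - d x y \<otimes>\<^sub>t z = dot_comul x X (d y z) (dot_comul y Y z Z)"
    by (simp add: dot_comul_def bl_add_right[OF b] bl_diff_right[OF T b] v)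
  finally show ?thesis .
qed

end

section \<open>The free 2-associative algebra and its quotient \<open>U2\<close>\<close>

text \<open>A tensor product sees only carrier and scalar multiplication, so records that put
  further structure on the same space share their tensor products.\<close>

lemma tensor_cong:
  assumes "carr V = carr V'" "scl V = scl V'" "carr W = carr W'" "scl W = scl W'"
  shows "tensor V W = tensor V' W'" "tens V W = tens V' W'"
  using assms by (auto simp: tensor_def tens_def tensor_rel_cong[OF assms] fun_eq_iff)

locale free_two_as =
  fixes V :: "('k::field, 'v::ab_group_add, 'z) vspace_scheme"
  assumes V [simp]: "is_vspace V"
begin

abbreviation (input) "E \<equiv> free_on (exprs V) :: ('v expr \<Rightarrow>\<^sub>0 'k) set"
abbreviation (input) "FE \<equiv> free_space (exprs V) :: ('k, 'v expr \<Rightarrow>\<^sub>0 'k) vspace"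
abbreviation (input) "I \<equiv> two_as_rel V"
abbreviation (input) "A \<equiv> two_as_space V"
abbreviation (input) "cl \<equiv> coset_rep I"
abbreviation (input) "gn v \<equiv> two_as_class V (EGen v)"
abbreviation (input) "em \<equiv> expr_mult :: ('v expr \<Rightarrow> 'v expr \<Rightarrow> 'v expr) \<Rightarrow> ('v expr \<Rightarrow>\<^sub>0 'k) \<Rightarrow> _"

definition relations :: "('v expr \<Rightarrow>\<^sub>0 'k) set" where
  "relations = {basis (EGen (x + y)) - basis (EGen x) - basis (EGen y) | x y. x \<in> carr V \<and> y \<in> carr V} \<union>
      {basis (EGen (scl V c x)) - pscale c (basis (EGen x)) | c x. x \<in> carr V} \<union>
      (\<Union>op\<in>{EStar, EDot}.
        {basis (op EOne t) - basis t | t. t \<in> exprs V} \<union>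
        {basis (op t EOne) - basis t | t. t \<in> exprs V} \<union>
        {basis (op (op s t) u) - basis (op s (op t u)) | s t u.
           s \<in> exprs V \<and> t \<in> exprs V \<and> u \<in> exprs V})"

lemma relations_intros:
  "x \<in> carr V \<Longrightarrow> y \<in> carr V \<Longrightarrow> basis (EGen (x + y)) - basis (EGen x) - basis (EGen y) \<in> relations"
  "x \<in> carr V \<Longrightarrow> basis (EGen (scl V c x)) - pscale c (basis (EGen x)) \<in> relations"
  "op \<in> {EStar, EDot} \<Longrightarrow> t \<in> exprs V \<Longrightarrow> basis (op EOne t) - basis t \<in> relations"
  "op \<in> {EStar, EDot} \<Longrightarrow> t \<in> exprs V \<Longrightarrow> basis (op t EOne) - basis t \<in> relations"
  "op \<in> {EStar, EDot} \<Longrightarrow> s \<in> exprs V \<Longrightarrow> t \<in> exprs V \<Longrightarrow> u \<in> exprs V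
    \<Longrightarrow> basis (op (op s t) u) - basis (op s (op t u)) \<in> relations"
  unfolding relations_def
  by (rule UnI1, rule UnI1, blast) (rule UnI1, rule UnI2, blast,
      rule UnI2, rule UN_I, assumption, rule UnI1, rule UnI1, blast,
      rule UnI2, rule UN_I, assumption, rule UnI1, rule UnI2, blast,
      rule UnI2, rule UN_I, assumption, rule UnI2, blast)

lemma relations_cases:
  assumes "r \<in> relations"
  obtains (add) x y where "r = basis (EGen (x + y)) - basis (EGen x) - basis (EGen y)" "x \<in> carr V" "y \<in> carr V"
    | (scl) c x where "r = basis (EGen (scl V c x)) - pscale c (basis (EGen x))" "x \<in> carr V"
    | (left) op t where "op \<in> {EStar, EDot}" "r = basis (op EOne t) - basis t" "t \<in> exprs V"
    | (right) op t where "op \<in> {EStar, EDot}" "r = basis (op t EOne) - basis t" "t \<in> exprs V"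
    | (assoc) op s t u where "op \<in> {EStar, EDot}" "r = basis (op (op s t) u) - basis (op s (op t u))"
        "s \<in> exprs V" "t \<in> exprs V" "u \<in> exprs V"
  using assms unfolding relations_def
  apply (elim UnE UN_E)
      apply (elim CollectE exE conjE, rule add, assumption+)
     apply (elim CollectE exE conjE, rule scl, assumption+)
    apply (elim CollectE exE conjE, rule left, assumption+)
   apply (elim CollectE exE conjE, rule right, assumption+)
  apply (elim CollectE exE conjE, rule assoc, assumption+)
  done

lemma ops: "op \<in> {EStar, EDot} \<Longrightarrow> s \<in> exprs V \<Longrightarrow> t \<in> exprs V \<Longrightarrow> op s t \<in> exprs V"
  by auto

lemma relations_sub: "relations \<subseteq> E"
proof
  fix r assume "r \<in> relations"
  then show "r \<in> E"
    by (cases rule: relations_cases) (auto intro!: free_on_simps(3,4) basis_in_free_on)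
qed

lemma I_eq: "I = generated_ideal E (em EStar) (em EDot) relations"
  unfolding two_as_rel_def relations_def ..

lemma em_closed:
  assumes "f \<in> E" "g \<in> E"
  shows "em EStar f g \<in> E" "em EDot f g \<in> E"
  using bl_closed[OF expr_mult_bl[of "exprs V" EStar], of f g]
    bl_closed[OF expr_mult_bl[of "exprs V" EDot], of f g] assms by simp_all

lemma I_ideal: "ideal_of E (em EStar) (em EDot) I"
  unfolding I_eq by (rule ideal_of_generated_ideal[OF relations_sub subspace_free_on em_closed])

lemma relation_in_I: "r \<in> relations \<Longrightarrow> r \<in> I"
  using generated_ideal_sup[of relations E] unfolding I_eq by blast

lemma I_induct:
  assumes "relations \<subseteq> J" "ideal_of E (em EStar) (em EDot) J" "x \<in> I"
  shows "x \<in> J"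
  using generated_ideal_least[OF assms(1,2)] assms(3) unfolding I_eq by blast

lemma op_bl: "op \<in> {EStar, EDot} \<Longrightarrow> bilinear_map FE FE FE (em op)"
  by (rule expr_mult_bl[OF ops])

lemma quot_mult: "op \<in> {EStar, EDot} \<Longrightarrow> quot_mult FE I (em op)"
  using I_ideal op_bl subspace_free_on[of "exprs V"]
  by unfold_locales (auto simp: ideal_of_def)

interpretation S: quot_mult FE I "em EStar"
  by (rule quot_mult) simp

lemma Q_eq: "quotient_space (carr FE) I = A"
  by (simp add: two_as_space_def)

lemma A [simp]: "is_vspace A" and sA [simp]: "scl A = pscale"
  using S.is_vspace_Q S.scl_Q unfolding Q_eq by auto

lemma cl_lm: "linear_map FE A cl"
  using S.rep_lm unfolding Q_eq .

lemma A_sub: "x \<in> carr A \<Longrightarrow> x \<in> E"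
  using S.Q_sub_C unfolding Q_eq by simp

lemma cl_closed [simp]: "f \<in> E \<Longrightarrow> cl f \<in> carr A"
  using S.rep_closed unfolding Q_eq by simp

lemma cl_id: "x \<in> carr A \<Longrightarrow> cl x = x"
  using S.rep_id unfolding Q_eq by simp

lemma class_eq: "two_as_class V t = cl (basis t)"
  by (simp add: two_as_class_def)

lemma class_closed [simp]: "t \<in> exprs V \<Longrightarrow> two_as_class V t \<in> carr A"
  by (simp add: class_eq)

lemma cl_eqI: "f - g \<in> relations \<Longrightarrow> cl f = cl g"
  using relation_in_I coset_rep_eq_iff[OF S.N] by blast

lemma cl_mult: "op \<in> {EStar, EDot} \<Longrightarrow> f \<in> E \<Longrightarrow> g \<in> E \<Longrightarrow> two_as_mult V op (cl f) (cl g) = cl (em op f g)"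
  unfolding two_as_mult_def using quot_mult.mult_rep[OF quot_mult, of op f g] by simp

lemma mult_class: "op \<in> {EStar, EDot} \<Longrightarrow> s \<in> exprs V \<Longrightarrow> t \<in> exprs V
    \<Longrightarrow> two_as_mult V op (two_as_class V s) (two_as_class V t) = two_as_class V (op s t)"
  unfolding class_eq using cl_mult[of op "basis s" "basis t"] by (simp add: expr_mult_basis)

lemma A_bl:
  assumes "op \<in> {EStar, EDot}"
  shows "bilinear_map A A A (two_as_mult V op)"
  using quot_mult.mult_bl[OF quot_mult[OF assms]] unfolding Q_eq two_as_mult_def .

text \<open>On classes of single expressions the laws are relations of the ideal. They spread to all
  of \<open>A\<close> by linearity in one argument at a time.\<close>

lemma A_ua:
  assumes op: "op \<in> {EStar, EDot}"
  shows "unital_associative A (two_as_mult V op) (two_as_class V EOne)"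
  unfolding unital_associative_def
proof (intro conjI ballI)
  let ?m = "two_as_mult V op"
  note b = A_bl[OF op]
  have eqI: "F x = G x" if "x \<in> carr A" "linear_map A A F" "linear_map A A G"
    "\<And>t. t \<in> exprs V \<Longrightarrow> F (two_as_class V t) = G (two_as_class V t)" for F G x
  proof -
    have "F (cl x) = G (cl x)"
      by (rule free_eqI[OF A_sub[OF that(1)] lm_comp[OF cl_lm that(2)] lm_comp[OF cl_lm that(3)]])
        (rule that(4)[unfolded class_eq])
    then show ?thesis unfolding cl_id[OF that(1)] .
  qed
  note c = bl_closed[OF b] 
  have one: "two_as_class V EOne \<in> carr A" by simp
  fix x assume x: "x \<in> carr A"
  show "?m (two_as_class V EOne) x = x"
  proof (rule eqI[OF x bl_right[OF b one] lm_id])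
    fix t assume t: "t \<in> exprs V"
    have "cl (basis (op EOne t)) = cl (basis t)"
      by (rule cl_eqI[OF relations_intros(3)[OF op t]])
    then show "?m (two_as_class V EOne) (two_as_class V t) = two_as_class V t"
      using t op by (simp add: mult_class) (simp add: class_eq)
  qed
  show "?m x (two_as_class V EOne) = x"
  proof (rule eqI[OF x bl_left[OF b one] lm_id])
    fix t assume t: "t \<in> exprs V"
    have "cl (basis (op t EOne)) = cl (basis t)"
      by (rule cl_eqI[OF relations_intros(4)[OF op t]])
    then show "?m (two_as_class V t) (two_as_class V EOne) = two_as_class V t"
      using t op by (simp add: mult_class) (simp add: class_eq)
  qed
  fix y z assume y: "y \<in> carr A" and z: "z \<in> carr A"
  have 1: "?m (?m (two_as_class V s) (two_as_class V t)) z = ?m (two_as_class V s) (?m (two_as_class V t) z)"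
    if s: "s \<in> exprs V" and t: "t \<in> exprs V" for s t
  proof (rule eqI[OF z bl_right[OF b] lm_comp[OF bl_right[OF b] bl_right[OF b]]])
    fix u assume u: "u \<in> exprs V"
    have "cl (basis (op (op s t) u)) = cl (basis (op s (op t u)))"
      by (rule cl_eqI[OF relations_intros(5)[OF op s t u]])
    then show "?m (?m (two_as_class V s) (two_as_class V t)) (two_as_class V u)
      = ?m (two_as_class V s) (?m (two_as_class V t) (two_as_class V u))"
      using s t u op by (simp add: mult_class ops) (auto simp: class_eq)
  qed (use s t c in auto)
  have 2: "?m (?m (two_as_class V s) y) z = ?m (two_as_class V s) (?m y z)" if s: "s \<in> exprs V" for s
    by (rule eqI[OF y lm_comp[OF bl_right[OF b] bl_left[OF b]] lm_comp[OF bl_left[OF b] bl_right[OF b]]])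
      (use s z 1 in auto)
  show "?m (?m x y) z = ?m x (?m y z)"
    by (rule eqI[OF x lm_comp[OF bl_left[OF b] bl_left[OF b]] bl_left[OF b]])
      (use y z c 2 in auto)
qed (use A_bl[OF op] in auto)

abbreviation (input) "stA \<equiv> two_as_mult V EStar"
abbreviation (input) "dA \<equiv> two_as_mult V EDot"
abbreviation (input) "\<I>A \<equiv> two_as_class V EOne"

lemma alg: "two_as_algebra A stA dA \<I>A"
  by (simp add: two_as_algebra_def A_ua)

interpretation al: two_as_algebra A stA dA \<I>A by (rule alg)

abbreviation (input) "comulE \<equiv> lin_ext pscale (expr_comul V)"

lemma expr_comul_closed: "t \<in> exprs V \<Longrightarrow> expr_comul V t \<in> carr (tensor A A)"
  by (induction t) (auto intro!: vs_diff vs_add bl_closed[OF tensor_mult_bl[OF A A_bl]])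

lemma comulE_lm: "linear_map FE (tensor A A) comulE"
  using lin_ext_lm[of "tensor A A" "exprs V" "expr_comul V"] expr_comul_closed by simp

lemma comulE_basis [simp]: "comulE (basis t) = expr_comul V t"
  by (simp add: module_pscale)

lemma expr_comul_dot:
  "expr_comul V (EDot s t) =
    al.dot_comul (two_as_class V s) (expr_comul V s) (two_as_class V t) (expr_comul V t)"
  by (simp add: al.dot_comul_def)

lemma comulE_star: "f \<in> E \<Longrightarrow> g \<in> E \<Longrightarrow> comulE (em EStar f g) = tensor_mult A stA (comulE f) (comulE g)"
  by (rule expr_mult_eqI[OF _ comulE_lm tensor_mult_bl[OF A A_bl] comulE_lm]) auto

lemma comulE_dot:
  assumes "f \<in> E" "g \<in> E"
  shows "comulE (em EDot f g) = tensor_mult A dA (tens A A (cl f) \<I>A) (comulE g)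
    + tensor_mult A dA (comulE f) (tens A A \<I>A (cl g)) - tens A A (cl f) (cl g)"
proof -
  note tb = tensor_mult_bl[OF A A_bl[of EDot]] and te = tens_bl[OF A A]
  have X: "EDot s t \<in> exprs V" if "s \<in> exprs V" "t \<in> exprs V" for s t using that by simp
  have bl: "bilinear_map FE FE (tensor A A) (\<lambda>f g. tensor_mult A dA (tens A A (cl f) \<I>A) (comulE g)
    + tensor_mult A dA (comulE f) (tens A A \<I>A (cl g)) - tens A A (cl f) (cl g))"
    unfolding bilinear_map_def
  proof (intro conjI ballI lm_minus lm_plus)
    fix f assume f: "f \<in> carr FE"
    have c: "tens A A (cl f) \<I>A \<in> carr (tensor A A)" "cl f \<in> carr A" "comulE f \<in> carr (tensor A A)"
      "tens A A \<I>A (cl f) \<in> carr (tensor A A)"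
      using f lm_closed[OF comulE_lm f] by simp_all
    show "linear_map FE (tensor A A) (\<lambda>g. tensor_mult A dA (tens A A (cl f) \<I>A) (comulE g))"
      by (rule lm_comp[OF comulE_lm bl_right[OF tb c(1)]]) simp
    show "linear_map FE (tensor A A) (\<lambda>g. tensor_mult A dA (comulE f) (tens A A \<I>A (cl g)))"
      by (rule lm_comp[OF lm_comp[OF cl_lm bl_right[OF te]] bl_right[OF tb c(3)]]) simp_all
    show "linear_map FE (tensor A A) (\<lambda>g. tens A A (cl f) (cl g))"
      by (rule lm_comp[OF cl_lm bl_right[OF te c(2)]])
    show "linear_map FE (tensor A A) (\<lambda>g. tensor_mult A dA (tens A A (cl g) \<I>A) (comulE f))"
      by (rule lm_comp[OF lm_comp[OF cl_lm bl_left[OF te]] bl_left[OF tb c(3)]]) simp_all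
    show "linear_map FE (tensor A A) (\<lambda>g. tensor_mult A dA (comulE g) (tens A A \<I>A (cl f)))"
      by (rule lm_comp[OF comulE_lm bl_left[OF tb c(4)]]) simp
    show "linear_map FE (tensor A A) (\<lambda>g. tens A A (cl g) (cl f))"
      by (rule lm_comp[OF cl_lm bl_left[OF te c(2)]])
  qed simp_all
  show ?thesis
    by (rule expr_mult_eqI[OF X comulE_lm bl lm_id _ assms]) (auto simp: class_eq)
qed

lemma gn_lm: "linear_map V A gn"
proof (rule linear_mapI)
  have cadd: "cl (f + g) = cl f + cl g" and cscl: "cl (pscale c f) = pscale c (cl f)" for f g c
    by (rule S.rep_add, rule S.rep_pscale)
  show "gn (x + y) = gn x + gn y" if "x \<in> carr V" "y \<in> carr V" for x y
    unfolding class_eq cadd[symmetric]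
    by (rule cl_eqI) (unfold diff_diff_add[symmetric], rule relations_intros(1)[OF that])
  show "gn (scl V c x) = scl A c (gn x)" if "x \<in> carr V" for c x
    unfolding class_eq sA cscl[symmetric]
    by (rule cl_eqI[OF relations_intros(2)[OF that]])
qed simp

text \<open>By \<open>kernel_ideal\<close> it suffices to treat the generating relations. Linearity
  of the generators holds because v\<otimes>1 + 1\<otimes>v is linear in v; the unit and
  associativity relations hold because both product rules for coproducts are unital and
  associative.\<close>

lemma comulE_zero: "f \<in> I \<Longrightarrow> comulE f = 0"
proof -
  have "comult_kernel A stA dA \<I>A FE (em EStar) (em EDot) cl comulE"
    by unfold_locales
      (use op_bl cl_lm comulE_lm cl_mult comulE_star comulE_dot in simp_all)
  from comult_kernel.kernel_ideal[OF this]
  have ideal: "ideal_of E (em EStar) (em EDot) {x \<in> E. cl x = 0 \<and> comulE x = 0}" by simp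
  have "comulE r = 0" if "r \<in> relations" for r
  proof -
    note sub = lm_diff[OF is_vspace_free_space comulE_lm, simplified]
      lm_scl[OF comulE_lm, simplified] lin_ext_diff[OF module_pscale] lin_ext_pscale[OF module_pscale]
    note te = tens_bl[OF A A]
    have tl: "linear_map V (tensor A A) (\<lambda>v. tens A A (gn v) \<I>A + tens A A \<I>A (gn v))"
      by (intro lm_plus lm_comp[OF gn_lm bl_left[OF te]] lm_comp[OF gn_lm bl_right[OF te]]) simp_all
    note cc = expr_comul_closed
    show ?thesis
      using that
    proof (cases rule: relations_cases)
      case (add x y)
      then show ?thesis using lm_add[OF tl, of x y] by (simp add: lin_ext_diff[OF module_pscale])
    next
      case (scl c x)
      then show ?thesis using lm_scl[OF tl, of x c]
        by (simp add: lin_ext_diff[OF module_pscale] lin_ext_pscale[OF module_pscale])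
    next
      case (left op t)
      then have "expr_comul V (op EOne t) = expr_comul V t"
        using al.tmul_unit[OF cc] al.dot_comul_unit[OF class_closed cc, of t t]
        by (auto simp: expr_comul_dot simp del: expr_comul.simps(4))
      then show ?thesis using left by (simp add: lin_ext_diff[OF module_pscale])
    next
      case (right op t)
      then have "expr_comul V (op t EOne) = expr_comul V t"
        using al.tmul_unit[OF cc] al.dot_comul_unit[OF class_closed cc, of t t]
        by (auto simp: expr_comul_dot simp del: expr_comul.simps(4))
      then show ?thesis using right by (simp add: lin_ext_diff[OF module_pscale])
    next
      case (assoc op s t u)
      have "expr_comul V (EStar (EStar s t) u) = expr_comul V (EStar s (EStar t u))"
        using tensor_mult_assoc[OF A A_bl ua_assoc[OF A_ua], of EStar] assoc cc by simp
      moreover have "expr_comul V (EDot (EDot s t) u) = expr_comul V (EDot s (EDot t u))"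
        using al.dot_comul_assoc[of "two_as_class V s" "two_as_class V t" "two_as_class V u"
            "expr_comul V s" "expr_comul V t" "expr_comul V u"] assoc cc
          mult_class[of EDot s t] mult_class[of EDot t u]
        by (simp add: expr_comul_dot del: expr_comul.simps(4))
      ultimately show ?thesis using assoc
        by (auto simp: lin_ext_diff[OF module_pscale] simp del: expr_comul.simps(3,4))
    qed
  qed
  moreover have "cl r = 0" if "r \<in> relations" for r
    by (rule coset_rep_zero[OF S.N relation_in_I[OF that]])
  ultimately have "relations \<subseteq> {x \<in> E. cl x = 0 \<and> comulE x = 0}"
    using relations_sub by auto
  from I_induct[OF this ideal] show "f \<in> I \<Longrightarrow> comulE f = 0" by blast
qed

lemma comulE_cl: "comulE (cl f) = comulE f"
  by (rule lin_ext_coset_rep[OF module_pscale S.N comulE_zero])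

lemma cl_incl: "linear_map A FE (\<lambda>x. x)"
  by (rule linear_mapI) (auto dest: A_sub)

lemma comult: "two_as_comult A stA dA \<I>A comulE"
proof (rule two_as_comult.intro[OF alg], unfold_locales)
  show "linear_map A (tensor A A) comulE" by (rule lm_comp[OF cl_incl comulE_lm])
  show "comulE \<I>A = tens A A \<I>A \<I>A"
    using comulE_cl[of "basis EOne"] by (simp add: class_eq[symmetric])
  fix x y assume x: "x \<in> carr A" and y: "y \<in> carr A"
  have "comulE (two_as_mult V op x y) = comulE (em op x y)" for op
    unfolding two_as_mult_def by (rule comulE_cl)
  then show "comulE (stA x y) = tensor_mult A stA (comulE x) (comulE y)"
    and "comulE (dA x y) = tensor_mult A dA (tens A A x \<I>A) (comulE y)
      + tensor_mult A dA (comulE x) (tens A A \<I>A y) - tens A A x y"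
    using comulE_star[of x y] comulE_dot[of x y] A_sub x y by (simp_all add: cl_id)
qed

lemma gn_prim:
  assumes "v \<in> carr V"
  shows "two_as_comult.prim A \<I>A comulE (gn v)"
  unfolding two_as_comult.prim_def[OF comult] using assms comulE_cl[of "basis (EGen v)"]
  by (simp add: class_eq[of "EGen v", symmetric])

lemma two_as_sel [simp]:
  "carr (two_as V) = carr A" "scl (two_as V) = pscale" "comul (two_as V) = comulE"
  "counit (two_as V) = lin_ext (*) expr_counit" "one (two_as V) = \<I>A"
  "star (two_as V) = stA" "dot (two_as V) = dA"
  by (simp_all add: two_as_def)

end

section \<open>The quotient \<open>U2\<close> and its coproduct\<close>

lemma (in quot_mult) quot_ua:
  assumes ua: "unital_associative W m e"
  shows "unital_associative Q (\<lambda>x y. coset_rep N (m x y)) (coset_rep N e)"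
proof -
  note c = bl_closed[OF m] ua_unit[OF ua]
  have r: "coset_rep N (m (coset_rep N f) x) = coset_rep N (m f x)"
    "coset_rep N (m x (coset_rep N f)) = coset_rep N (m x f)"
    if "f \<in> carr W" "x \<in> carr Q" for f x
    using mult_rep[of f x] mult_rep[of x f] that Q_sub_C[OF that(2)] rep_id[OF that(2)] by simp_all
  show ?thesis
    unfolding unital_associative_def
  proof (intro conjI ballI)
    fix x assume x: "x \<in> carr Q"
    note xW = Q_sub_C[OF x]
    show "coset_rep N (m (coset_rep N e) x) = x" "coset_rep N (m x (coset_rep N e)) = x"
      using r[OF c(2) x] ua_left[OF ua xW] ua_right[OF ua xW] rep_id[OF x] by simp_all
    fix y z assume y: "y \<in> carr Q" and z: "z \<in> carr Q"
    show "coset_rep N (m (coset_rep N (m x y)) z) = coset_rep N (m x (coset_rep N (m y z)))"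
      using r(1)[OF c(1)[OF xW Q_sub_C[OF y]] z] r(2)[OF c(1)[OF Q_sub_C[OF y] Q_sub_C[OF z]] x]
        ua_assoc[OF ua xW Q_sub_C[OF y] Q_sub_C[OF z]] by simp
  qed (use mult_bl c in auto)
qed

locale binf =
  fixes R :: "('k::field, 'v::ab_group_add, 'z) Binf_scheme"
  assumes R: "is_vspace R"
    and Mop_closed: "\<And>rs ss. rs \<in> lists (carr R) \<Longrightarrow> ss \<in> lists (carr R) \<Longrightarrow> Mop R rs ss \<in> carr R"
begin

sublocale free_two_as R
  by unfold_locales (rule R)

interpretation al: two_as_algebra A stA dA \<I>A by (rule alg)
interpretation ca: two_as_comult A stA dA \<I>A comulE by (rule comult)

abbreviation (input) "J \<equiv> U2_ideal R"
abbreviation (input) "\<pi> \<equiv> coset_rep J"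
abbreviation (input) "U \<equiv> quotient_space (carr A) J"

definition U2_relations where
  "U2_relations = {gn (Mop R rs ss) - M_op stA dA (map gn rs) (map gn ss) | rs ss.
           rs \<in> lists (carr R) \<and> ss \<in> lists (carr R)}"

lemma J_eq: "J = generated_ideal (carr A) stA dA U2_relations"
  by (simp add: U2_ideal_def U2_relations_def Binf_of_def Let_def)

lemma gn_lists: "rs \<in> lists (carr R) \<Longrightarrow> map gn rs \<in> lists (carr A)"
  using lm_closed[OF gn_lm] by auto

lemma U2_relations_sub: "U2_relations \<subseteq> carr A"
  unfolding U2_relations_def
  using lm_closed[OF gn_lm Mop_closed] al.M_closed[OF gn_lists gn_lists] by (auto simp: in_lists_conv_set)

lemma J_ideal: "ideal_of (carr A) stA dA J"
  unfolding J_eq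
  by (rule ideal_of_generated_ideal[OF U2_relations_sub]) (use is_vspace_subspace[OF A] in auto)

lemma quot_mult_U: "op \<in> {EStar, EDot} \<Longrightarrow> quot_mult A J (two_as_mult R op)"
  using J_ideal A_bl is_vspace_subspace[OF A]
  by unfold_locales (auto simp: ideal_of_def)

interpretation S: quot_mult A J stA by (rule quot_mult_U) simp

lemma U [simp]: "is_vspace U" and sU [simp]: "scl U = pscale"
  by (rule S.is_vspace_Q, rule S.scl_Q)

lemma pi_lm: "linear_map A U \<pi>"
  by (rule S.rep_lm)

lemma pi_id: "x \<in> carr U \<Longrightarrow> \<pi> x = x"
  by (rule S.rep_id)

lemma U_sub: "x \<in> carr U \<Longrightarrow> x \<in> carr A"
  by (rule S.Q_sub_C)

lemma pi_closed [simp]: "x \<in> carr A \<Longrightarrow> \<pi> x \<in> carr U"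
  by (rule S.rep_closed)

abbreviation (input) "stU \<equiv> \<lambda>x y. \<pi> (stA x y)"
abbreviation (input) "dU \<equiv> \<lambda>x y. \<pi> (dA x y)"
abbreviation (input) "\<I>U \<equiv> \<pi> \<I>A"
abbreviation (input) "comulU \<equiv> \<lambda>x. tensor_map U U \<pi> \<pi> (comulE x)"

lemma algU: "two_as_algebra U stU dU \<I>U"
  using quot_mult.quot_ua[OF quot_mult_U A_ua] by (simp add: two_as_algebra_def)

interpretation au: two_as_algebra U stU dU \<I>U by (rule algU)

lemma pi_mult:
  assumes "x \<in> carr A" "y \<in> carr A"
  shows "\<pi> (stA x y) = stU (\<pi> x) (\<pi> y)" "\<pi> (dA x y) = dU (\<pi> x) (\<pi> y)"
  using quot_mult.mult_rep[OF quot_mult_U, of EStar x y] quot_mult.mult_rep[OF quot_mult_U, of EDot x y]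
    assms by simp_all

lemma pi_tensor_lm: "linear_map (tensor A A) (tensor U U) (tensor_map U U \<pi> \<pi>)"
  by (rule tensor_map_lm[OF A A U U pi_lm pi_lm])

lemmas pi_tens = tensor_map_tens[OF A A U U pi_lm pi_lm]

lemma comulU_lm: "linear_map A (tensor U U) comulU"
  by (rule lm_comp[OF ca.D pi_tensor_lm])

lemma J_kernel: "ideal_of (carr A) stA dA {x \<in> carr A. \<pi> x = 0 \<and> comulU x = 0}"
proof (rule comult_kernel.kernel_ideal[of U stU dU \<I>U])
  note mm = tensor_map_mult[OF A U _ _ pi_lm]
  show "comult_kernel U stU dU \<I>U A stA dA \<pi> comulU"
  proof (rule comult_kernel.intro[OF algU], unfold_locales)
    fix x y assume x [simp]: "x \<in> carr A" and y [simp]: "y \<in> carr A"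
    show "comulU (stA x y) = tensor_mult U stU (comulU x) (comulU y)"
      unfolding ca.D_st[OF x y]
      by (rule mm[OF A_bl au.st_bl]) (use pi_mult x y ca.D_closed in auto)
    have m: "tensor_map U U \<pi> \<pi> (tensor_mult A dA X Y)
      = tensor_mult U dU (tensor_map U U \<pi> \<pi> X) (tensor_map U U \<pi> \<pi> Y)"
      if "X \<in> carr (tensor A A)" "Y \<in> carr (tensor A A)" for X Y
      by (rule mm[OF A_bl au.d_bl]) (use pi_mult that in auto)
    note c = bl_closed[OF ca.tmb_d]
    show "comulU (dA x y) = tensor_mult U dU (tens U U (\<pi> x) \<I>U) (comulU y)
      + tensor_mult U dU (comulU x) (tens U U \<I>U (\<pi> y)) - tens U U (\<pi> x) (\<pi> y)"
      unfolding ca.D_d[OF x y]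
      by (simp add: lm_diff[OF _ pi_tensor_lm] lm_add[OF pi_tensor_lm] c m pi_tens)
  qed (use A_bl pi_lm comulU_lm pi_mult in auto)
qed

lemma gn_prims: "rs \<in> lists (carr R) \<Longrightarrow> map gn rs \<in> lists (Collect ca.prim)"
  using gn_prim by auto

lemma pi_relation: "z \<in> U2_relations \<Longrightarrow> \<pi> z = 0"
  using generated_ideal_sup[of U2_relations "carr A" stA dA] coset_rep_zero[OF S.N]
  unfolding J_eq[symmetric] by blast

text \<open>A generating relation is the difference of a generator and an operation \<open>M\<close>
  on generators. Both are primitive, the latter by \<open>M_prim\<close>, so its coproduct is
  z\<otimes>1 + 1\<otimes>z, and this vanishes once z is sent to zero in \<open>U\<close>.\<close>

lemma comulU_zero: "x \<in> J \<Longrightarrow> comulU x = 0"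
proof -
  have "comulU z = 0" if z: "z \<in> U2_relations" for z
  proof -
    obtain rs ss where zz: "z = gn (Mop R rs ss) - M_op stA dA (map gn rs) (map gn ss)"
      and l: "rs \<in> lists (carr R)" "ss \<in> lists (carr R)"
      using z unfolding U2_relations_def by blast
    have "ca.prim z"
      unfolding zz
      using module.subspace_diff[OF is_vspace_module[OF A] ca.subspace_prim]
        gn_prim[OF Mop_closed[OF l]] ca.M_prim[OF gn_prims gn_prims, OF l] by simp
    then have "z \<in> carr A" "comulE z = tens A A z \<I>A + tens A A \<I>A z"
      by (simp_all add: ca.prim_def)
    then show ?thesis
      using pi_relation[OF z] by (simp add: lm_add[OF pi_tensor_lm] pi_tens
          bl_zero_left[OF U tens_bl[OF U U]] bl_zero_right[OF U tens_bl[OF U U]])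
  qed
  then have "U2_relations \<subseteq> {x \<in> carr A. \<pi> x = 0 \<and> comulU x = 0}"
    using U2_relations_sub pi_relation by blast
  from generated_ideal_least[OF this J_kernel] show "x \<in> J \<Longrightarrow> comulU x = 0"
    unfolding J_eq by blast
qed

lemma comulU_pi:
  assumes x: "x \<in> carr A"
  shows "comulU (\<pi> x) = comulU x"
proof -
  have "\<pi> x \<in> carr A" by (rule U_sub[OF pi_closed[OF x]])
  then have "comulU (\<pi> x) - comulU x = comulU (\<pi> x - x)" using lm_diff[OF A comulU_lm _ x] by simp
  also have "\<dots> = 0" by (rule comulU_zero[OF coset_rep_in_coset[OF S.N]])
  finally show ?thesis by simp
qed

abbreviation (input) "gU \<equiv> \<lambda>r. \<pi> (gn r)"

lemma gU_lm: "linear_map R U gU"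
  by (rule lm_comp[OF gn_lm pi_lm])

lemma comulU_gU: "r \<in> carr R \<Longrightarrow> comulU (gU r) = tens U U (gU r) \<I>U + tens U U \<I>U (gU r)"
  using gn_prim[of r] comulU_pi[of "gn r"]
  by (simp add: ca.prim_def lm_add[OF pi_tensor_lm] pi_tens)

text \<open>The defining relations identify the operation of \<open>R\<close> with that of
  \<open>2as(R)\<close> on generators, and \<open>\<pi>\<close>, being a homomorphism, carries the
  latter to the operation of \<open>U2\<close> formed with its own two products.\<close>

lemma gU_Mop:
  assumes rs: "rs \<in> lists (carr R)" and ss: "ss \<in> lists (carr R)"
  shows "gU (Mop R rs ss) = M_op stU dU (map gU rs) (map gU ss)"
proof -
  have "gn (Mop R rs ss) - M_op stA dA (map gn rs) (map gn ss) \<in> U2_relations"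
    unfolding U2_relations_def using rs ss by blast
  then have "gU (Mop R rs ss) = \<pi> (M_op stA dA (map gn rs) (map gn ss))"
    using pi_relation lm_diff[OF A pi_lm lm_closed[OF gn_lm Mop_closed[OF rs ss]]
        al.M_closed[OF gn_lists[OF rs] gn_lists[OF ss]]] by simp
  also have "\<dots> = M_op stU dU (map \<pi> (map gn rs)) (map \<pi> (map gn ss))"
    by (rule M_op_hom[OF A U A_bl A_bl pi_lm]) (use pi_mult gn_lists rs ss in auto)
  finally show ?thesis by (simp add: o_def)
qed

section \<open>Words in the generators exhaust \<open>U2\<close>\<close>

definition words_U :: "('v list \<Rightarrow>\<^sub>0 'k) \<Rightarrow> ('v expr \<Rightarrow>\<^sub>0 'k)" where
  "words_U = lin_ext pscale (\<lambda>rs. au.dp (map gU rs))"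

abbreviation (input) "TR \<equiv> word_space R"

lemma words_U_lm: "linear_map TR U words_U"
  unfolding words_U_def by (rule word_lift_lm[OF R U sU au.dp_ml[OF gU_lm]])

lemma words_U_word: "rs \<in> lists (carr R) \<Longrightarrow> words_U (word R rs) = au.dp (map gU rs)"
  unfolding words_U_def by (rule word_lift[OF R U sU au.dp_ml[OF gU_lm]])

lemma gU_lists: "rs \<in> lists (carr R) \<Longrightarrow> map gU rs \<in> lists (carr U)"
  using lm_closed[OF gU_lm] by auto

lemma words_U_dot:
  assumes X: "X \<in> carr TR" and Y: "Y \<in> carr TR"
  shows "words_U (wcat R X Y) = dU (words_U X) (words_U Y)"
proof -
  note l = bl_lm[OF wcat_bl[OF R] words_U_lm] and r = bl_comp[OF au.d_bl words_U_lm words_U_lm]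
  have "words_U (wcat R (word R us) Y) = dU (words_U (word R us)) (words_U Y)"
    if us: "us \<in> lists (carr R)" for us
    by (rule word_eqI[OF R Y bl_right[OF l] bl_right[OF r]])
      (use us in \<open>simp_all add: wcat_word words_U_word au.dp_append[OF gU_lists gU_lists] word_closed R\<close>)
  then show ?thesis
    by (intro word_eqI[OF R X bl_left[OF l] bl_left[OF r]]) (use Y in auto)
qed

text \<open>For two words \<open>st_dp\<close> expands the product \<open>*\<close> over cuttings;
  by \<open>gU_Mop\<close> each piece is the image of a single element of \<open>R\<close>, so each
  cutting yields a word in generators again. The general case follows since the image of
  \<open>words_U\<close> is a subspace.\<close>

lemma words_U_star:
  assumes X: "X \<in> carr TR" and Y: "Y \<in> carr TR"
  shows "stU (words_U X) (words_U Y) \<in> words_U ` carr TR"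
proof -
  note r = bl_comp[OF au.st_bl words_U_lm words_U_lm]
  have im: "is_vspace \<lparr>carr = words_U ` carr TR, scl = pscale\<rparr>"
  proof (rule is_vspaceI_pscale)
    have "x + y \<in> words_U ` carr TR" if "x \<in> words_U ` carr TR" "y \<in> words_U ` carr TR" for x y
    proof -
      from that obtain X Y where "X \<in> carr TR" "Y \<in> carr TR" "x = words_U X" "y = words_U Y" by blast
      then show ?thesis using lm_add[OF words_U_lm, of X Y]
          imageI[OF vs_add[OF is_vspace_word_space[OF R]], of X Y words_U] by simp
    qed
    moreover have "pscale c x \<in> words_U ` carr TR" if "x \<in> words_U ` carr TR" for c x
    proof -
      from that obtain X where "X \<in> carr TR" "x = words_U X" by blast
      then show ?thesis using lm_scl[OF words_U_lm, of X c]
          imageI[OF vs_scl[OF is_vspace_word_space[OF R]], of X words_U c] by simp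
    qed
    moreover have "0 \<in> words_U ` carr TR"
      using imageI[OF vs_zero[OF is_vspace_word_space[OF R]], of words_U]
        lm_zero[OF is_vspace_word_space[OF R] words_U_lm] by simp
    ultimately show "module.subspace pscale (carr \<lparr>carr = words_U ` carr TR, scl = pscale\<rparr>)"
      by (simp add: subspace_pscale_iff)
  qed simp
  note im = vs_zero[OF im, simplified] vs_add[OF im, simplified] vs_scl[OF im, simplified]
    vs_sum[OF im, simplified]
  have words: "stU (words_U (word R us)) (words_U (word R vs)) \<in> words_U ` carr TR"
    if us: "us \<in> lists (carr R)" and vs: "vs \<in> lists (carr R)" for us vs
  proof -
    let ?m = "\<lambda>ps. map (\<lambda>p. Mop R (fst p) (snd p)) ps"
    have m: "?m ps \<in> lists (carr R)" if "ps \<in> cuttings us vs" for ps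
      using cuttings_lists[OF that us vs] Mop_closed by (auto simp: in_lists_conv_set)
    have "stU (words_U (word R us)) (words_U (word R vs))
      = (\<Sum>ps\<in>cuttings (map gU us) (map gU vs). au.dp (au.Mc ps))"
      unfolding words_U_word[OF us] words_U_word[OF vs] by (rule au.st_dp[OF gU_lists[OF us] gU_lists[OF vs]])
    also have "\<dots> = (\<Sum>ps\<in>cuttings us vs. au.dp (au.Mc (map (\<lambda>p. (map gU (fst p), map gU (snd p))) ps)))"
      by (rule sum_cuttings_map)
    also have "\<dots> = (\<Sum>ps\<in>cuttings us vs. words_U (word R (?m ps)))"
    proof (rule sum.cong[OF refl])
      fix ps assume ps: "ps \<in> cuttings us vs"
      have "au.Mc (map (\<lambda>p. (map gU (fst p), map gU (snd p))) ps) = map gU (?m ps)"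
        using gU_Mop[OF cuttings_lists[OF ps us vs]] by auto
      then show "au.dp (au.Mc (map (\<lambda>p. (map gU (fst p), map gU (snd p))) ps)) = words_U (word R (?m ps))"
        unfolding words_U_word[OF m[OF ps]] by (rule arg_cong)
    qed
    also have "\<dots> \<in> words_U ` carr TR"
      by (rule im(4)) (use word_closed[OF R m] in blast)
    finally show ?thesis .
  qed
  have 1: "stU (words_U (word R us)) (words_U Y) \<in> words_U ` carr TR" if us: "us \<in> lists (carr R)" for us
    using Y
  proof (rule word_induct[OF R], goal_cases)
    case 1
    then show ?case using bl_zero_right[OF is_vspace_word_space[OF R] r word_closed[OF R us]] im(1) by simp
  next
    case (2 c vs)
    then show ?case
      using bl_scl_right[OF r word_closed[OF R us] word_closed[OF R], of vs c] im(3)[OF words[OF us]] by simp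
  next
    case (3 X Y)
    then show ?case using bl_add_right[OF r word_closed[OF R us], of X Y] im(2) by simp
  qed
  show ?thesis
    using X
  proof (rule word_induct[OF R], goal_cases)
    case 1
    then show ?case using bl_zero_left[OF is_vspace_word_space[OF R] r Y] im(1) by simp
  next
    case (2 c vs)
    then show ?case
      using bl_scl_left[OF r word_closed[OF R] Y, of vs c] im(3)[OF 1] by simp
  next
    case (3 X X')
    then show ?case using bl_add_left[OF r, of X X' Y] Y im(2) by simp
  qed
qed

text \<open>The image contains the unit and the generators and is closed under both products, hence
  contains the class of every expression, by induction on expressions.\<close>

lemma words_U_surj: "x \<in> carr U \<Longrightarrow> x \<in> words_U ` carr TR"
proof -
  have ex: "\<pi> (two_as_class R t) \<in> words_U ` carr TR" if "t \<in> exprs R" for t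
    using that
  proof (induction t)
    case EOne
    have "words_U (word R []) = \<I>U" by (simp add: words_U_word)
    then show ?case using imageI[OF word_closed[OF R], of "[]" words_U] by simp
  next
    case (EGen r)
    then have r: "r \<in> carr R" by simp
    then have "words_U (word R [r]) = gU r"
      using lm_closed[OF gU_lm r] by (simp add: words_U_word)
    then show ?case using imageI[OF word_closed[OF R], of "[r]" words_U] r by simp
  next
    case (EStar s t)
    then obtain X Y where "X \<in> carr TR" "Y \<in> carr TR" "\<pi> (two_as_class R s) = words_U X"
      "\<pi> (two_as_class R t) = words_U Y" by auto
    then show ?case
      using words_U_star[of X Y] EStar.prems mult_class[of EStar s t]
        pi_mult(1)[of "two_as_class R s" "two_as_class R t"] by simp
  next
    case (EDot s t)
    then obtain X Y where XY: "X \<in> carr TR" "Y \<in> carr TR" "\<pi> (two_as_class R s) = words_U X"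
      "\<pi> (two_as_class R t) = words_U Y" by auto
    have "\<pi> (two_as_class R (EDot s t)) = words_U (wcat R X Y)"
      using words_U_dot[of X Y] XY EDot.prems mult_class[of EDot s t]
        pi_mult(2)[of "two_as_class R s" "two_as_class R t"] by simp
    then show ?case using imageI[OF bl_closed[OF wcat_bl[OF R] XY(1,2)], of words_U] by simp
  qed
  have fr: "\<exists>X\<in>carr TR. \<pi> (cl f) = words_U X" if "f \<in> E" for f
    using that
  proof (induction f rule: free_on_induct)
    case zero
    have "\<pi> (cl 0) = 0" using lm_zero[OF is_vspace_free_space lm_comp[OF cl_lm pi_lm]] .
    then show ?case using lm_zero[OF is_vspace_word_space[OF R] words_U_lm] vs_zero[OF is_vspace_word_space[OF R]]
      by metis
  next
    case (basis c t)
    then obtain X where X: "X \<in> carr TR" "\<pi> (two_as_class R t) = words_U X" using ex by blast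
    have "\<pi> (cl (pscale c (basis t))) = pscale c (\<pi> (cl (basis t)))"
      using lm_scl[OF lm_comp[OF cl_lm pi_lm], of "basis t" c] basis by simp
    also have "\<dots> = words_U (pscale c X)"
      using lm_scl[OF words_U_lm X(1), of c] X(2) by (simp add: class_eq)
    finally show ?case using vs_scl[OF is_vspace_word_space[OF R] X(1), of c] by auto
  next
    case (add f g)
    then obtain X Y where X: "X \<in> carr TR" "\<pi> (cl f) = words_U X" and Y: "Y \<in> carr TR" "\<pi> (cl g) = words_U Y"
      by blast
    have "\<pi> (cl (f + g)) = words_U (X + Y)"
      using lm_add[OF lm_comp[OF cl_lm pi_lm], of f g] add.hyps X Y lm_add[OF words_U_lm, of X Y] by simp
    then show ?case using vs_add[OF is_vspace_word_space[OF R] X(1) Y(1)] by blast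
  qed
  assume x: "x \<in> carr U"
  then obtain X where "X \<in> carr TR" "\<pi> (cl x) = words_U X" using fr[OF A_sub[OF U_sub[OF x]]] by blast
  then show ?thesis using pi_id[OF x] cl_id[OF U_sub[OF x]] by auto
qed

lemma U2_sel [simp]:
  "carr (U2 R) = carr U" "scl (U2 R) = pscale" "comul (U2 R) = comulU"
  "counit (U2 R) = lin_ext (*) expr_counit" "one (U2 R) = \<I>U" "star (U2 R) = stU" "dot (U2 R) = dU"
  by (simp_all add: U2_def Let_def)

lemma U2_tens [simp]: "tensor (U2 R) (U2 R) = tensor U U" "tens (U2 R) (U2 R) = tens U U"
  by (rule tensor_cong; simp)+

end

lemma word_cong:
  assumes "carr V = carr V'" "scl V = scl V'"
  shows "word_space V = word_space V'" "word V = word V'"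
proof -
  have "word_rel V = word_rel V'" using assms by (simp add: word_rel_def)
  then show "word_space V = word_space V'" "word V = word V'"
    using assms by (auto simp: word_space_def word_def fun_eq_iff)
qed

section \<open>Connected 2-associative bialgebras are enveloping algebras\<close>

context two_as_bialgebra
begin

abbreviation (input) "R \<equiv> Prim_Binf H"

lemma R_sel: "carr R = Collect prim" "scl R = scl H" "Mop R = M"
  by (simp_all add: Prim_Binf_def Binf_of_def carr_Prim)

text \<open>The tensor coalgebra is built on \<open>Prim H\<close> and \<open>U2\<close> on the
  record that also carries the operations; the two are different records on the same space.\<close>

lemma R_words: "word_space R = word_space (Prim H)" "word R = word (Prim H)"
  by (rule word_cong; simp add: R_sel carr_Prim)+

text \<open>Closure of the primitive elements under the operations is \<open>M_prim\<close>; it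
  makes \<open>Prim_Binf H\<close> a legitimate argument of \<open>U2\<close>.\<close>

lemma R_binf: "binf R"
proof
  show "is_vspace R" using is_vspace_Prim unfolding is_vspace_def R_sel scl_Prim carr_Prim .
qed (use M_prim in \<open>simp add: R_sel\<close>)

interpretation b: binf R by (rule R_binf)

interpretation au: two_as_algebra b.U b.stU b.dU b.\<I>U by (rule b.algU)

text \<open>Evaluation of formal expressions in \<open>H\<close>. Its linear extension
  \<open>ev\<close> induces the canonical morphism from \<open>U2(Prim H)\<close> to
  \<open>H\<close>.\<close>

primrec eval :: "'v expr \<Rightarrow> 'v" where
  "eval EOne = \<I>"
| "eval (EGen v) = v"
| "eval (EStar s u) = star H (eval s) (eval u)"
| "eval (EDot s u) = dot H (eval s) (eval u)"

lemma eval_closed [simp]: "s \<in> exprs R \<Longrightarrow> eval s \<in> carr H"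
  by (induction s) (auto simp: R_sel prim_closed)

abbreviation (input) "ev \<equiv> lin_ext (scl H) eval"

lemma ev_lm: "linear_map b.FE H ev"
  using lin_ext_lm[OF B, of "exprs R" eval] by simp

lemma ev_basis [simp]: "ev (basis s) = eval s"
  by (simp add: is_vspaceD(2))

lemma ev_mult:
  assumes "f \<in> b.E" "g \<in> b.E"
  shows "ev (expr_mult EStar f g) = star H (ev f) (ev g)" "ev (expr_mult EDot f g) = dot H (ev f) (ev g)"
  by (rule expr_mult_eqI[OF _ ev_lm st_bl ev_lm _ assms], simp_all)
    (rule expr_mult_eqI[OF _ ev_lm d_bl ev_lm _ assms], simp_all)

text \<open>Used for both quotients on the way to \<open>U2\<close>: the space of formal expressions
  and the free 2-associative algebra.\<close>

lemma kernel_ideal: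
  assumes W: "is_vspace W" "scl W = pscale" and st: "bilinear_map W W W st" and d: "bilinear_map W W W d"
    and h: "linear_map W H h"
    and "\<And>x y. x \<in> carr W \<Longrightarrow> y \<in> carr W \<Longrightarrow> h (st x y) = star H (h x) (h y)"
    and "\<And>x y. x \<in> carr W \<Longrightarrow> y \<in> carr W \<Longrightarrow> h (d x y) = dot H (h x) (h y)"
  shows "ideal_of (carr W) st d {x \<in> carr W. h x = 0}"
proof -
  have "module.subspace pscale {x \<in> carr W. h x = 0}"
    unfolding subspace_pscale_iff
    using vs_scl[OF W(1)] lm_scl[OF h] W(2) by (auto simp: W lm_zero[OF W(1) h] lm_add[OF h])
  then show ?thesis
    using lm_closed[OF h]
    by (auto simp: ideal_of_def assms bl_closed[OF st] bl_closed[OF d]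
        bl_zero_left[OF B st_bl] bl_zero_left[OF B d_bl] bl_zero_right[OF B st_bl] bl_zero_right[OF B d_bl])
qed

lemma ev_I: "f \<in> b.I \<Longrightarrow> ev f = 0"
proof -
  note m = is_vspaceD(2)[OF B]
  have "ev r = 0" if "r \<in> b.relations" for r
    using that
  proof (cases rule: b.relations_cases)
    case (add x y)
    then show ?thesis by (simp add: lin_ext_diff[OF m])
  next
    case (scl c x)
    then show ?thesis by (simp add: lin_ext_diff[OF m] lin_ext_pscale[OF m] R_sel)
  next
    case (left op s)
    then show ?thesis by (auto simp: lin_ext_diff[OF m])
  next
    case (right op s)
    then show ?thesis by (auto simp: lin_ext_diff[OF m])
  next
    case (assoc op s s' u)
    then show ?thesis by (auto simp: lin_ext_diff[OF m] ua_assoc[OF st] ua_assoc[OF d])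
  qed
  then have "b.relations \<subseteq> {f \<in> b.E. ev f = 0}" using b.relations_sub by blast
  moreover have "ideal_of b.E (expr_mult EStar) (expr_mult EDot) {f \<in> b.E. ev f = 0}"
    using kernel_ideal[OF _ _ b.op_bl b.op_bl ev_lm, of EStar EDot] ev_mult by simp
  ultimately show "f \<in> b.I \<Longrightarrow> ev f = 0" using b.I_induct by blast
qed

lemma subspace_I: "module.subspace pscale b.I" and subspace_J: "module.subspace pscale b.J"
  using b.I_ideal b.J_ideal by (auto simp: ideal_of_def)

text \<open>Choosing representatives does not change \<open>ev\<close>, so the same function serves
  on formal sums, on \<open>2as\<close> and, through \<open>ev_pi\<close>, on
  \<open>U2\<close>.\<close>

lemma ev_cl: "ev (b.cl f) = ev f"
  by (rule lin_ext_coset_rep[OF is_vspaceD(2)[OF B] subspace_I ev_I])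

lemma ev_A_lm: "linear_map b.A H ev"
  using lm_comp[OF b.cl_incl ev_lm] .

lemma ev_A_mult:
  assumes "x \<in> carr b.A" "y \<in> carr b.A"
  shows "ev (b.stA x y) = star H (ev x) (ev y)" "ev (b.dA x y) = dot H (ev x) (ev y)"
  using ev_mult[OF b.A_sub[OF assms(1)] b.A_sub[OF assms(2)]] by (simp_all add: two_as_mult_def ev_cl)

lemma ev_gn: "ev (b.gn v) = v"
  by (simp add: b.class_eq ev_cl)

text \<open>Being a homomorphism, \<open>ev\<close> takes the operation of \<open>2as\<close> on
  generators to the operation of \<open>H\<close> on the elements themselves, and this is by
  definition the operation of \<open>Prim_Binf H\<close>. Both sides of a relation therefore have
  the same value.\<close>

lemma ev_J: "x \<in> b.J \<Longrightarrow> ev x = 0"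
proof -
  have "ev z = 0" if z: "z \<in> b.U2_relations" for z
  proof -
    obtain rs ss where zz: "z = b.gn (Mop R rs ss) - M_op b.stA b.dA (map b.gn rs) (map b.gn ss)"
      and l: "rs \<in> lists (carr R)" "ss \<in> lists (carr R)"
      using z unfolding b.U2_relations_def by blast
    have "ev (M_op b.stA b.dA (map b.gn rs) (map b.gn ss)) = M (map ev (map b.gn rs)) (map ev (map b.gn ss))"
      by (rule M_op_hom[OF b.A B b.A_bl b.A_bl ev_A_lm])
        (use ev_A_mult b.gn_lists l in auto)
    then show ?thesis
      by (simp add: zz lin_ext_diff[OF is_vspaceD(2)[OF B]] ev_gn o_def R_sel)
  qed
  then have "b.U2_relations \<subseteq> {x \<in> carr b.A. ev x = 0}" using b.U2_relations_sub by blast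
  moreover have "ideal_of (carr b.A) b.stA b.dA {x \<in> carr b.A. ev x = 0}"
    by (rule kernel_ideal[OF _ _ b.A_bl b.A_bl ev_A_lm]) (use ev_A_mult in auto)
  ultimately show "x \<in> b.J \<Longrightarrow> ev x = 0"
    using generated_ideal_least unfolding b.J_eq by blast
qed

lemma ev_pi: "ev (b.\<pi> x) = ev x"
  by (rule lin_ext_coset_rep[OF is_vspaceD(2)[OF B] subspace_J ev_J])

lemma U_incl: "linear_map b.U b.A (\<lambda>x. x)"
  by (rule linear_mapI) (auto dest: b.U_sub)

lemma ev_U_lm: "linear_map b.U H ev"
  using lm_comp[OF U_incl ev_A_lm] .

lemma ev_U_mult:
  assumes "x \<in> carr b.U" "y \<in> carr b.U"
  shows "ev (b.stU x y) = star H (ev x) (ev y)" "ev (b.dU x y) = dot H (ev x) (ev y)"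
  using ev_A_mult[OF b.U_sub[OF assms(1)] b.U_sub[OF assms(2)]] by (simp_all add: ev_pi)

lemma ev_one: "ev b.\<I>U = \<I>"
  by (simp add: ev_pi b.class_eq ev_cl)

lemma ev_counit: "f \<in> b.E \<Longrightarrow> \<epsilon> (ev f) = lin_ext (*) expr_counit f"
proof (rule free_eqI[OF _ lm_comp[OF ev_lm eps]])
  show "linear_map b.FE ground_field (lin_ext (*) expr_counit)"
    using lin_ext_lm[OF is_vspace_ground_field, of "exprs R" expr_counit] by simp
  fix s assume "s \<in> exprs R"
  then have "\<epsilon> (eval s) = expr_counit s"
    by (induction s) (auto simp: eps_one eps_prim R_sel eps_star eps_dot)
  moreover have "module ((*) :: 'k \<Rightarrow> 'k \<Rightarrow> 'k)" using is_vspaceD(2)[OF is_vspace_ground_field] by simp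
  ultimately show "\<epsilon> (ev (basis s)) = lin_ext (*) expr_counit (basis s)" by simp
qed

text \<open>\<open>expr_comul\<close> recurses by the very rules that the coproduct of
  \<open>H\<close> obeys on the unit, on primitive elements and on both products, so induction on
  expressions matches them clause by clause.\<close>

lemma ev_comulE:
  assumes "f \<in> b.E"
  shows "tensor_map H H ev ev (b.comulE f) = comul H (ev f)"
proof (rule free_eqI[OF assms])
  note tl = tensor_map_lm[OF b.A b.A B B ev_A_lm ev_A_lm]
  note tt = tensor_map_tens[OF b.A b.A B B ev_A_lm ev_A_lm]
  have tm: "tensor_map H H ev ev (tensor_mult b.A b.stA X Y)
      = tensor_mult H (star H) (tensor_map H H ev ev X) (tensor_map H H ev ev Y)"
    "tensor_map H H ev ev (tensor_mult b.A b.dA X Y)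
      = tensor_mult H (dot H) (tensor_map H H ev ev X) (tensor_map H H ev ev Y)"
    if "X \<in> carr (tensor b.A b.A)" "Y \<in> carr (tensor b.A b.A)" for X Y
    by (rule tensor_map_mult[OF b.A B b.A_bl st_bl ev_A_lm]; use ev_A_mult that in simp)
      (rule tensor_map_mult[OF b.A B b.A_bl d_bl ev_A_lm]; use ev_A_mult that in simp)
  have cls: "ev (two_as_class R s) = eval s" for s by (simp add: b.class_eq ev_cl)
  show "linear_map b.FE T (\<lambda>f. tensor_map H H ev ev (b.comulE f))"
    by (rule lm_comp[OF b.comulE_lm tl])
  show "linear_map b.FE T (\<lambda>f. comul H (ev f))"
    by (rule lm_comp[OF ev_lm D])
  fix s assume "s \<in> exprs R"
  then have "tensor_map H H ev ev (expr_comul R s) = comul H (eval s)"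
  proof (induction s)
    case (EGen v)
    then have "prim v" by (simp add: R_sel)
    then show ?case using EGen by (simp add: lm_add[OF tl] tt cls prim_def)
  next
    case (EDot s u)
    have c: "tensor_mult b.A b.dA X Y \<in> carr (tensor b.A b.A)"
      if "X \<in> carr (tensor b.A b.A)" "Y \<in> carr (tensor b.A b.A)" for X Y
      by (rule bl_closed[OF tensor_mult_bl[OF b.A b.A_bl] that]) simp
    show ?case
      using EDot by (simp add: lm_add[OF tl] lm_diff[OF _ tl] tt cls tm c b.expr_comul_closed D_d)
  qed (simp_all add: tt cls tm b.expr_comul_closed D_one D_st)
  then show "tensor_map H H ev ev (b.comulE (basis s)) = comul H (ev (basis s))" by simp
qed

lemma ev_comulU:
  assumes x: "x \<in> carr b.U"
  shows "comul H (ev x) = tensor_map H H ev ev (b.comulU x)"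
proof -
  have X: "b.comulE x \<in> carr (tensor b.A b.A)"
    using lm_closed[OF b.comulE_lm] b.A_sub[OF b.U_sub[OF x]] by simp
  have "tensor_map H H ev ev (b.comulU x) = tensor_map H H (\<lambda>x. ev (b.\<pi> x)) (\<lambda>x. ev (b.\<pi> x)) (b.comulE x)"
    by (rule tensor_map_comp[OF b.A b.A b.U b.U B B b.pi_lm b.pi_lm ev_U_lm ev_U_lm X])
  also have "\<dots> = comul H (ev x)"
    using ev_comulE[OF b.A_sub[OF b.U_sub[OF x]]] by (simp only: ev_pi)
  finally show ?thesis ..
qed

text \<open>The factorisation of the word map through \<open>U2\<close>. The composite is written
  out by \<open>lin_ext\<close>, since \<open>from_words\<close> is introduced under connectedness,
  which is not assumed here.\<close>

lemma ev_words_U: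
  assumes X: "X \<in> carr (word_space (Prim H))"
  shows "ev (b.words_U X) = lin_ext (scl H) dp X"
proof (rule word_eqI[OF is_vspace_Prim X])
  show "linear_map (word_space (Prim H)) H (\<lambda>X. ev (b.words_U X))"
    using lm_comp[OF b.words_U_lm ev_U_lm] unfolding R_words .
  have ml: "multilinear (Prim H) H dp" using dp_ml[OF Prim_incl] by simp
  show "linear_map (word_space (Prim H)) H (lin_ext (scl H) dp)"
    by (rule word_lift_lm[OF _ B refl ml]) simp
  fix rs assume rs: "rs \<in> lists (carr (Prim H))"
  then have rs': "rs \<in> lists (carr R)" by (simp add: R_sel carr_Prim)
  have "ev (au.dp (map b.gU rs)) = dp rs"
    using rs'
  proof (induction rs)
    case (Cons r rs)
    then show ?case
      using ev_U_mult(2)[of "b.gU r" "au.dp (map b.gU rs)"] lm_closed[OF b.gU_lm, of r]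
        au.dp_closed[OF b.gU_lists, of rs]
      by (simp add: ev_pi ev_gn)
  qed (simp add: ev_one)
  then show "ev (b.words_U (word (Prim H) rs)) = lin_ext (scl H) dp (word (Prim H) rs)"
    using b.words_U_word[OF rs'] word_lift[OF is_vspace_Prim B refl ml rs] by (simp add: R_words)
qed

text \<open>The isomorphism \<phi> is arbitrary, so its inverse is only known to send each generator
  to some primitive element, not to the one it is named after. This suffices: \<open>U2\<close> is
  spanned by words in generators, hence \<open>H\<close> by words in primitive elements.\<close>

lemma connected_if_iso:
  assumes iso: "two_assoc_bialgebra_iso H (U2 R) \<phi>"
  shows "connected_coalgebra H"
proof -
  have ci: "coalgebra_iso H (U2 R) \<phi>" and one: "\<phi> \<I> = b.\<I>U"
    and dot: "\<And>x y. x \<in> carr H \<Longrightarrow> y \<in> carr H \<Longrightarrow> \<phi> (dot H x y) = b.dU (\<phi> x) (\<phi> y)"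
    using iso by (auto simp: two_assoc_bialgebra_iso_def)
  have bij: "bij_betw \<phi> (carr H) (carr b.U)" using ci by (simp add: coalgebra_iso_def)
  let ?g = "inv_into (carr H) \<phi>"
  have U2v: "is_vspace (U2 R)" using b.U by (simp add: is_vspace_def del: b.U)
  have inv: "coalgebra_iso (U2 R) H ?g" by (rule coalgebra_iso_inv[OF B U2v D ci])
  have g: "linear_map b.U H ?g"
    and gc: "\<And>x. x \<in> carr b.U \<Longrightarrow> comul H (?g x) = tensor_map H H ?g ?g (b.comulU x)"
    using inv by (auto simp: coalgebra_iso_def linear_map_def)
  have g\<phi>: "?g (\<phi> x) = x" if "x \<in> carr H" for x
    using bij that by (simp add: bij_betw_inv_into_left)
  have \<phi>g: "\<phi> (?g x) = x" if "x \<in> carr b.U" for x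
    using bij that by (simp add: bij_betw_def f_inv_into_f)
  have g1: "?g b.\<I>U = \<I>" using g\<phi>[OF e] one by simp
  have gd: "?g (b.dU x y) = dot H (?g x) (?g y)" if "x \<in> carr b.U" "y \<in> carr b.U" for x y
    using g\<phi>[of "dot H (?g x) (?g y)"] dot[of "?g x" "?g y"] that lm_closed[OF g] by (simp add: \<phi>g)
  have gp: "prim (?g (b.gU r))" if r: "r \<in> carr R" for r
    using gc[OF lm_closed[OF b.gU_lm r]] b.comulU_gU[OF r] lm_closed[OF b.gU_lm r]
      lm_closed[OF g lm_closed[OF b.gU_lm r]]
    by (simp add: prim_def lm_add[OF tensor_map_lm[OF b.U b.U B B g g]]
        tensor_map_tens[OF b.U b.U B B g g] g1)
  have gdp: "?g (au.dp (map b.gU rs)) = dp (map (\<lambda>r. ?g (b.gU r)) rs)" if "rs \<in> lists (carr R)" for rs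
    using that
  proof (induction rs)
    case (Cons r rs)
    then show ?case
      using gd[of "b.gU r" "au.dp (map b.gU rs)"] lm_closed[OF b.gU_lm, of r]
        au.dp_closed[OF b.gU_lists, of rs] by simp
  qed (simp add: g1)
  have m: "module (scl H)" by (rule is_vspaceD(2)[OF B])
  let ?S = "module.span (scl H) (dp ` lists (Collect prim))"
  have "?g (b.words_U X) \<in> ?S" if "X \<in> carr (word_space R)" for X
    using that
  proof (rule word_induct[OF b.R], goal_cases)
    case 1
    then show ?case
      using lm_zero[OF is_vspace_word_space[OF b.R] lm_comp[OF b.words_U_lm g]]
      by (simp add: module.span_zero[OF m])
  next
    case (2 c vs)
    have "map (\<lambda>r. ?g (b.gU r)) vs \<in> lists (Collect prim)" using gp 2 by auto
    then have "?g (b.words_U (word R vs)) \<in> ?S"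
      unfolding b.words_U_word[OF 2] gdp[OF 2] by (intro module.span_base[OF m] imageI)
    then show ?case
      using lm_scl[OF lm_comp[OF b.words_U_lm g] word_closed[OF b.R 2], of c]
      by (simp add: module.span_scale[OF m])
  next
    case (3 X Y)
    then show ?case
      using lm_add[OF lm_comp[OF b.words_U_lm g], of X Y] by (simp add: module.span_add[OF m])
  qed
  moreover have "x \<in> (\<lambda>X. ?g (b.words_U X)) ` carr (word_space R)" if x: "x \<in> carr H" for x
  proof -
    have "\<phi> x \<in> carr b.U" using bij x by (auto simp: bij_betw_def)
    then obtain X where "X \<in> carr (word_space R)" "\<phi> x = b.words_U X" using b.words_U_surj by blast
    then show ?thesis using g\<phi>[OF x] by (metis imageI)
  qed
  ultimately have "carr H \<subseteq> ?S" by blast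
  then show ?thesis by (rule connected_if_generated)
qed

end

context connected_two_as
begin

interpretation b: binf R by (rule R_binf)

lemma iso_U2: "\<exists>\<phi>. two_assoc_bialgebra_iso H (U2 R) \<phi>"
proof -
  have evw: "ev (b.words_U X) = from_words X" if "X \<in> carr TP" for X
    using ev_words_U[OF that] by (simp add: from_words_def)
  have surj: "x \<in> b.words_U ` carr TP" if "x \<in> carr b.U" for x
    using b.words_U_surj[OF that] by (simp add: R_words)
  have wcl: "b.words_U X \<in> carr b.U" if "X \<in> carr TP" for X
    using lm_closed[OF b.words_U_lm] that by (simp add: R_words)
  have bij: "bij_betw ev (carr b.U) (carr H)"
    unfolding bij_betw_def
  proof (intro conjI inj_onI equalityI subsetI)
    fix x y assume "x \<in> carr b.U" "y \<in> carr b.U" and eq: "ev x = ev y"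
    then obtain X Y where X: "X \<in> carr TP" "x = b.words_U X" and Y: "Y \<in> carr TP" "y = b.words_U Y"
      using surj by blast
    then have "from_words X = from_words Y" using eq evw by simp
    then have "X = Y" using from_words_bij X Y by (auto simp: bij_betw_def dest: inj_onD)
    then show "x = y" using X Y by simp
  next
    fix x assume "x \<in> carr H"
    then obtain X where "X \<in> carr TP" "x = from_words X"
      using from_words_bij by (auto simp: bij_betw_def)
    then show "x \<in> ev ` carr b.U"
      using imageI[of "b.words_U X" "carr b.U" ev] evw[of X] wcl[of X] by simp
  qed (auto intro: lm_closed[OF ev_U_lm])
  have U2v: "is_vspace (U2 R)" using b.U by (simp add: is_vspace_def del: b.U)
  have iso: "coalgebra_iso (U2 R) H ev"
    unfolding coalgebra_iso_def
    using ev_U_lm bij ev_comulU ev_counit b.A_sub[OF b.U_sub] by (simp add: linear_map_def)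
  have c: "linear_map (U2 R) (tensor (U2 R) (U2 R)) (comul (U2 R))"
    using lm_comp[OF U_incl b.comulU_lm] by (simp add: linear_map_def)
  let ?g = "inv_into (carr b.U) ev"
  have g: "coalgebra_iso H (U2 R) ?g" using coalgebra_iso_inv[OF U2v B c iso] by simp
  have gl: "linear_map H b.U ?g"
    using g by (auto simp: coalgebra_iso_def linear_map_def)
  have gev: "?g (ev x) = x" if "x \<in> carr b.U" for x
    using bij_betw_inv_into_left[OF bij that] by simp
  have evg: "ev (?g x) = x" if "x \<in> carr H" for x
    using bij that by (simp add: bij_betw_def f_inv_into_f)
  interpret au: two_as_algebra b.U b.stU b.dU b.\<I>U by (rule b.algU)
  have "?g \<I> = b.\<I>U" using gev[OF au.e] ev_one by simp
  moreover have "?g (star H x y) = b.stU (?g x) (?g y)" "?g (dot H x y) = b.dU (?g x) (?g y)"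
    if "x \<in> carr H" "y \<in> carr H" for x y
    using gev[OF au.closed(1), of "?g x" "?g y"] gev[OF au.closed(2), of "?g x" "?g y"]
      ev_U_mult[of "?g x" "?g y"] that lm_closed[OF gl] by (simp_all add: evg)
  ultimately have "two_assoc_bialgebra_iso H (U2 R) ?g"
    unfolding two_assoc_bialgebra_iso_def using g by simp
  then show ?thesis by blast
qed

end

section \<open>Cofree bialgebras carry a second product\<close>

lemma subspace_lm_kernel:
  assumes V: "is_vspace V" and f: "linear_map V U f" and U: "is_vspace U"
  shows "module.subspace (scl V) {x \<in> carr V. f x = 0}"
  unfolding module.subspace_def[OF is_vspaceD(2)[OF V]]
  using V U by (simp add: lm_zero[OF V f] lm_add[OF f] lm_scl[OF f])

text \<open>The counterpart of \<open>is_vspace_Prim\<close> for a cofree bialgebra, where a second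
  product is yet to be constructed: primitive elements form the kernel of a linear map.\<close>

lemma is_vspace_Prim_coalgebra:
  assumes C [simp]: "is_vspace C" and D: "linear_map C (tensor C C) (comul C)" and [simp]: "one C \<in> carr C"
  shows "is_vspace (Prim C)"
proof -
  note t = tens_bl[OF C C]
  have lm: "linear_map C (tensor C C) (\<lambda>x. comul C x - tens C C x (one C) - tens C C (one C) x)"
    by (intro lm_minus D bl_left[OF t] bl_right[OF t]) simp_all
  have "module.subspace (scl C) {x \<in> carr C. comul C x - tens C C x (one C) - tens C C (one C) x = 0}"
    by (rule subspace_lm_kernel[OF C lm]) simp
  then show ?thesis
    using C by (simp add: is_vspace_def Prim_def reduced_comul_def)
qed

text \<open>A nonzero vector is independent, so the value \<open>1\<close> on it extends linearly.
  The functional detects that tensor powers of \<open>v\<close> do not vanish.\<close>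

lemma exists_functional:
  assumes V: "is_vspace V" and v: "v \<noteq> 0"
  obtains l where "linear_map V ground_field l" "l v = 1"
proof -
  interpret vector_space_pair "scl V" "(*)"
    using is_vspace_vector_space[OF V] is_vspace_vector_space[OF is_vspace_ground_field]
    by (simp add: vector_space_pair_def)
  have "vs1.independent {v}" using v by simp
  then obtain l where l: "Vector_Spaces.linear (scl V) (*) l" "\<forall>x\<in>{v}. l x = 1"
    using linear_independent_extend[of "{v}" "\<lambda>_. 1"] by blast
  have "linear_map V ground_field l"
    by (rule linear_mapI) (use l(1) in \<open>simp_all add: Vector_Spaces.linear_iff\<close>)
  then show thesis using that l(2) by simp
qed

context
  fixes V :: "('k::field, 'v::ab_group_add, 'z) vspace_scheme"
  assumes V [simp]: "is_vspace V"
begin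

abbreviation (input) "W \<equiv> word_space V"
abbreviation (input) "\<Delta> \<equiv> comul (tensor_coalgebra V)"

lemma W [simp]: "is_vspace W"
  by simp

lemmas wl [simp] = word_closed[OF V]
lemmas W_bl = wcat_bl[OF V] and W_lm = comul_word_lm[OF V]

text \<open>For a concatenation with seam at \<open>a\<close>, the cuts from the seam on and the
  cuts up to the seam count the seam twice. The subtracted \<open>f a\<close> is the term
  \<open>x \<otimes> y\<close> in the infinitesimal compatibility of concatenation and
  deconcatenation.\<close>

lemma sum_split_overlap: "(\<Sum>i\<le>a + b. f i) = (\<Sum>j\<le>b. f (a + j)) + (\<Sum>i\<le>a. f i) - (f a :: 'a::ab_group_add)"
  for a b :: nat
  by (induction b) (simp_all add: algebra_simps)

lemma comul_wcat:
  assumes X: "X \<in> carr W" and Y: "Y \<in> carr W"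
  shows "\<Delta> (wcat V X Y) = tensor_mult W (wcat V) (tens W W X (word V [])) (\<Delta> Y)
    + tensor_mult W (wcat V) (\<Delta> X) (tens W W (word V []) Y) - tens W W X Y"
proof -
  note tb = tensor_mult_bl[OF W W_bl] and te = tens_bl[OF W W] and tt = tensor_mult_tens[OF W W_bl]
  let ?R = "\<lambda>X Y. tensor_mult W (wcat V) (tens W W X (word V [])) (\<Delta> Y)
    + tensor_mult W (wcat V) (\<Delta> X) (tens W W (word V []) Y) - tens W W X Y"
  have n: "word V [] \<in> carr W" by simp
  have R: "bilinear_map W W (tensor W W) ?R"
    unfolding bilinear_map_def
  proof (intro conjI ballI lm_minus lm_plus)
    fix X assume X: "X \<in> carr W"
    note c = lm_closed[OF W_lm X] tens_closed[OF W W X n] tens_closed[OF W W n X]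
    show "linear_map W (tensor W W) (\<lambda>Y. tensor_mult W (wcat V) (tens W W X (word V [])) (\<Delta> Y))"
      by (rule lm_comp[OF W_lm bl_right[OF tb c(2)]])
    show "linear_map W (tensor W W) (\<lambda>Y. tensor_mult W (wcat V) (\<Delta> X) (tens W W (word V []) Y))"
      by (rule lm_comp[OF bl_right[OF te n] bl_right[OF tb c(1)]])
    show "linear_map W (tensor W W) (tens W W X)" by (rule bl_right[OF te X])
    show "linear_map W (tensor W W) (\<lambda>Y. tensor_mult W (wcat V) (tens W W Y (word V [])) (\<Delta> X))"
      by (rule lm_comp[OF bl_left[OF te n] bl_left[OF tb c(1)]])
    show "linear_map W (tensor W W) (\<lambda>Y. tensor_mult W (wcat V) (\<Delta> Y) (tens W W (word V []) X))"
      by (rule lm_comp[OF W_lm bl_left[OF tb c(3)]])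
    show "linear_map W (tensor W W) (\<lambda>Y. tens W W Y X)" by (rule bl_left[OF te X])
  qed simp_all
  note L = bl_lm[OF W_bl W_lm]
  have words: "\<Delta> (wcat V (word V us) (word V vs)) = ?R (word V us) (word V vs)"
    if us: "us \<in> lists (carr V)" and vs: "vs \<in> lists (carr V)" for us vs
  proof -
    note tl = take_lists[OF us] drop_lists[OF us] take_lists[OF vs] drop_lists[OF vs]
    let ?f = "\<lambda>i. tens W W (word V (take i (us @ vs))) (word V (drop i (us @ vs)))"
    have "tensor_mult W (wcat V) (tens W W (word V us) (word V [])) (\<Delta> (word V vs))
       = (\<Sum>j\<le>length vs. ?f (length us + j))"
      using us vs by (simp add: comul_word bl_sum_right[OF _ tb] tl tt wcat_word)
    moreover have "tensor_mult W (wcat V) (\<Delta> (word V us)) (tens W W (word V []) (word V vs))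
       = (\<Sum>i\<le>length us. ?f i)"
      using us vs by (simp add: comul_word bl_sum_left[OF _ tb] tl tt wcat_word)
    moreover have "tens W W (word V us) (word V vs) = ?f (length us)" by simp
    moreover have "\<Delta> (wcat V (word V us) (word V vs)) = (\<Sum>i\<le>length us + length vs. ?f i)"
      using us vs comul_word[OF V, of "us @ vs"] by (simp add: wcat_word del: take_append drop_append)
    ultimately show ?thesis by (simp only: sum_split_overlap)
  qed
  have 1: "\<Delta> (wcat V (word V us) Y) = ?R (word V us) Y" if us: "us \<in> lists (carr V)" for us
    by (rule word_eqI[OF V Y bl_right[OF L] bl_right[OF R]]) (use us words in auto)
  show ?thesis
    by (rule word_eqI[OF V X bl_left[OF L] bl_left[OF R]]) (use Y 1 in auto)
qed

section \<open>Length components and group-like elements of the tensor coalgebra\<close>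

definition degree_part :: "nat \<Rightarrow> ('v list \<Rightarrow>\<^sub>0 'k) \<Rightarrow> ('v list \<Rightarrow>\<^sub>0 'k)" where
  "degree_part n = lin_ext pscale (\<lambda>vs. if length vs = n then word V vs else 0)"

lemma degree_part_ml: "multilinear V W (\<lambda>vs. if length vs = n then word V vs else 0)"
  unfolding multilinear_def
proof (intro conjI ballI)
  show "linear_map V W (\<lambda>x. if length (us @ x # ws) = n then word V (us @ x # ws) else 0)"
    if "us \<in> lists (carr V)" "ws \<in> lists (carr V)" for us ws
    by (cases "length us + Suc (length ws) = n")
      (use ml_lm[OF word_ml[OF V] that] in \<open>simp_all add: lm_const_zero\<close>)
qed simp

lemma degree_part_lm: "linear_map W W (degree_part n)"
  unfolding degree_part_def by (rule word_lift_lm[OF V W scl_word_space degree_part_ml])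

lemma degree_part_word:
  "vs \<in> lists (carr V) \<Longrightarrow> degree_part n (word V vs) = (if length vs = n then word V vs else 0)"
  unfolding degree_part_def by (rule word_lift[OF V W scl_word_space degree_part_ml])

text \<open>A word has at most one cut into pieces of lengths \<open>n\<close> and \<open>m\<close>,
  and it has one exactly when its length is \<open>n + m\<close>; joining the pieces restores the
  word.\<close>

lemma degree_part_comul:
  assumes X: "X \<in> carr W"
  shows "lin_ext pscale (\<lambda>(a, b). wcat V (degree_part n a) (degree_part m b)) (\<Delta> X) = degree_part (n + m) X"
proof -
  note bl = bl_comp[OF W_bl degree_part_lm[of n] degree_part_lm[of m]]
  note ll = lift_lm[OF W W W scl_word_space bl] and lt = lift_tens[OF W W W scl_word_space bl]
  show ?thesis
  proof (rule word_eqI[OF V X lm_comp[OF W_lm ll] degree_part_lm])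
    fix vs assume vs: "vs \<in> lists (carr V)"
    note tl = take_lists[OF vs] drop_lists[OF vs]
    have "wcat V (degree_part n (word V (take i vs))) (degree_part m (word V (drop i vs)))
      = (if i = n then if length vs = n + m then word V vs else 0 else 0)" if "i \<le> length vs" for i
    proof (cases "i = n \<and> length vs = n + m")
      case True
      then show ?thesis using wcat_word[OF V tl(1)[of i] tl(2)[of i]] tl by (simp add: degree_part_word)
    next
      case False
      then have "degree_part n (word V (take i vs)) = 0 \<or> degree_part m (word V (drop i vs)) = 0"
        using that by (auto simp: degree_part_word tl)
      then show ?thesis
        using False bl_zero_left[OF W W_bl lm_closed[OF degree_part_lm wl[OF tl(2)]]]
          bl_zero_right[OF W W_bl lm_closed[OF degree_part_lm wl[OF tl(1)]]] by auto
    qed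
    then have "lin_ext pscale (\<lambda>(a, b). wcat V (degree_part n a) (degree_part m b)) (\<Delta> (word V vs))
      = (\<Sum>i\<le>length vs. if i = n then if length vs = n + m then word V vs else 0 else 0)"
      using vs by (simp add: comul_word lm_sum[OF _ ll] lt tl)
    also have "\<dots> = degree_part (n + m) (word V vs)"
      using vs by (auto simp: sum.delta degree_part_word)
    finally show "lin_ext pscale (\<lambda>(a, b). wcat V (degree_part n a) (degree_part m b)) (\<Delta> (word V vs))
      = degree_part (n + m) (word V vs)" .
  qed
qed

lemma degree_part_bounded: "X \<in> carr W \<Longrightarrow> \<exists>N. \<forall>n>N. degree_part n X = 0"
proof (induction rule: word_induct[OF V, consumes 1])
  case 1
  then show ?case using lm_zero[OF W degree_part_lm] by auto
next
  case (2 c vs)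
  then have "degree_part n (pscale c (word V vs)) = 0" if "n > length vs" for n
    using that lm_scl[OF degree_part_lm, of "word V vs" n c] by (simp add: degree_part_word)
  then show ?case by blast
next
  case (3 X Y)
  then obtain N M where "\<forall>n>N. degree_part n X = 0" "\<forall>n>M. degree_part n Y = 0" by blast
  then have "degree_part n (X + Y) = 0" if "n > max N M" for n
    using that lm_add[OF degree_part_lm 3(1,2), of n] by simp
  then show ?case by blast
qed

lemma degree_part_sum: "X \<in> carr W \<Longrightarrow> \<exists>N. \<forall>M\<ge>N. (\<Sum>n\<le>M. degree_part n X) = X"
proof (induction rule: word_induct[OF V, consumes 1])
  case 1
  then show ?case using lm_zero[OF W degree_part_lm] by auto
next
  case (2 c vs)
  have "degree_part n (pscale c (word V vs)) = (if n = length vs then pscale c (word V vs) else 0)" for n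
    using lm_scl[OF degree_part_lm, of "word V vs" n c] 2 by (simp add: degree_part_word)
  then have "(\<Sum>n\<le>M. degree_part n (pscale c (word V vs))) = pscale c (word V vs)" if "M \<ge> length vs" for M
    using that by simp
  then show ?case by blast
next
  case (3 X Y)
  then obtain N M where NM: "\<forall>L\<ge>N. (\<Sum>n\<le>L. degree_part n X) = X" "\<forall>L\<ge>M. (\<Sum>n\<le>L. degree_part n Y) = Y"
    by blast
  have "(\<Sum>n\<le>L. degree_part n (X + Y)) = X + Y" if "L \<ge> max N M" for L
    using that NM by (simp add: lm_add[OF degree_part_lm 3(1,2)] sum.distrib)
  then show ?case by blast
qed

text \<open>By linearity in the single letter, sums and multiples of one-letter words are again
  one-letter words, so this component is given by one vector.\<close>

lemma degree_part_1: "X \<in> carr W \<Longrightarrow> \<exists>v\<in>carr V. degree_part 1 X = word V [v]"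
proof (induction rule: word_induct[OF V, consumes 1])
  have ll: "linear_map V W (\<lambda>v. word V [v])"
    using ml_lm[OF word_ml[OF V], of "[]" "[]"] by simp
  {
    case 1
    then show ?case using lm_zero[OF V ll] lm_zero[OF W degree_part_lm] vs_zero[OF V] by metis
  next
    case (2 c vs)
    note s = lm_scl[OF degree_part_lm, of "word V vs" 1 c]
    show ?case
    proof (cases "length vs = 1")
      case True
      then obtain v where v: "vs = [v]" by (cases vs) auto
      then have "degree_part 1 (pscale c (word V vs)) = word V [scl V c v]"
        using s 2 lm_scl[OF ll, of v c] by (simp add: degree_part_word)
      then show ?thesis using v 2 vs_scl[OF V, of v c] by auto
    next
      case False
      then show ?thesis using s 2 lm_zero[OF V ll] by (auto simp: degree_part_word intro!: bexI[of _ 0])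
    qed
  next
    case (3 X Y)
    then obtain v w where vw: "v \<in> carr V" "degree_part 1 X = word V [v]" "w \<in> carr V" "degree_part 1 Y = word V [w]"
      by blast
    have "degree_part 1 (X + Y) = word V [v + w]"
      using lm_add[OF degree_part_lm 3(1,2), of 1] lm_add[OF ll, of v w] vw by simp
    then show ?case using vs_add[OF V vw(1,3)] by blast
  }
qed

lemma degree_part_0: "X \<in> carr W \<Longrightarrow> degree_part 0 X = pscale (counit (tensor_coalgebra V) X) (word V [])"
proof (rule word_eqI[OF V _ degree_part_lm])
  show "linear_map W W (\<lambda>X. pscale (counit (tensor_coalgebra V) X) (word V []))"
    using lm_scl_const[OF W _ counit_word_lm[OF V], of "word V []"] by simp
qed (auto simp: degree_part_word counit_word)

text \<open>A functional \<open>l\<close> with \<open>l v = 1\<close> extends to words by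
  multiplying the values of the letters. This is multilinear and equals \<open>1\<close> on every
  tensor power of \<open>v\<close>.\<close>

lemma word_replicate_nonzero:
  assumes v: "v \<in> carr V" "v \<noteq> 0"
  shows "word V (replicate n v) \<noteq> 0"
proof
  assume 0: "word V (replicate n v) = 0"
  obtain l where l: "linear_map V ground_field l" "l v = 1" by (rule exists_functional[OF V v(2)])
  have ml: "multilinear V ground_field (\<lambda>vs. prod_list (map l vs))"
    by (rule multilinearI) (auto simp: lm_add[OF l(1)] lm_scl[OF l(1)] algebra_simps)
  have "lin_ext (*) (\<lambda>vs. prod_list (map l vs)) (word V (replicate n v)) = prod_list (map l (replicate n v))"
    by (rule word_lift[OF V is_vspace_ground_field scl_ground_field ml]) (use v in auto)
  also have "\<dots> = 1" using l(2) by (induction n) auto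
  finally show False using 0 by simp
qed

text \<open>The components of a group-like element are \<open>w\<^sub>n = w\<^sub>1\<^sup>\<otimes>\<^sup>n\<close>, and almost all of them vanish, so \<open>w\<^sub>1 = 0\<close>.\<close>

lemma grouplike_unique:
  assumes u: "u \<in> carr W" and gl: "\<Delta> u = tens W W u u" and cu: "counit (tensor_coalgebra V) u = 1"
  shows "u = word V []"
proof -
  \<comment> \<open>Projecting the two factors of \<open>u \<otimes> u\<close> to lengths
    \<open>n\<close> and \<open>m\<close> and concatenating computes the same component as
    \<open>degree_part_comul\<close> does from the coproduct.\<close>
  have mult: "degree_part (n + m) u = wcat V (degree_part n u) (degree_part m u)" for n m
    using degree_part_comul[OF u, of n m] lift_tens[OF W W W scl_word_space
        bl_comp[OF W_bl degree_part_lm[of n] degree_part_lm[of m]] u u] by (simp add: gl)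
  obtain v where v: "v \<in> carr V" "degree_part 1 u = word V [v]" using degree_part_1[OF u] by blast
  have rep: "degree_part (Suc n) u = word V (replicate (Suc n) v)" for n
  proof (induction n)
    case (Suc n)
    have "degree_part (Suc (Suc n)) u = wcat V (word V [v]) (word V (replicate (Suc n) v))"
      using mult[of 1 "Suc n"] Suc v by simp
    then show ?case using v wcat_word[OF V, of "[v]" "replicate (Suc n) v"] by (simp add: in_lists_conv_set)
  qed (use v in simp)
  obtain N where N: "\<forall>n>N. degree_part n u = 0" using degree_part_bounded[OF u] by blast
  have "v = 0"
    using N[rule_format, of "Suc N"] rep[of N] word_replicate_nonzero[OF v(1), of "Suc N"] by auto
  then have 1: "degree_part 1 u = 0"
    using v lm_zero[OF V ml_lm[OF word_ml[OF V], of "[]" "[]"]] by simp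
  have high: "degree_part (Suc n) u = 0" for n
    using mult[of 1 n] 1 bl_zero_left[OF W W_bl lm_closed[OF degree_part_lm u]] by simp
  obtain M where "(\<Sum>n\<le>M. degree_part n u) = u" using degree_part_sum[OF u] by blast
  moreover have "(\<Sum>n\<le>M. degree_part n u) = degree_part 0 u"
    using high by (induction M) auto
  ultimately show ?thesis using degree_part_0[OF u] cu by simp
qed

end

section \<open>Notions unaffected by adjoining a second product\<close>

lemma with_dot_sel [simp]:
  "carr (with_dot H d) = carr H" "scl (with_dot H d) = scl H" "comul (with_dot H d) = comul H"
  "counit (with_dot H d) = counit H" "one (with_dot H d) = one H" "star (with_dot H d) = star H"
  "dot (with_dot H d) = d"
  by (simp_all add: with_dot_def bialg.extend_def bialg2.fields_def)

lemma with_dot_tensor [simp]: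
  fixes H :: "('k::field, 'v::ab_group_add) bialg" and X :: "('k, 'w::ab_group_add, 'z) vspace_scheme"
  shows "tensor (with_dot H d) X = tensor H X" "tensor X (with_dot H d) = tensor X H"
    "tens (with_dot H d) X = tens H X" "tens X (with_dot H d) = tens X H"
  by (rule tensor_cong; simp)+

lemma with_dot_tensor_maps [simp]:
  fixes H :: "('k::field, 'v::ab_group_add) bialg" and X :: "('k, 'w::ab_group_add, 'z) vspace_scheme"
  shows "tensor_mult (with_dot H d) = tensor_mult H"
    "tensor_map (with_dot H d) X = tensor_map H X" "tensor_map X (with_dot H d) = tensor_map X H"
  by (intro ext; simp add: tensor_mult_def tensor_map_def)+

lemma with_dot_linear_map [simp]:
  fixes H :: "('k::field, 'v::ab_group_add) bialg" and X :: "('k, 'w::ab_group_add, 'z) vspace_scheme"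
  shows "is_vspace (with_dot H d) = is_vspace H" "linear_map (with_dot H d) X = linear_map H X"
    "linear_map X (with_dot H d) = linear_map X H"
  by (auto simp: is_vspace_def linear_map_def fun_eq_iff)

lemma with_dot_bialgebra [simp]:
  fixes H :: "('k::field, 'v::ab_group_add) bialg"
  shows "bialgebra (with_dot H d) = bialgebra H"
    and "counital_coassociative (with_dot H d) = counital_coassociative H"
    and "unital_associative (with_dot H d) m e = unital_associative H m e"
proof -
  show 1: "unital_associative (with_dot H d) m e = unital_associative H m e" for m e
    by (simp add: unital_associative_def bilinear_map_def)
  have "tensor_assoc (with_dot H d) (with_dot H d) (with_dot H d) = tensor_assoc H H H"
    by (intro ext) (simp add: tensor_assoc_def)
  then show "counital_coassociative (with_dot H d) = counital_coassociative H"
    by (simp add: counital_coassociative_def)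
  then show "bialgebra (with_dot H d) = bialgebra H"
    by (simp add: bialgebra_def 1)
qed

lemma with_dot_coalgebra [simp]:
  fixes H :: "('k::field, 'v::ab_group_add) bialg"
  shows "reduced_comul (with_dot H d) = reduced_comul H" "Prim (with_dot H d) = Prim H"
    "filtration (with_dot H d) r = filtration H r"
    "connected_coalgebra (with_dot H d) = connected_coalgebra H"
    "coalgebra_iso (with_dot H d) X = coalgebra_iso H X"
proof -
  show 1: "reduced_comul (with_dot H d) = reduced_comul H"
    by (intro ext) (simp add: reduced_comul_def)
  then show "Prim (with_dot H d) = Prim H" by (simp add: Prim_def)
  have 2: "filtration (with_dot H d) r = filtration H r" for r by (induction r) (simp_all add: 1)
  then show "filtration (with_dot H d) r = filtration H r" .
  show "connected_coalgebra (with_dot H d) = connected_coalgebra H"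
    by (simp add: connected_coalgebra_def 2)
  show "coalgebra_iso (with_dot H d) X = coalgebra_iso H X"
    by (intro ext) (simp add: coalgebra_iso_def)
qed

text \<open>Only concatenation is carried over along \<phi>, while \<open>*\<close> stays as it is.
  The two products are tied together by the coproduct and the common unit alone, so nothing about
  \<phi> and \<open>*\<close> has to be checked.\<close>

lemma cofree_imp_two_as:
  fixes H :: "('k::field, 'v::ab_group_add) bialg"
  assumes H: "bialgebra H" and iso: "coalgebra_iso H (tensor_coalgebra (Prim H)) \<phi>"
  shows "\<exists>d. two_assoc_bialgebra (with_dot H d) \<and> connected_coalgebra H"
proof -
  let ?P = "Prim H" and ?W = "word_space (Prim H)" and ?TC = "tensor_coalgebra (Prim H)"
  have cc: "counital_coassociative H" and ua: "unital_associative H (star H) (one H)"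
    and c1: "comul H (one H) = tens H H (one H) (one H)" and e1: "counit H (one H) = 1"
    using H by (auto simp: bialgebra_def)
  note V = cc_vspace[OF cc] and D = cc_comul[OF cc] and I = ua_unit[OF ua]
  have P [simp]: "is_vspace ?P" by (rule is_vspace_Prim_coalgebra[OF V D I])
  have W [simp]: "is_vspace ?W" by simp
  have lm: "linear_map H ?W \<phi>" and bij: "bij_betw \<phi> (carr H) (carr ?W)"
    and cm: "\<And>x. x \<in> carr H \<Longrightarrow> comul ?TC (\<phi> x) = tensor_map ?W ?W \<phi> \<phi> (comul H x)"
    and cu: "\<And>x. x \<in> carr H \<Longrightarrow> counit ?TC (\<phi> x) = counit H x"
    using iso tc_simps[OF P] tc_tens[OF P]
    by (auto simp: coalgebra_iso_def linear_map_def tensor_map_def)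
  have \<phi>1: "\<phi> (one H) = word ?P []"
    by (rule grouplike_unique[OF P lm_closed[OF lm I]])
      (simp_all add: cm[OF I] cu[OF I] c1 e1 tensor_map_tens[OF V V W W lm lm] I)
  let ?g = "inv_into (carr H) \<phi>"
  have inv: "coalgebra_iso ?TC H ?g"
  proof (rule coalgebra_iso_inv[OF V _ D iso])
    show "is_vspace ?TC" using W by (simp only: is_vspace_def tc_simps[OF P] scl_word_space)
  qed
  have g: "linear_map ?W H ?g"
    and gc: "\<And>X. X \<in> carr ?W \<Longrightarrow> comul H (?g X) = tensor_map H H ?g ?g (comul ?TC X)"
    using inv tc_simps[OF P] by (auto simp: coalgebra_iso_def linear_map_def)
  have g\<phi>: "?g (\<phi> x) = x" if "x \<in> carr H" for x
    using bij that by (simp add: bij_betw_inv_into_left)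
  have \<phi>g: "\<phi> (?g X) = X" if "X \<in> carr ?W" for X
    using bij that by (simp add: bij_betw_def f_inv_into_f)
  have g1: "?g (word ?P []) = one H" using g\<phi>[OF I] \<phi>1 by simp
  note wb = wcat_bl[OF P]
  define d where "d x y = ?g (wcat ?P (\<phi> x) (\<phi> y))" for x y
  have d_bl: "bilinear_map H H H d"
    unfolding d_def by (rule bl_comp[OF bl_lm[OF wb g] lm lm])
  have gd: "?g (wcat ?P X Y) = d (?g X) (?g Y)" if "X \<in> carr ?W" "Y \<in> carr ?W" for X Y
    using that by (simp add: d_def \<phi>g)
  have \<phi>d: "\<phi> (d x y) = wcat ?P (\<phi> x) (\<phi> y)" if "x \<in> carr H" "y \<in> carr H" for x y
    unfolding d_def using that by (intro \<phi>g bl_closed[OF wb] lm_closed[OF lm])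
  have d_ua: "unital_associative H d (one H)"
    unfolding unital_associative_def
  proof (intro conjI ballI)
    fix x assume x: "x \<in> carr H"
    show "d (one H) x = x" "d x (one H) = x"
      using wcat_unit[OF P lm_closed[OF lm x]] by (simp_all add: d_def \<phi>1 g\<phi> x)
    fix y z assume y: "y \<in> carr H" and z: "z \<in> carr H"
    show "d (d x y) z = d x (d y z)"
      using wcat_assoc[OF P lm_closed[OF lm x] lm_closed[OF lm y] lm_closed[OF lm z]] \<phi>d[OF x y] \<phi>d[OF y z]
      by (simp add: d_def[of "d x y"] d_def[of x "d y z"])
  qed (use V I d_bl in auto)
  have d_comul: "comul H (d x y) = tensor_mult H d (tens H H x (one H)) (comul H y)
      + tensor_mult H d (comul H x) (tens H H (one H) y) - tens H H x y"
    if x: "x \<in> carr H" and y: "y \<in> carr H" for x y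
  proof -
    let ?X = "\<phi> x" and ?Y = "\<phi> y" and ?n = "word ?P []"
    have X: "?X \<in> carr ?W" and Y: "?Y \<in> carr ?W" and n: "?n \<in> carr ?W"
      using x y lm_closed[OF lm] by (auto simp: word_closed)
    note tl = tensor_map_lm[OF W W V V g g] and tt = tensor_map_tens[OF W W V V g g]
    note C = lm_closed[OF comul_word_lm[OF P]]
    have m: "tensor_map H H ?g ?g (tensor_mult ?W (wcat ?P) A B)
      = tensor_mult H d (tensor_map H H ?g ?g A) (tensor_map H H ?g ?g B)"
      if "A \<in> carr (tensor ?W ?W)" "B \<in> carr (tensor ?W ?W)" for A B
    proof (rule tensor_map_mult[OF W V wb d_bl g _ that])
      show "?g (wcat ?P X Y) = d (?g X) (?g Y)" if "X \<in> carr ?W" "Y \<in> carr ?W" for X Y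
        by (rule gd[OF that])
    qed
    note tb = bl_closed[OF tensor_mult_bl[OF W wb]]
    have gX: "tensor_map H H ?g ?g (comul ?TC ?X) = comul H x" "tensor_map H H ?g ?g (comul ?TC ?Y) = comul H y"
      using gc[OF X] gc[OF Y] g\<phi> x y by simp_all
    have "comul H (d x y) = tensor_map H H ?g ?g (comul ?TC (wcat ?P ?X ?Y))"
      unfolding d_def by (rule gc[OF bl_closed[OF wb X Y]])
    also have "\<dots> = tensor_mult H d (tens H H x (one H)) (comul H y)
      + tensor_mult H d (comul H x) (tens H H (one H) y) - tens H H x y"
      unfolding comul_wcat[OF P X Y]
      using X Y n C[OF X] C[OF Y]
      by (simp add: lm_diff[OF _ tl] lm_add[OF tl] tb m tt gX g1 g\<phi> x y)
    finally show ?thesis .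
  qed
  have two: "two_assoc_bialgebra (with_dot H d)"
    using H cc d_ua d_comul by (simp add: two_assoc_bialgebra_def unital_infinitesimal_bialgebra_def)
  interpret G: two_as_bialgebra "with_dot H d" by unfold_locales (rule two)
  \<comment> \<open>\<phi> need not send a primitive element \<open>v\<close> to the letter
    \<open>v\<close>, so the preimage of a letter is merely some primitive element, which is enough
    for the words to span.\<close>
  have prims: "G.prim (?g (word ?P [v]))" if v: "v \<in> carr ?P" for v
  proof -
    have c: "word ?P [v] \<in> carr ?W" "word ?P [] \<in> carr ?W" using v by (auto intro: word_closed)
    have "comul ?TC (word ?P [v]) = tens ?W ?W (word ?P []) (word ?P [v]) + tens ?W ?W (word ?P [v]) (word ?P [])"
      using v by (simp add: comul_word)
    then show ?thesis
      unfolding G.prim_def using c gc[OF c(1)] lm_closed[OF g c(1)]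
      by (simp add: lm_add[OF tensor_map_lm[OF W W V V g g]]
          tensor_map_tens[OF W W V V g g] g1 add.commute)
  qed
  have words: "?g (word ?P vs) = G.dp (map (\<lambda>v. ?g (word ?P [v])) vs)" if "vs \<in> lists (carr ?P)" for vs
    using that
  proof (induction vs)
    case (Cons v vs)
    then have "word ?P (v # vs) = wcat ?P (word ?P [v]) (word ?P vs)" by (simp add: wcat_word)
    then show ?case
      using Cons gd[of "word ?P [v]" "word ?P vs"]
      by (simp add: word_closed G.dp_simps[unfolded with_dot_sel])
  qed (simp add: g1 G.dp_simps[unfolded with_dot_sel])
  have m: "module (scl H)" by (rule is_vspaceD(2)[OF V])
  let ?S = "module.span (scl H) (G.dp ` lists (Collect G.prim))"
  have span: "?g X \<in> ?S" if "X \<in> carr ?W" for X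
    using that
  proof (rule word_induct[OF P], goal_cases)
    case 1
    then show ?case using lm_zero[OF W g] by (simp add: module.span_zero[OF m])
  next
    case (2 c vs)
    have "map (\<lambda>v. ?g (word ?P [v])) vs \<in> lists (Collect G.prim)" using prims 2 by auto
    then have "?g (word ?P vs) \<in> ?S"
      unfolding words[OF 2] by (intro module.span_base[OF m] imageI)
    then show ?case
      using lm_scl[OF g word_closed[OF P 2], of c] by (simp add: module.span_scale[OF m])
  next
    case (3 X Y)
    then show ?case using lm_add[OF g, of X Y] by (simp add: module.span_add[OF m])
  qed
  have "carr H \<subseteq> ?S"
  proof
    fix x assume x: "x \<in> carr H"
    show "x \<in> ?S" using span[OF lm_closed[OF lm x]] unfolding g\<phi>[OF x] .
  qed
  then have "connected_coalgebra (with_dot H d)"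
    by (intro G.connected_if_generated) simp
  then show ?thesis using two by auto
qed

theorem theorem4p2:
  fixes H :: "('k::field, 'v::ab_group_add) bialg"
  assumes "bialgebra H"
  shows "((connected_coalgebra H \<and> (\<exists>d. two_assoc_bialgebra (with_dot H d))) \<longleftrightarrow>
          (\<exists>d. two_assoc_bialgebra (with_dot H d) \<and>
               (\<exists>\<phi>. two_assoc_bialgebra_iso (with_dot H d) (U2 (Prim_Binf (with_dot H d))) \<phi>)))
       \<and> ((\<exists>d. two_assoc_bialgebra (with_dot H d) \<and>
               (\<exists>\<phi>. two_assoc_bialgebra_iso (with_dot H d) (U2 (Prim_Binf (with_dot H d))) \<phi>)) \<longleftrightarrow>
          (\<exists>\<phi>. coalgebra_iso H (tensor_coalgebra (Prim H)) \<phi>))"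
    (is "(?conn \<and> (\<exists>d. ?two d) \<longleftrightarrow> (\<exists>d. ?two d \<and> ?iso d)) \<and> (_ \<longleftrightarrow> ?cofree)")
proof -
  \<comment> \<open>One product \<open>d\<close> serves both conclusions. From the enveloping and
    from the cofree form it then remains only to return to connectedness together with some
    product.\<close>
  have conn: "?iso d \<and> ?cofree" if "?conn" "?two d" for d
  proof -
    interpret G: connected_two_as "with_dot H d"
      by unfold_locales (use that in auto)
    show ?thesis using G.iso_U2 G.cofree by simp
  qed
  moreover have "?conn" if "?two d" "?iso d" for d
  proof -
    interpret G: two_as_bialgebra "with_dot H d" by unfold_locales (rule that(1))
    show ?thesis using that(2) G.connected_if_iso by auto
  qed
  moreover have "\<exists>d. ?two d \<and> ?conn" if "?cofree"
    using that cofree_imp_two_as[OF assms] by blast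
  ultimately show ?thesis by blast
qed

end
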